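(* Let $G$ be a connected Lie group, $H$ a compact subgroup of $G$, and $F$ a $G$-invariant Finsler metric on $G/H$, so that $(G/H,F)$ is a connected homogeneous Finsler space. Let $\mathfrak g=\mathfrak h+\mathfrak m$ be an $\mathrm{Ad}(H)$-invariant decomposition for $G/H$. Then for any linearly independent commuting pair $u,v\in\mathfrak m$ (that is, $[u,v]=0$) satisfying $\langle[u,\mathfrak m]_{\mathfrak m},u\rangle^F_u=0$, we have $$K^F(o,u,u\wedge v)=\frac{\langle U(u,v),U(u,v)\rangle^F_u}{\langle u,u\rangle^F_u\langle v,v\rangle^F_u-\langle u,v\rangle^F_u\langle u,v\rangle^F_u},$$ where $U$ is the bilinear symmetric mapping from $\mathfrak m\times\mathfrak m$ to $\mathfrak m$ (for the fixed reference vector $u$) whose value $U(u,v)$ is determined by $$\langle U(u,v),w\rangle^F_u=\frac12\left(\langle[w,u]_{\mathfrak m},v\rangle^F_u+\langle[w,v]_{\mathfrak m},u\rangle^F_u\right)\quad\text{for any } w\in\mathfrak m.$$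
   Context: $\mathfrak g=\mathrm{Lie}(G)$, $\mathfrak h=\mathrm{Lie}(H)$, and $o=eH\in G/H$. An $\mathrm{Ad}(H)$-invariant decomposition $\mathfrak g=\mathfrak h+\mathfrak m$ is one in which $\mathfrak m$ is the orthogonal complement of $\mathfrak h$ for some $\mathrm{Ad}(H)$-invariant inner product on $\mathfrak g$; then $\mathfrak m$ is identified with $T_o(G/H)$. The projection to $\mathfrak m$ along $\mathfrak h$ is $\mathrm{pr}_{\mathfrak m}$, and $[\cdot,\cdot]_{\mathfrak m}=\mathrm{pr}_{\mathfrak m}\circ[\cdot,\cdot]$. The condition $\langle[u,\mathfrak m]_{\mathfrak m},u\rangle_u^F=0$ means $\langle[u,w]_{\mathfrak m},u\rangle_u^F=0$ for all $w\in\mathfrak m$. A Minkowski norm on a finite-dimensional real vector space $V$ is a continuous function $F:V\to[0,\infty)$ that is positive and smooth on $V\setminus\{0\}$, satisfies $F(\lambda y)=\lambda F(y)$ for all $\lambda\ge 0$, and has positive definite Hessian $g_{ij}(y)=\frac12[F^2]_{y^iy^j}(y)$ at every $y\neq0$. For $y\ne 0$ put $\langle u,v\rangle_y=\langle u,v\rangle^F_y=g_{ij}(y)u^iv^j=\frac12\frac{\partial^2}{\partial s\partial t}F^2(y+su+tv)|_{s=t=0}$. A Finsler metric on a manifold $M$ is a continuous function $F:TM\to[0,\infty)$, positive and smooth on $TM\setminus 0$, whose restriction to each tangent space is a Minkowski norm. The restriction of $F$ to $T_o(G/H)=\mathfrak m$ is also denoted $F$. In standard local coordinates $(x^i,y^j)$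 of $TM$ let $G^i=\frac14 g^{il}([F^2]_{x^ky^l}y^k-[F^2]_{x^l})$. The Riemann curvature $R_y=R^i_k(y)\,\partial_{x^i}\otimes dx^k:T_xM\to T_xM$ is given by $R^i_k(y)=2\partial_{x^k}G^i-y^j\partial^2_{x^jy^k}G^i+2G^j\partial^2_{y^jy^k}G^i-\partial_{y^j}G^i\,\partial_{y^k}G^j$. For linearly independent $y,v\in T_xM$ the flag curvature is $K^F(x,y,y\wedge v)=\dfrac{\langle R_yv,v\rangle_y}{\langle y,y\rangle_y\langle v,v\rangle_y-\langle y,v\rangle_y^2}$. *)

theory Defs
  imports
    "HOL-Analysis.Analysis"
    "HOL-Library.Function_Algebras"
    "HOL-Algebra.Left_Coset"
begin

section \<open>Pointwise real vector space structure on functions\<close>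

instantiation "fun" :: (type, real_vector) real_vector
begin

definition scaleR_fun :: "real \<Rightarrow> ('a \<Rightarrow> 'b) \<Rightarrow> 'a \<Rightarrow> 'b" where
  "scaleR_fun r f = (\<lambda>x. r *\<^sub>R f x)"

instance
  by standard (simp_all add: scaleR_fun_def fun_eq_iff scaleR_add_right scaleR_add_left)

end


section \<open>Smooth functions between Euclidean spaces\<close>

text \<open>
  \<open>Ck_on k S f\<close> is meant for open \<open>S\<close>; only the behaviour of \<open>f\<close> on \<open>S\<close> matters then.
\<close>

primrec Ck_on ::
    "nat \<Rightarrow> 'e::euclidean_space set \<Rightarrow> ('e \<Rightarrow> 'f::real_normed_vector) \<Rightarrow> bool" where
  "Ck_on 0 S f \<longleftrightarrow> continuous_on S f"
| "Ck_on (Suc k) S f \<longleftrightarrow>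
     (\<forall>x\<in>S. f differentiable (at x)) \<and>
     (\<forall>b\<in>Basis. Ck_on k S (\<lambda>x. frechet_derivative f (at x) b))"

definition smooth_on ::
    "'e::euclidean_space set \<Rightarrow> ('e \<Rightarrow> 'f::real_normed_vector) \<Rightarrow> bool" where
  "smooth_on S f \<longleftrightarrow> (\<forall>k. Ck_on k S f)"


section \<open>Smooth manifolds\<close>

text \<open>A chart is a domain together with a coordinate map; the map is irrelevant off the domain.\<close>

type_synonym ('a, 'e) chart = "'a set \<times> ('a \<Rightarrow> 'e)"

abbreviation chart_inv :: "('a, 'e) chart \<Rightarrow> 'e \<Rightarrow> 'a" where
  "chart_inv c \<equiv> inv_into (fst c) (snd c)"

text \<open>The atlas need not be maximal.\<close>

record ('a, 'e) manifold =
  mtop :: "'a topology"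
  atlas :: "('a, 'e) chart set"

definition smooth_manifold :: "('a, 'e::euclidean_space) manifold \<Rightarrow> bool" where
  "smooth_manifold M \<longleftrightarrow>
     Hausdorff_space (mtop M) \<and> second_countable (mtop M) \<and>
     \<Union> (fst ` atlas M) = topspace (mtop M) \<and>
     (\<forall>c\<in>atlas M. openin (mtop M) (fst c) \<and> open (snd c ` fst c) \<and>
        homeomorphic_map (subtopology (mtop M) (fst c)) (top_of_set (snd c ` fst c)) (snd c)) \<and>
     (\<forall>c\<in>atlas M. \<forall>d\<in>atlas M.
        smooth_on (snd c ` (fst c \<inter> fst d)) (snd d \<circ> chart_inv c))"

definition charts_at :: "('a, 'e) manifold \<Rightarrow> 'a \<Rightarrow> ('a, 'e) chart set" where
  "charts_at M p = {c \<in> atlas M. p \<in> fst c}"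

definition smooth_map ::
    "('a, 'e::euclidean_space) manifold \<Rightarrow> ('b, 'f::euclidean_space) manifold \<Rightarrow> ('a \<Rightarrow> 'b) \<Rightarrow> bool" where
  "smooth_map M N f \<longleftrightarrow>
     continuous_map (mtop M) (mtop N) f \<and>
     (\<forall>c\<in>atlas M. \<forall>d\<in>atlas N.
        smooth_on (snd c ` {p \<in> fst c. f p \<in> fst d}) (snd d \<circ> f \<circ> chart_inv c))"

definition prod_manifold ::
    "('a, 'e) manifold \<Rightarrow> ('b, 'f) manifold \<Rightarrow> ('a \<times> 'b, 'e \<times> 'f) manifold" where
  "prod_manifold M N =
     \<lparr>mtop = prod_topology (mtop M) (mtop N),
      atlas = {(fst c \<times> fst d, map_prod (snd c) (snd d)) | c d. c \<in> atlas M \<and> d \<in> atlas N}\<rparr>"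

definition real_line :: "(real, real) manifold" where
  "real_line = \<lparr>mtop = euclidean, atlas = {(UNIV, \<lambda>x. x)}\<rparr>"


subsection \<open>Tangent vectors\<close>

text \<open>
  A tangent vector at \<open>p\<close> is the family of its components with respect to all charts around \<open>p\<close>,
  related by the Jacobians of the coordinate changes; it is set to 0 at all other charts, so that
  the vector space operations are pointwise and \<open>0\<close> is the zero vector.  As \<open>0\<close> is the zero
  vector at every point, functions on the tangent bundle take the base point as an argument.
\<close>

type_synonym ('a, 'e) tvec = "('a, 'e) chart \<Rightarrow> 'e"

definition tangent_space :: "('a, 'e::euclidean_space) manifold \<Rightarrow> 'a \<Rightarrow> ('a, 'e) tvec set" where
  "tangent_space M p =
     {v. (\<forall>c. c \<notin> charts_at M p \<longrightarrow> v c = 0) \<and>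
         (\<forall>c\<in>charts_at M p. \<forall>d\<in>charts_at M p.
            v d = frechet_derivative (snd d \<circ> chart_inv c) (at (snd c p)) (v c))}"

text \<open>The tangent vector at \<open>p\<close> whose components in the chart \<open>c\<close> are \<open>y\<close>.\<close>

definition tvec_of ::
    "('a, 'e::euclidean_space) manifold \<Rightarrow> 'a \<Rightarrow> ('a, 'e) chart \<Rightarrow> 'e \<Rightarrow> ('a, 'e) tvec" where
  "tvec_of M p c y =
     (\<lambda>d. if d \<in> charts_at M p
          then frechet_derivative (snd d \<circ> chart_inv c) (at (snd c p)) y else 0)"

text \<open>By the chain rule, the result does not depend on the chart selected by \<open>SOME\<close>.\<close>

definition differential ::
    "('a, 'e::euclidean_space) manifold \<Rightarrow> ('b, 'f::euclidean_space) manifold \<Rightarrow> ('a \<Rightarrow> 'b)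
       \<Rightarrow> 'a \<Rightarrow> ('a, 'e) tvec \<Rightarrow> ('b, 'f) tvec" where
  "differential M N f p v =
     (\<lambda>d. if d \<in> charts_at N (f p)
          then let c = (SOME c. c \<in> charts_at M p)
               in frechet_derivative (snd d \<circ> f \<circ> chart_inv c) (at (snd c p)) (v c)
          else 0)"

definition velocity ::
    "('a, 'e::euclidean_space) manifold \<Rightarrow> (real \<Rightarrow> 'a) \<Rightarrow> real \<Rightarrow> ('a, 'e) tvec" where
  "velocity M \<gamma> t =
     (\<lambda>c. if c \<in> charts_at M (\<gamma> t) then vector_derivative (snd c \<circ> \<gamma>) (at t) else 0)"

text \<open>In coordinates, \<open>[X,Y]\<^sup>i = X\<^sup>j \<partial>\<^sub>j Y\<^sup>i - Y\<^sup>j \<partial>\<^sub>j X\<^sup>i\<close>.\<close>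

definition field_bracket ::
    "('a, 'e::euclidean_space) manifold \<Rightarrow> ('a \<Rightarrow> ('a, 'e) tvec) \<Rightarrow> ('a \<Rightarrow> ('a, 'e) tvec)
       \<Rightarrow> 'a \<Rightarrow> ('a, 'e) tvec" where
  "field_bracket M X Y p =
     (\<lambda>c. if c \<in> charts_at M p
          then frechet_derivative (\<lambda>x. Y (chart_inv c x) c) (at (snd c p)) (X p c)
             - frechet_derivative (\<lambda>x. X (chart_inv c x) c) (at (snd c p)) (Y p c)
          else 0)"


section \<open>Lie groups\<close>

definition lie_group :: "'g monoid \<Rightarrow> ('g, 'e::euclidean_space) manifold \<Rightarrow> bool" where
  "lie_group G MG \<longleftrightarrow>
     group G \<and> smooth_manifold MG \<and> topspace (mtop MG) = carrier G \<and>
     smooth_map (prod_manifold MG MG) MG (\<lambda>(x, y). x \<otimes>\<^bsub>G\<^esub> y) \<and>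
     smooth_map MG MG (\<lambda>x. inv\<^bsub>G\<^esub> x)"

abbreviation lie_algebra ::
    "'g monoid \<Rightarrow> ('g, 'e::euclidean_space) manifold \<Rightarrow> ('g, 'e) tvec set" where
  "lie_algebra G MG \<equiv> tangent_space MG \<one>\<^bsub>G\<^esub>"

definition left_invariant_field ::
    "'g monoid \<Rightarrow> ('g, 'e::euclidean_space) manifold \<Rightarrow> ('g, 'e) tvec \<Rightarrow> 'g \<Rightarrow> ('g, 'e) tvec" where
  "left_invariant_field G MG u g = differential MG MG (\<lambda>x. g \<otimes>\<^bsub>G\<^esub> x) \<one>\<^bsub>G\<^esub> u"

definition lie_bracket ::
    "'g monoid \<Rightarrow> ('g, 'e::euclidean_space) manifold
       \<Rightarrow> ('g, 'e) tvec \<Rightarrow> ('g, 'e) tvec \<Rightarrow> ('g, 'e) tvec" where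
  "lie_bracket G MG u v =
     field_bracket MG (left_invariant_field G MG u) (left_invariant_field G MG v) \<one>\<^bsub>G\<^esub>"

definition Ad ::
    "'g monoid \<Rightarrow> ('g, 'e::euclidean_space) manifold \<Rightarrow> 'g \<Rightarrow> ('g, 'e) tvec \<Rightarrow> ('g, 'e) tvec" where
  "Ad G MG g = differential MG MG (\<lambda>x. g \<otimes>\<^bsub>G\<^esub> x \<otimes>\<^bsub>G\<^esub> inv\<^bsub>G\<^esub> g) \<one>\<^bsub>G\<^esub>"

definition one_parameter_subgroup ::
    "'g monoid \<Rightarrow> ('g, 'e::euclidean_space) manifold \<Rightarrow> (real \<Rightarrow> 'g) \<Rightarrow> bool" where
  "one_parameter_subgroup G MG \<gamma> \<longleftrightarrow>
     smooth_map real_line MG \<gamma> \<and> (\<forall>s t. \<gamma> (s + t) = \<gamma> s \<otimes>\<^bsub>G\<^esub> \<gamma> t)"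

text \<open>
  The Lie algebra of a closed subgroup \<open>H\<close>, as the subspace \<open>{u. \<forall>t. exp (t u) \<in> H}\<close> of the
  Lie algebra of \<open>G\<close>; the curve \<open>t \<mapsto> exp (t u)\<close> is the one-parameter subgroup with initial
  velocity \<open>u\<close>.
\<close>

definition lie_subalgebra_of ::
    "'g monoid \<Rightarrow> ('g, 'e::euclidean_space) manifold \<Rightarrow> 'g set \<Rightarrow> ('g, 'e) tvec set" where
  "lie_subalgebra_of G MG H =
     {u \<in> lie_algebra G MG.
        \<exists>\<gamma>. one_parameter_subgroup G MG \<gamma> \<and> velocity MG \<gamma> 0 = u \<and> (\<forall>t. \<gamma> t \<in> H)}"


section \<open>Homogeneous spaces\<close>

abbreviation coset_proj :: "'g monoid \<Rightarrow> 'g set \<Rightarrow> 'g \<Rightarrow> 'g set" where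
  "coset_proj G H \<equiv> \<lambda>g. g <#\<^bsub>G\<^esub> H"

text \<open>
  \<open>G/H\<close> carries the quotient topology and the (unique) smooth structure for which the canonical
  projection is a submersion.
\<close>

definition coset_manifold ::
    "'g monoid \<Rightarrow> ('g, 'e::euclidean_space) manifold \<Rightarrow> 'g set
       \<Rightarrow> ('g set, 'f::euclidean_space) manifold \<Rightarrow> bool" where
  "coset_manifold G MG H M \<longleftrightarrow>
     smooth_manifold M \<and> topspace (mtop M) = lcosets\<^bsub>G\<^esub> H \<and>
     quotient_map (mtop MG) (mtop M) (coset_proj G H) \<and>
     smooth_map MG M (coset_proj G H) \<and>
     (\<forall>g\<in>carrier G. differential MG M (coset_proj G H) g ` tangent_space MG g
                      = tangent_space M (g <#\<^bsub>G\<^esub> H))"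

definition inner_product_on :: "'v::real_vector set \<Rightarrow> ('v \<Rightarrow> 'v \<Rightarrow> real) \<Rightarrow> bool" where
  "inner_product_on V B \<longleftrightarrow>
     (\<forall>x\<in>V. \<forall>y\<in>V. B x y = B y x) \<and>
     (\<forall>x\<in>V. \<forall>y\<in>V. \<forall>z\<in>V. \<forall>a b. B (a *\<^sub>R x + b *\<^sub>R y) z = a * B x z + b * B y z) \<and>
     (\<forall>x\<in>V. x \<noteq> 0 \<longrightarrow> B x x > 0)"

definition invariant_decomposition ::
    "'g monoid \<Rightarrow> ('g, 'e::euclidean_space) manifold \<Rightarrow> 'g set \<Rightarrow> ('g, 'e) tvec set \<Rightarrow> bool" where
  "invariant_decomposition G MG H \<mm> \<longleftrightarrow>
     (\<exists>B. inner_product_on (lie_algebra G MG) B \<and>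
          (\<forall>h\<in>H. \<forall>x\<in>lie_algebra G MG. \<forall>y\<in>lie_algebra G MG.
             B (Ad G MG h x) (Ad G MG h y) = B x y) \<and>
          \<mm> = {w \<in> lie_algebra G MG. \<forall>x\<in>lie_subalgebra_of G MG H. B x w = 0})"

definition proj_along :: "'v::real_vector set \<Rightarrow> 'v set \<Rightarrow> 'v \<Rightarrow> 'v" where
  "proj_along \<hh> \<mm> x = (THE w. w \<in> \<mm> \<and> x - w \<in> \<hh>)"

definition bracket_m ::
    "'g monoid \<Rightarrow> ('g, 'e::euclidean_space) manifold \<Rightarrow> 'g set \<Rightarrow> ('g, 'e) tvec set
       \<Rightarrow> ('g, 'e) tvec \<Rightarrow> ('g, 'e) tvec \<Rightarrow> ('g, 'e) tvec" where
  "bracket_m G MG H \<mm> u v = proj_along (lie_subalgebra_of G MG H) \<mm> (lie_bracket G MG u v)"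

text \<open>The identification of \<open>\<mm>\<close> with the tangent space of \<open>G/H\<close> at the origin \<open>o = H\<close>.\<close>

definition to_origin ::
    "'g monoid \<Rightarrow> ('g, 'e::euclidean_space) manifold \<Rightarrow> 'g set
       \<Rightarrow> ('g set, 'f::euclidean_space) manifold \<Rightarrow> ('g, 'e) tvec \<Rightarrow> ('g set, 'f) tvec" where
  "to_origin G MG H M = differential MG M (coset_proj G H) \<one>\<^bsub>G\<^esub>"


section \<open>Finsler metrics\<close>

text \<open>\<open>\<langle>u, v\<rangle>\<^sub>y = 1/2 \<partial>\<^sup>2/\<partial>s\<partial>t F\<^sup>2(y + s u + t v)\<close> at \<open>s = t = 0\<close>\<close>

definition fund_tensor :: "('v::real_vector \<Rightarrow> real) \<Rightarrow> 'v \<Rightarrow> 'v \<Rightarrow> 'v \<Rightarrow> real" where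
  "fund_tensor F y u v =
     1 / 2 * deriv (\<lambda>s. deriv (\<lambda>t. (F (y + s *\<^sub>R u + t *\<^sub>R v))\<^sup>2) 0) 0"

definition minkowski_norm :: "('e::euclidean_space \<Rightarrow> real) \<Rightarrow> bool" where
  "minkowski_norm F \<longleftrightarrow>
     continuous_on UNIV F \<and> (\<forall>y. 0 \<le> F y) \<and>
     (\<forall>y. y \<noteq> 0 \<longrightarrow> 0 < F y) \<and> smooth_on (UNIV - {0}) F \<and>
     (\<forall>a\<ge>0. \<forall>y. F (a *\<^sub>R y) = a * F y) \<and>
     (\<forall>y v. y \<noteq> 0 \<longrightarrow> v \<noteq> 0 \<longrightarrow> fund_tensor F y v v > 0)"

text \<open>
  \<open>F p v\<close> is the value on the tangent vector \<open>v\<close> at \<open>p\<close>; in the standard coordinates \<open>(x, y)\<close>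
  of the tangent bundle induced by the chart \<open>c\<close> it is the following function.
\<close>

definition in_chart ::
    "('a, 'e::euclidean_space) manifold \<Rightarrow> ('a \<Rightarrow> ('a, 'e) tvec \<Rightarrow> real) \<Rightarrow> ('a, 'e) chart
       \<Rightarrow> 'e \<times> 'e \<Rightarrow> real" where
  "in_chart M F c = (\<lambda>(x, y). F (chart_inv c x) (tvec_of M (chart_inv c x) c y))"

definition finsler_metric ::
    "('a, 'e::euclidean_space) manifold \<Rightarrow> ('a \<Rightarrow> ('a, 'e) tvec \<Rightarrow> real) \<Rightarrow> bool" where
  "finsler_metric M F \<longleftrightarrow>
     (\<forall>c\<in>atlas M.
        continuous_on ((snd c ` fst c) \<times> UNIV) (in_chart M F c) \<and>
        smooth_on ((snd c ` fst c) \<times> (UNIV - {0})) (in_chart M F c) \<and>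
        (\<forall>x\<in>snd c ` fst c. minkowski_norm (\<lambda>y. in_chart M F c (x, y))))"

definition invariant_metric ::
    "'g monoid \<Rightarrow> ('g set, 'e::euclidean_space) manifold
       \<Rightarrow> ('g set \<Rightarrow> ('g set, 'e) tvec \<Rightarrow> real) \<Rightarrow> bool" where
  "invariant_metric G M F \<longleftrightarrow>
     (\<forall>g\<in>carrier G. \<forall>p\<in>topspace (mtop M). \<forall>v\<in>tangent_space M p.
        F (g <#\<^bsub>G\<^esub> p) (differential M M (\<lambda>q. g <#\<^bsub>G\<^esub> q) p v) = F p v)"


subsection \<open>Flag curvature\<close>

text \<open>
  Partial derivatives with respect to the standard coordinates \<open>(x\<^sup>i, y\<^sup>j)\<close>; below, \<open>L\<close> is the
  coordinate expression of \<open>F\<^sup>2\<close>.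
\<close>

definition pdx :: "'n \<Rightarrow> ((real^'n) \<times> (real^'n) \<Rightarrow> real) \<Rightarrow> (real^'n) \<times> (real^'n) \<Rightarrow> real" where
  "pdx k f = (\<lambda>(x, y). deriv (\<lambda>t. f (x + t *\<^sub>R axis k 1, y)) 0)"

definition pdy :: "'n \<Rightarrow> ((real^'n) \<times> (real^'n) \<Rightarrow> real) \<Rightarrow> (real^'n) \<times> (real^'n) \<Rightarrow> real" where
  "pdy k f = (\<lambda>(x, y). deriv (\<lambda>t. f (x, y + t *\<^sub>R axis k 1)) 0)"

definition metric_matrix ::
    "((real^'n) \<times> (real^'n) \<Rightarrow> real) \<Rightarrow> (real^'n) \<times> (real^'n) \<Rightarrow> real^'n^'n" where
  "metric_matrix L z = (\<chi> i j. 1 / 2 * pdy j (pdy i L) z)"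

definition spray_coeff ::
    "((real^'n) \<times> (real^'n) \<Rightarrow> real) \<Rightarrow> 'n \<Rightarrow> (real^'n) \<times> (real^'n) \<Rightarrow> real" where
  "spray_coeff L i = (\<lambda>z.
     1 / 4 * (\<Sum>l\<in>UNIV. matrix_inv (metric_matrix L z) $ i $ l *
                ((\<Sum>k\<in>UNIV. pdy l (pdx k L) z * snd z $ k) - pdx l L z)))"

definition riemann_coeff ::
    "((real^'n) \<times> (real^'n) \<Rightarrow> real) \<Rightarrow> 'n \<Rightarrow> 'n \<Rightarrow> (real^'n) \<times> (real^'n) \<Rightarrow> real" where
  "riemann_coeff L i k = (\<lambda>z.
     let S = spray_coeff L in
       2 * pdx k (S i) z
       - (\<Sum>j\<in>UNIV. snd z $ j * pdy k (pdx j (S i)) z)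
       + 2 * (\<Sum>j\<in>UNIV. S j z * pdy k (pdy j (S i)) z)
       - (\<Sum>j\<in>UNIV. pdy j (S i) z * pdy k (S j) z))"

definition riemann_curvature ::
    "('a, real^'n) manifold \<Rightarrow> ('a \<Rightarrow> ('a, real^'n) tvec \<Rightarrow> real) \<Rightarrow> 'a
       \<Rightarrow> ('a, real^'n) tvec \<Rightarrow> ('a, real^'n) tvec \<Rightarrow> ('a, real^'n) tvec" where
  "riemann_curvature M F p y v =
     (\<lambda>c. if c \<in> charts_at M p
          then \<chi> i. \<Sum>k\<in>UNIV.
                 riemann_coeff (\<lambda>z. (in_chart M F c z)\<^sup>2) i k (snd c p, y c) * v c $ k
          else 0)"

definition flag_curvature ::
    "('a, real^'n) manifold \<Rightarrow> ('a \<Rightarrow> ('a, real^'n) tvec \<Rightarrow> real) \<Rightarrow> 'a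
       \<Rightarrow> ('a, real^'n) tvec \<Rightarrow> ('a, real^'n) tvec \<Rightarrow> real" where
  "flag_curvature M F p y v =
     fund_tensor (F p) y (riemann_curvature M F p y v) v /
     (fund_tensor (F p) y y y * fund_tensor (F p) y v v - (fund_tensor (F p) y y v)\<^sup>2)"


section \<open>The norm on the complement and the mapping U\<close>

definition norm_m ::
    "'g monoid \<Rightarrow> ('g, 'e::euclidean_space) manifold \<Rightarrow> 'g set
       \<Rightarrow> ('g set, 'f::euclidean_space) manifold
       \<Rightarrow> ('g set \<Rightarrow> ('g set, 'f) tvec \<Rightarrow> real) \<Rightarrow> ('g, 'e) tvec \<Rightarrow> real" where
  "norm_m G MG H M F w = F H (to_origin G MG H M w)"

text \<open>\<open>N\<close> is a Minkowski norm on \<open>\<mm>\<close> and \<open>u\<close> is the reference vector.\<close>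

definition U_map ::
    "'g monoid \<Rightarrow> ('g, 'e::euclidean_space) manifold \<Rightarrow> 'g set \<Rightarrow> ('g, 'e) tvec set
       \<Rightarrow> (('g, 'e) tvec \<Rightarrow> real) \<Rightarrow> ('g, 'e) tvec
       \<Rightarrow> ('g, 'e) tvec \<Rightarrow> ('g, 'e) tvec \<Rightarrow> ('g, 'e) tvec" where
  "U_map G MG H \<mm> N u a b =
     (THE z. z \<in> \<mm> \<and>
        (\<forall>w\<in>\<mm>. fund_tensor N u z w =
           1 / 2 * (fund_tensor N u (bracket_m G MG H \<mm> w a) b
                  + fund_tensor N u (bracket_m G MG H \<mm> w b) a)))"

end

theory Submission
  imports Defs
begin

text \<open>
  For \<open>w\<close> in the Lie algebra let \<open>X\<^sub>w\<close> be the fundamental vector field of the action on \<open>G/H\<close>;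
  it is a Killing field, that is, its complete lift annihilates \<open>L = F\<^sup>2\<close> and hence
  commutes with the geodesic spray.  The condition on \<open>u\<close> says that the integral curve of
  \<open>X\<^sub>u\<close> through the origin is a geodesic.  Let \<open>A\<close> be the covariant derivative along it on
  fields invariant under the flow of \<open>X\<^sub>u\<close>; in a chart, \<open>A w = (D X\<^sub>u) w + (\<partial>G/\<partial>y) w\<close> for the
  spray coefficients \<open>G\<close>.  As \<open>X\<^sub>u\<close> and \<open>X\<^sub>v\<close> commute, \<open>X\<^sub>v\<close> is an invariant Jacobi field,
  so \<open>R\<^sub>u v = - A (A v)\<close>.  A Koszul formula expresses \<open>A\<close> through brackets: it shows that \<open>A\<close> is
  skew for \<open>\<langle>\<cdot>,\<cdot>\<rangle>\<^sub>u\<close>, that \<open>A v = U(u,v)\<close>, and that \<open>A\<close>, hence \<open>R\<^sub>u v\<close>, does not depend on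
  the chart.  Therefore \<open>\<langle>R\<^sub>u v, v\<rangle>\<^sub>u = \<langle>A v, A v\<rangle>\<^sub>u\<close>.

  Two facts about \<open>G/H\<close> enter: the action is smooth, since the projection has smooth local
  sections, and the Lie algebra of \<open>H\<close> is the kernel of the differential of the projection,
  which needs the existence of one-parameter subgroups.
\<close>


section \<open>Calculus of smooth functions\<close>

text \<open>The fundamental tensor depends on its reference vector, so differentiating it brings in
  third derivatives of \<open>L\<close> (the Cartan tensor), which a Koszul formula must not
  contain. They disappear because, \<open>u\<close> being geodesic, the complete lift of the field
  of \<open>u\<close> at \<open>u\<close> equals the spray vector \<open>(y, -2 G)\<close>, and
  invariance of \<open>L\<close> turns a third derivative along a lift into derivatives of lower
  order. The same coincidence simplifies the curvature. The relation between curvature and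
  \<open>A\<close> is the Jacobi equation: the covariant derivative of an invariant field
  \<open>J\<close> along the geodesic is the invariant field \<open>A J\<close>, so
  \<open>D D J + R J = 0\<close> reads \<open>A (A J) + R J = 0\<close>. It is obtained here by
  coordinate calculus from the Killing equations of both fields and their derivatives. Orbit maps
  relate fundamental fields to right-invariant fields, hence their bracket is the negative of the
  Lie algebra bracket; this explains the order of the terms in the bracket formulas. Curvature is a
  family of components over all charts, so the computation is made in each chart at the origin and
  the results are compared.\<close>

abbreviation fd :: "('a::real_normed_vector \<Rightarrow> 'b::real_normed_vector) \<Rightarrow> 'a \<Rightarrow> 'a \<Rightarrow> 'b" where
  "fd f x \<equiv> frechet_derivative f (at x)"

lemma fd_eqI: "(f has_derivative f') (at x) \<Longrightarrow> fd f x = f'"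
  by (simp add: frechet_derivative_at[symmetric])

lemma fd_cong:
  assumes "open S" "x \<in> S" "\<And>y. y \<in> S \<Longrightarrow> f y = g y"
  shows "fd f x = fd g x"
proof -
  \<comment> \<open>\<open>frechet_derivative\<close> is a choice among all derivatives, so it
    suffices that both functions have the same derivatives \<open>D\<close>, also where there are
    none.\<close>
  have "(f has_derivative D) (at x) \<longleftrightarrow> (g has_derivative D) (at x)" for D
    using assms has_derivative_transform_within_open[of _ D x UNIV S]
    by (metis (no_types, lifting) has_derivative_transform_within_open)
  then show ?thesis
    by (simp add: frechet_derivative_def)
qed

lemma differentiable_cong_open:
  assumes "open S" "x \<in> S" "\<And>y. y \<in> S \<Longrightarrow> f y = g y" "f differentiable (at x)"
  shows "g differentiable (at x)"
  using assms unfolding differentiable_def by (metis (no_types, lifting) has_derivative_transform_within_open)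

lemma linear_fd: "f differentiable (at x) \<Longrightarrow> linear (fd f x)"
  by (simp add: linear_frechet_derivative)

lemma fd_has_derivative: "f differentiable (at x) \<Longrightarrow> (f has_derivative fd f x) (at x)"
  by (simp add: frechet_derivative_works)

lemma fd_euclidean:
  fixes f :: "'a::euclidean_space \<Rightarrow> 'b::real_normed_vector"
  assumes "f differentiable (at x)"
  shows "fd f x w = (\<Sum>b\<in>Basis. (w \<bullet> b) *\<^sub>R fd f x b)"
proof -
  interpret linear "fd f x" by (rule linear_fd[OF assms])
  have "fd f x w = fd f x (\<Sum>b\<in>Basis. (w \<bullet> b) *\<^sub>R b)"
    by (simp add: euclidean_representation)
  then show ?thesis by (simp add: sum scale)
qed

section \<open>Closure properties of finite and infinite differentiability\<close>

lemma Ck_on_Suc_D: "Ck_on (Suc k) S f \<Longrightarrow> Ck_on k S f"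
proof (induction k arbitrary: f)
  case 0
  then show ?case
    by (auto intro!: differentiable_imp_continuous_on simp: differentiable_on_def
        differentiable_at_withinI)
next
  case (Suc k)
  then show ?case by (metis Ck_on.simps(2))
qed

lemma Ck_on_subset: "Ck_on k S f \<Longrightarrow> T \<subseteq> S \<Longrightarrow> Ck_on k T f"
  by (induction k arbitrary: f) (auto intro: continuous_on_subset)

lemma Ck_on_cong:
  "open S \<Longrightarrow> (\<And>x. x \<in> S \<Longrightarrow> f x = g x) \<Longrightarrow> Ck_on k S f \<Longrightarrow> Ck_on k S g"
proof (induction k arbitrary: f g)
  case 0
  then show ?case using continuous_on_cong[of S S f g] by simp
next
  case (Suc k)
  have "fd f x = fd g x" if "x \<in> S" for x
    by (rule fd_cong) (use Suc.prems that in auto)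
  then show ?case
    using Suc.prems Suc.IH[of "\<lambda>x. fd f x b" "\<lambda>x. fd g x b" for b] differentiable_cong_open[of S _ f g]
    by auto
qed

lemma Ck_on_local:
  "(\<And>x. x \<in> S \<Longrightarrow> \<exists>T. open T \<and> x \<in> T \<and> Ck_on k T f) \<Longrightarrow> Ck_on k S f"
proof (induction k arbitrary: f)
  case 0
  then have "isCont f x" if "x \<in> S" for x
    using that continuous_on_eq_continuous_at by (metis Ck_on.simps(1))
  then show ?case by (simp add: continuous_at_imp_continuous_on)
next
  case (Suc k)
  then show ?case by fastforce
qed

lemma Ck_on_const: "Ck_on k S (\<lambda>x. c)"
  by (induction k arbitrary: c) (auto simp: fd_eqI[OF has_derivative_const])

lemma (in bounded_linear) Ck_on_compose:
  fixes g :: "'e::euclidean_space \<Rightarrow> 'a"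
  shows "open S \<Longrightarrow> Ck_on k S g \<Longrightarrow> Ck_on k S (\<lambda>x. f (g x))"
proof (induction k arbitrary: g)
  case 0
  then show ?case by (simp add: continuous_on)
next
  case (Suc k)
  have d: "((\<lambda>x. f (g x)) has_derivative (\<lambda>h. f (fd g x h))) (at x)" if "x \<in> S" for x
    by (rule has_derivative) (use Suc.prems that in \<open>auto intro: fd_has_derivative\<close>)
  have "Ck_on k S (\<lambda>x. f (fd g x b))" if "b \<in> Basis" for b
    using Suc that by auto
  then have "Ck_on k S (\<lambda>x. fd (\<lambda>x. f (g x)) x b)" if "b \<in> Basis" for b
    by (rule Ck_on_cong[rotated 2]) (use that Suc.prems in \<open>auto simp: fd_eqI[OF d]\<close>)
  then show ?case using d by (auto simp: differentiable_def)
qed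

lemma Ck_on_add: 
  fixes f g :: "'e::euclidean_space \<Rightarrow> 'b::real_normed_vector"
  shows "open S \<Longrightarrow> Ck_on k S f \<Longrightarrow> Ck_on k S g \<Longrightarrow> Ck_on k S (\<lambda>x. f x + g x)"
proof (induction k arbitrary: f g)
  case 0
  then show ?case by (simp add: continuous_on_add)
next
  case (Suc k)
  have d: "((\<lambda>x. f x + g x) has_derivative (\<lambda>h. fd f x h + fd g x h)) (at x)" if "x \<in> S" for x
    by (rule has_derivative_add) (use Suc.prems that in \<open>auto intro: fd_has_derivative\<close>)
  have "Ck_on k S (\<lambda>x. fd f x b + fd g x b)" if "b \<in> Basis" for b
    using Suc that by auto
  then have "Ck_on k S (\<lambda>x. fd (\<lambda>x. f x + g x) x b)" if "b \<in> Basis" for b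
    by (rule Ck_on_cong[rotated 2]) (use that Suc.prems in \<open>auto simp: fd_eqI[OF d]\<close>)
  then show ?case using d by (auto simp: differentiable_def)
qed

lemma (in bounded_bilinear) Ck_on_compose:
  fixes f :: "'e::euclidean_space \<Rightarrow> 'a" and g :: "'e \<Rightarrow> 'b"
  shows "open S \<Longrightarrow> Ck_on k S f \<Longrightarrow> Ck_on k S g \<Longrightarrow> Ck_on k S (\<lambda>x. f x ** g x)"
proof (induction k arbitrary: f g)
  case 0
  then show ?case by (simp add: continuous_on)
next
  case (Suc k)
  have d: "((\<lambda>x. f x ** g x) has_derivative (\<lambda>h. f x ** fd g x h + fd f x h ** g x)) (at x)" if "x \<in> S" for x
    by (rule FDERIV) (use Suc.prems that in \<open>auto intro: fd_has_derivative\<close>)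
  have "Ck_on k S (\<lambda>x. f x ** fd g x b + fd f x b ** g x)" if "b \<in> Basis" for b
    by (intro Ck_on_add Suc.IH) (use Suc.prems that Ck_on_Suc_D[OF Suc.prems(2)] Ck_on_Suc_D[OF Suc.prems(3)] in simp_all)
  then have "Ck_on k S (\<lambda>x. fd (\<lambda>x. f x ** g x) x b)" if "b \<in> Basis" for b
    by (rule Ck_on_cong[rotated 2]) (use that Suc.prems in \<open>auto simp: fd_eqI[OF d]\<close>)
  then show ?case using d by (auto simp: differentiable_def)
qed

lemma Ck_on_sum:
  "open S \<Longrightarrow> (\<And>i. i \<in> I \<Longrightarrow> Ck_on k S (f i)) \<Longrightarrow> Ck_on k S (\<lambda>x. \<Sum>i\<in>I. f i x)"
  by (induction I rule: infinite_finite_induct) (auto simp: Ck_on_const intro!: Ck_on_add)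

text \<open>By the chain rule the derivative along \<open>b\<close> is
  \<open>fd f (g x) (fd g x b)\<close>, whose direction varies with \<open>x\<close>. As
  \<open>Ck_on\<close> controls derivatives along \<open>Basis\<close> only, the direction is
  expanded in the basis, which leaves sums of products covered by the closure lemmas and the
  induction hypothesis.\<close>

lemma Ck_on_compose:
  fixes f :: "'b::euclidean_space \<Rightarrow> 'c::real_normed_vector" and g :: "'a::euclidean_space \<Rightarrow> 'b"
  shows "open S \<Longrightarrow> Ck_on k T f \<Longrightarrow> Ck_on k S g \<Longrightarrow> g ` S \<subseteq> T \<Longrightarrow> Ck_on k S (\<lambda>x. f (g x))"
proof (induction k arbitrary: f g)
  case 0
  then show ?case by (auto intro: continuous_on_compose2)
next
  case (Suc k)
  have d: "((\<lambda>x. f (g x)) has_derivative (\<lambda>h. fd f (g x) (fd g x h))) (at x)" if "x \<in> S" for x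
    by (rule has_derivative_compose) (use Suc.prems that in \<open>auto intro: fd_has_derivative\<close>)
  have "Ck_on k S (\<lambda>x. \<Sum>i\<in>Basis. (fd g x b \<bullet> i) *\<^sub>R fd f (g x) i)" if "b \<in> Basis" for b
    by (intro Ck_on_sum bounded_bilinear.Ck_on_compose[OF bounded_bilinear_scaleR] Suc.IH
        bounded_linear.Ck_on_compose[OF bounded_linear_inner_left] Suc.prems)
      (use Suc.prems that Ck_on_Suc_D[OF Suc.prems(3)] in auto)
  then have "Ck_on k S (\<lambda>x. fd (\<lambda>x. f (g x)) x b)" if "b \<in> Basis" for b
    by (rule Ck_on_cong[rotated 2])
      (use that Suc.prems in \<open>auto simp: fd_eqI[OF d] fd_euclidean[symmetric] image_subset_iff\<close>)
  then show ?case using d by (auto simp: differentiable_def)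
qed


lemma Ck_on_inverse:
  fixes f :: "'a::euclidean_space \<Rightarrow> real"
  shows "open S \<Longrightarrow> Ck_on k S f \<Longrightarrow> (\<And>x. x \<in> S \<Longrightarrow> f x \<noteq> 0) \<Longrightarrow> Ck_on k S (\<lambda>x. inverse (f x))"
proof (induction k)
  case 0
  then show ?case by (auto intro: continuous_on_inverse)
next
  case (Suc k)
  have d: "((\<lambda>x. inverse (f x)) has_derivative (\<lambda>h. - (inverse (f x) * fd f x h * inverse (f x)))) (at x)"
    if "x \<in> S" for x
    by (rule Deriv.has_derivative_inverse) (use Suc.prems that in \<open>auto intro: fd_has_derivative\<close>)
  have "Ck_on k S (\<lambda>x. - (inverse (f x) * fd f x b * inverse (f x)))" if "b \<in> Basis" for b
    by (intro bounded_bilinear.Ck_on_compose[OF bounded_bilinear_mult]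
         bounded_linear.Ck_on_compose[OF bounded_linear_minus[OF bounded_linear_ident]] Suc.IH Suc.prems)
      (use Suc.prems that Ck_on_Suc_D[OF Suc.prems(2)] in auto)
  then have "Ck_on k S (\<lambda>x. fd (\<lambda>x. inverse (f x)) x b)" if "b \<in> Basis" for b
    by (rule Ck_on_cong[rotated 2]) (use that Suc.prems in \<open>auto simp: fd_eqI[OF d]\<close>)
  then show ?case using d by (auto simp: differentiable_def)
qed

text \<open>An unfolding of smoothness that stays at infinite order, so that facts about derivatives
  follow without induction on the order.\<close>

lemma smooth_on_Suc:
  "smooth_on S f \<longleftrightarrow> (\<forall>x\<in>S. f differentiable (at x)) \<and> (\<forall>b\<in>Basis. smooth_on S (\<lambda>x. fd f x b))"
  unfolding smooth_on_def by (metis Ck_on.simps(2) Ck_on_Suc_D all_not_in_conv nonempty_Basis)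

lemma smooth_on_differentiable: "smooth_on S f \<Longrightarrow> x \<in> S \<Longrightarrow> f differentiable (at x)"
  using smooth_on_Suc by blast

lemma smooth_on_has_derivative: "smooth_on S f \<Longrightarrow> x \<in> S \<Longrightarrow> (f has_derivative fd f x) (at x)"
  using smooth_on_differentiable fd_has_derivative by blast

lemma smooth_on_continuous_on: "smooth_on S f \<Longrightarrow> continuous_on S f"
  unfolding smooth_on_def by (metis Ck_on.simps(1))

lemma smooth_on_subset: "smooth_on S f \<Longrightarrow> T \<subseteq> S \<Longrightarrow> smooth_on T f"
  unfolding smooth_on_def by (metis Ck_on_subset)

lemma smooth_on_cong:
  "smooth_on S f \<Longrightarrow> open S \<Longrightarrow> (\<And>x. x \<in> S \<Longrightarrow> f x = g x) \<Longrightarrow> smooth_on S g"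
  unfolding smooth_on_def by (metis Ck_on_cong)

lemma smooth_on_const: "smooth_on S (\<lambda>x. c)"
  unfolding smooth_on_def by (simp add: Ck_on_const)

lemma (in bounded_linear) smooth_on_compose:
  fixes g :: "'e::euclidean_space \<Rightarrow> 'a"
  shows "smooth_on S g \<Longrightarrow> open S \<Longrightarrow> smooth_on S (\<lambda>x. f (g x))"
  unfolding smooth_on_def by (metis Ck_on_compose)

lemma (in bounded_bilinear) smooth_on_compose:
  fixes f :: "'e::euclidean_space \<Rightarrow> 'a" and g :: "'e \<Rightarrow> 'b"
  shows "smooth_on S f \<Longrightarrow> smooth_on S g \<Longrightarrow> open S \<Longrightarrow> smooth_on S (\<lambda>x. prod (f x) (g x))"
  unfolding smooth_on_def by (metis Ck_on_compose)

lemma smooth_on_ident: "smooth_on S (\<lambda>x. x)"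
proof -
  have "fd (\<lambda>x. x) = (\<lambda>(x::'a) h. h)"
    by (intro ext) (simp add: fd_eqI[OF has_derivative_ident])
  then show ?thesis
    by (subst smooth_on_Suc) (simp add: smooth_on_const)
qed

lemma bounded_linear_smooth_on:
  fixes f :: "'e::euclidean_space \<Rightarrow> 'f::real_normed_vector"
  shows "bounded_linear f \<Longrightarrow> open S \<Longrightarrow> smooth_on S f"
  using bounded_linear.smooth_on_compose[OF _ smooth_on_ident] by blast

lemmas smooth_on_inner_left = bounded_linear.smooth_on_compose[OF bounded_linear_inner_left]
lemmas smooth_on_fst = bounded_linear.smooth_on_compose[OF bounded_linear_fst]
lemmas smooth_on_snd = bounded_linear.smooth_on_compose[OF bounded_linear_snd]
lemmas smooth_on_scaleR = bounded_bilinear.smooth_on_compose[OF bounded_bilinear_scaleR]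
lemmas smooth_on_mult = bounded_bilinear.smooth_on_compose[OF bounded_bilinear_mult]
lemmas smooth_on_minus = bounded_linear.smooth_on_compose[OF bounded_linear_minus[OF bounded_linear_ident]]
lemmas smooth_on_vec_nth = bounded_linear.smooth_on_compose[OF bounded_linear_vec_nth]

lemma smooth_on_add:
  fixes f g :: "'e::euclidean_space \<Rightarrow> 'b::real_normed_vector"
  shows "smooth_on S f \<Longrightarrow> smooth_on S g \<Longrightarrow> open S \<Longrightarrow> smooth_on S (\<lambda>x. f x + g x)"
  unfolding smooth_on_def by (metis Ck_on_add)

lemma smooth_on_diff:
  fixes f g :: "'e::euclidean_space \<Rightarrow> 'b::real_normed_vector"
  assumes "smooth_on S f" "smooth_on S g" "open S"
  shows "smooth_on S (\<lambda>x. f x - g x)"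
  using smooth_on_add[OF assms(1) smooth_on_minus[OF assms(2,3)] assms(3)] by simp

lemma smooth_on_sum:
  "(\<And>i. i \<in> I \<Longrightarrow> smooth_on S (f i)) \<Longrightarrow> open S \<Longrightarrow> smooth_on S (\<lambda>x. \<Sum>i\<in>I. f i x)"
  unfolding smooth_on_def by (metis Ck_on_sum)

lemma smooth_on_prod:
  fixes f :: "'i \<Rightarrow> 'e::euclidean_space \<Rightarrow> real"
  shows "(\<And>i. i \<in> I \<Longrightarrow> smooth_on S (f i)) \<Longrightarrow> open S \<Longrightarrow> smooth_on S (\<lambda>x. \<Prod>i\<in>I. f i x)"
  by (induction I rule: infinite_finite_induct) (auto simp: smooth_on_const intro!: smooth_on_mult)

lemma smooth_on_compose:
  fixes f :: "'b::euclidean_space \<Rightarrow> 'c::real_normed_vector" and g :: "'a::euclidean_space \<Rightarrow> 'b"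
  shows "smooth_on T f \<Longrightarrow> smooth_on S g \<Longrightarrow> open S \<Longrightarrow> g ` S \<subseteq> T \<Longrightarrow> smooth_on S (\<lambda>x. f (g x))"
  unfolding smooth_on_def by (metis Ck_on_compose)

lemma smooth_on_inverse:
  fixes f :: "'a::euclidean_space \<Rightarrow> real"
  shows "smooth_on S f \<Longrightarrow> open S \<Longrightarrow> (\<And>x. x \<in> S \<Longrightarrow> f x \<noteq> 0) \<Longrightarrow> smooth_on S (\<lambda>x. inverse (f x))"
  unfolding smooth_on_def by (metis Ck_on_inverse)

lemma smooth_on_divide:
  fixes f g :: "'a::euclidean_space \<Rightarrow> real"
  assumes "smooth_on S f" "smooth_on S g" "open S" "\<And>x. x \<in> S \<Longrightarrow> g x \<noteq> 0"
  shows "smooth_on S (\<lambda>x. f x / g x)"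
  using smooth_on_mult[OF assms(1) smooth_on_inverse[OF assms(2-4)] assms(3)]
  by (simp add: divide_inverse)

lemma smooth_on_Pair:
  fixes f :: "'a::euclidean_space \<Rightarrow> 'b::real_normed_vector" and g :: "'a \<Rightarrow> 'c::real_normed_vector"
  assumes "smooth_on S f" "smooth_on S g" "open S"
  shows "smooth_on S (\<lambda>x. (f x, g x))"
proof -
  have "bounded_linear (\<lambda>x::'b. (x, 0::'c))" "bounded_linear (\<lambda>x::'c. (0::'b, x))"
    by (intro bounded_linear_Pair bounded_linear_ident bounded_linear_zero)+
  from smooth_on_add[OF bounded_linear.smooth_on_compose[OF this(1) assms(1,3)]
      bounded_linear.smooth_on_compose[OF this(2) assms(2,3)] assms(3)]
  show ?thesis by simp
qed

lemma smooth_on_euclidean: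
  fixes f :: "'a::euclidean_space \<Rightarrow> 'b::euclidean_space"
  assumes "\<And>b. b \<in> Basis \<Longrightarrow> smooth_on S (\<lambda>x. f x \<bullet> b)" "open S"
  shows "smooth_on S f"
proof -
  have "smooth_on S (\<lambda>x. \<Sum>b\<in>Basis. (f x \<bullet> b) *\<^sub>R b)"
    by (intro smooth_on_sum smooth_on_scaleR smooth_on_const assms)
  then show ?thesis by (simp add: euclidean_representation)
qed

lemma smooth_on_vec:
  fixes f :: "'a::euclidean_space \<Rightarrow> real^'n"
  assumes "\<And>i. smooth_on S (\<lambda>x. f x $ i)" "open S"
  shows "smooth_on S f"
  by (rule smooth_on_euclidean) (use assms in \<open>auto simp: Basis_vec_def inner_axis\<close>)

lemma smooth_on_local:
  "(\<And>x. x \<in> S \<Longrightarrow> \<exists>T. open T \<and> x \<in> T \<and> smooth_on T f) \<Longrightarrow> smooth_on S f"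
  unfolding smooth_on_def by (meson Ck_on_local)

text \<open>Base point and direction both vary, as they do in complete lifts. The fields
  \<open>lf\<close>, \<open>rf\<close> and \<open>kf\<close> below are also derivatives of a map at
  a moving base point.\<close>

lemma smooth_on_fd:
  fixes f :: "'b::euclidean_space \<Rightarrow> 'c::real_normed_vector" and g h :: "'a::euclidean_space \<Rightarrow> 'b"
  assumes "smooth_on T f" "smooth_on S g" "smooth_on S h" "open S" "g ` S \<subseteq> T"
  shows "smooth_on S (\<lambda>x. fd f (g x) (h x))"
proof -
  have "smooth_on S (\<lambda>x. fd f (g x) b)" if "b \<in> Basis" for b
    by (rule smooth_on_compose[of T "\<lambda>x. fd f x b" S g]) (use assms that smooth_on_Suc[of T f] in auto)
  then have 1: "smooth_on S (\<lambda>x. \<Sum>b\<in>Basis. (h x \<bullet> b) *\<^sub>R fd f (g x) b)"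
    by (intro smooth_on_sum smooth_on_scaleR smooth_on_inner_left assms) auto
  show ?thesis
    by (rule smooth_on_cong[OF 1 \<open>open S\<close>], rule fd_euclidean[symmetric])
      (use assms in \<open>auto simp: smooth_on_differentiable image_subset_iff\<close>)
qed

lemma smooth_on_fd_const:
  fixes f :: "'b::euclidean_space \<Rightarrow> 'c::real_normed_vector"
  shows "smooth_on T f \<Longrightarrow> open T \<Longrightarrow> smooth_on T (\<lambda>x. fd f x b)"
  using smooth_on_fd[of T f T "\<lambda>x. x" "\<lambda>_. b"] by (simp add: smooth_on_ident smooth_on_const)

text \<open>The product rule for a derivative whose base point and direction both move. Second
  derivatives are written throughout as derivatives of a directional derivative with frozen
  direction; the basis expansion of the moving direction reduces to that form.\<close>

lemma has_derivative_fd: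
  fixes f :: "'b::euclidean_space \<Rightarrow> 'c::real_normed_vector" and g h :: "'a::euclidean_space \<Rightarrow> 'b"
  assumes f: "smooth_on T f" and "open T" "g x \<in> T"
    and g: "(g has_derivative g') (at x)" and h: "(h has_derivative h') (at x)"
  shows "((\<lambda>x. fd f (g x) (h x)) has_derivative
      (\<lambda>w. fd (\<lambda>y. fd f y (h x)) (g x) (g' w) + fd f (g x) (h' w))) (at x)"
proof -
  have cont: "isCont g x"
    using g has_derivative_continuous by blast
  obtain W where W: "open W" "x \<in> W" "\<And>y. y \<in> W \<Longrightarrow> g y \<in> T"
    using continuous_at_open cont \<open>open T\<close> \<open>g x \<in> T\<close> by metis
  have sm: "smooth_on T (\<lambda>y. fd f y b)" for b
    using f \<open>open T\<close> by (rule smooth_on_fd_const)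
  have 1: "((\<lambda>x. \<Sum>b\<in>Basis. (h x \<bullet> b) *\<^sub>R fd f (g x) b) has_derivative
    (\<lambda>w. \<Sum>b\<in>Basis. (h x \<bullet> b) *\<^sub>R fd (\<lambda>y. fd f y b) (g x) (g' w) + (h' w \<bullet> b) *\<^sub>R fd f (g x) b)) (at x)"
    by (intro has_derivative_sum has_derivative_scaleR has_derivative_inner_left h
        has_derivative_compose[OF g smooth_on_has_derivative[OF sm \<open>g x \<in> T\<close>]])
  have lin: "fd f y v = (\<Sum>b\<in>Basis. (v \<bullet> b) *\<^sub>R fd f y b)" if "y \<in> T" for y v
    using fd_euclidean smooth_on_differentiable[OF f that] by blast
  have 2: "((\<lambda>y. \<Sum>b\<in>Basis. (h x \<bullet> b) *\<^sub>R fd f y b) has_derivative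
    (\<lambda>w. \<Sum>b\<in>Basis. (h x \<bullet> b) *\<^sub>R fd (\<lambda>y. fd f y b) (g x) w)) (at (g x))"
    by (intro has_derivative_sum has_derivative_scaleR_right smooth_on_has_derivative[OF sm \<open>g x \<in> T\<close>])
  have 3: "fd (\<lambda>y. fd f y (h x)) (g x) = (\<lambda>w. \<Sum>b\<in>Basis. (h x \<bullet> b) *\<^sub>R fd (\<lambda>y. fd f y b) (g x) w)"
    by (rule fd_eqI, rule has_derivative_transform_within_open[OF 2 \<open>open T\<close> \<open>g x \<in> T\<close>])
      (rule lin[symmetric])
  have "((\<lambda>x. fd f (g x) (h x)) has_derivative
    (\<lambda>w. \<Sum>b\<in>Basis. (h x \<bullet> b) *\<^sub>R fd (\<lambda>y. fd f y b) (g x) (g' w) + (h' w \<bullet> b) *\<^sub>R fd f (g x) b)) (at x)"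
    by (rule has_derivative_transform_within_open[OF 1 W(1,2)]) (rule lin[OF W(3), symmetric])
  then show ?thesis
    by (rule has_derivative_eq_rhs) (simp add: 3 sum.distrib lin[OF \<open>g x \<in> T\<close>, symmetric] fun_eq_iff)
qed

lemma fd_compose:
  assumes "f differentiable (at (g x))" "g differentiable (at x)"
  shows "fd (\<lambda>x. f (g x)) x w = fd f (g x) (fd g x w)"
  using fd_eqI[OF has_derivative_compose[OF fd_has_derivative[OF assms(2)] fd_has_derivative[OF assms(1)]]]
  by simp

lemma has_vector_derivative_line:
  assumes "f differentiable (at (x + t *\<^sub>R a))"
  shows "((\<lambda>t. f (x + t *\<^sub>R a)) has_vector_derivative fd f (x + t *\<^sub>R a) a) (at t)"
proof -
  have "((\<lambda>t. x + t *\<^sub>R a) has_derivative (\<lambda>h. h *\<^sub>R a)) (at t)"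
    by (auto intro!: derivative_eq_intros)
  from has_derivative_compose[OF this fd_has_derivative[OF assms]] show ?thesis
    by (simp add: has_vector_derivative_def linear_scale[OF linear_fd[OF assms]])
qed

lemma deriv_line:
  fixes f :: "'a::real_normed_vector \<Rightarrow> real"
  assumes "f differentiable (at x)"
  shows "deriv (\<lambda>t. f (x + t *\<^sub>R a)) 0 = fd f x a"
  using has_vector_derivative_line[of f x 0 a] assms
  by (intro DERIV_imp_deriv) (simp add: has_real_derivative_iff_has_vector_derivative)

text \<open>The second difference is the increment over \<open>[0, h]\<close> of the function that
  sends \<open>s\<close> to \<open>f (x + h b + s a) - f (x + s a)\<close>. One mean value step in
  \<open>s\<close> and one in \<open>t\<close> turn it into a mixed derivative at an interior
  point.\<close>

lemma second_difference_mvt: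
  fixes f :: "'a::euclidean_space \<Rightarrow> real"
  assumes f: "smooth_on S f" and "open S" and "h > 0"
    and S: "\<And>s t. 0 \<le> s \<Longrightarrow> s \<le> h \<Longrightarrow> 0 \<le> t \<Longrightarrow> t \<le> h \<Longrightarrow> x + s *\<^sub>R a + t *\<^sub>R b \<in> S"
  obtains s t where "0 < s" "s < h" "0 < t" "t < h"
    "f (x + h *\<^sub>R a + h *\<^sub>R b) - f (x + h *\<^sub>R a) - f (x + h *\<^sub>R b) + f x =
      h\<^sup>2 * fd (\<lambda>y. fd f y a) (x + s *\<^sub>R a + t *\<^sub>R b) b"
proof -
  let ?g = "\<lambda>y. fd f y a"
  have 1: "((\<lambda>s. f ((x + c) + s *\<^sub>R a)) has_real_derivative fd f ((x + c) + s *\<^sub>R a) a) (at s)"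
    if "(x + c) + s *\<^sub>R a \<in> S" for s c
    using has_vector_derivative_line[OF smooth_on_differentiable[OF f that]]
    by (simp add: has_real_derivative_iff_has_vector_derivative)
  have g: "smooth_on S ?g" using f \<open>open S\<close> by (rule smooth_on_fd_const)
  have 2: "((\<lambda>t. ?g (y + t *\<^sub>R b)) has_real_derivative fd ?g (y + t *\<^sub>R b) b) (at t)"
    if "y + t *\<^sub>R b \<in> S" for y t
    using has_vector_derivative_line[OF smooth_on_differentiable[OF g that]]
    by (simp add: has_real_derivative_iff_has_vector_derivative)
  have "\<exists>s. 0 < s \<and> s < h \<and> (f ((x + h *\<^sub>R b) + h *\<^sub>R a) - f ((x + 0) + h *\<^sub>R a))
      - (f ((x + h *\<^sub>R b) + 0 *\<^sub>R a) - f ((x + 0) + 0 *\<^sub>R a)) =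
      (h - 0) * (?g ((x + h *\<^sub>R b) + s *\<^sub>R a) - ?g ((x + 0) + s *\<^sub>R a))"
    by (rule MVT2[OF \<open>h > 0\<close>], intro DERIV_diff 1)
      (use S[of _ h] S[of _ 0] \<open>h > 0\<close> in \<open>auto simp: algebra_simps\<close>)
  then obtain s where s: "0 < s" "s < h" "f (x + h *\<^sub>R a + h *\<^sub>R b) - f (x + h *\<^sub>R a) - f (x + h *\<^sub>R b) + f x
     = h * (?g (x + s *\<^sub>R a + h *\<^sub>R b) - ?g (x + s *\<^sub>R a))"
    by (auto simp: algebra_simps)
  have "\<exists>t. 0 < t \<and> t < h \<and> ?g (x + s *\<^sub>R a + h *\<^sub>R b) - ?g (x + s *\<^sub>R a + 0 *\<^sub>R b)
      = (h - 0) * fd ?g (x + s *\<^sub>R a + t *\<^sub>R b) b"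
    by (rule MVT2[OF \<open>h > 0\<close>], intro 2) (use S s in auto)
  then show ?thesis using that s by (auto simp: power2_eq_square algebra_simps)
qed

text \<open>The second difference is symmetric in \<open>a\<close> and \<open>b\<close>, so the two
  mixed derivatives share a value at suitable points near \<open>x\<close>. If they differed at
  \<open>x\<close>, continuity would keep them apart on a small parallelogram.\<close>

lemma fd_fd_commute_real:
  fixes f :: "'a::euclidean_space \<Rightarrow> real"
  assumes f: "smooth_on S f" and "open S" and "x \<in> S"
  shows "fd (\<lambda>y. fd f y a) x b = fd (\<lambda>y. fd f y b) x a"
proof (rule ccontr)
  define A where "A y = fd (\<lambda>y. fd f y a) y b" for y
  define B where "B y = fd (\<lambda>y. fd f y b) y a" for y
  assume "\<not> ?thesis"
  then have "\<bar>A x - B x\<bar> / 2 > 0" (is "?e > 0") by (simp add: A_def B_def)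
  have "smooth_on S A" "smooth_on S B"
    unfolding A_def B_def by (intro smooth_on_fd_const f \<open>open S\<close>)+
  then have "isCont A x" "isCont B x"
    using smooth_on_continuous_on continuous_on_eq_continuous_at \<open>open S\<close> \<open>x \<in> S\<close> by blast+
  then have "\<forall>\<^sub>F y in nhds x. dist (A y) (A x) < ?e" "\<forall>\<^sub>F y in nhds x. dist (B y) (B x) < ?e"
    using \<open>?e > 0\<close> unfolding isCont_def tendsto_at_iff_tendsto_nhds by (blast intro: tendstoD)+
  moreover have "\<forall>\<^sub>F y in nhds x. y \<in> S"
    using \<open>open S\<close> \<open>x \<in> S\<close> by (rule eventually_nhds_in_open)
  ultimately have "\<forall>\<^sub>F y in nhds x. dist (A y) (A x) < ?e \<and> dist (B y) (B x) < ?e \<and> y \<in> S"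
    by (intro eventually_conj)
  then obtain r where "r > 0" and r: "\<And>y. dist y x < r \<Longrightarrow> dist (A y) (A x) < ?e \<and> dist (B y) (B x) < ?e \<and> y \<in> S"
    unfolding eventually_nhds_metric by blast
  \<comment> \<open>With this \<open>h\<close> the whole parallelogram spanned by \<open>h a\<close>
    and \<open>h b\<close> stays within distance \<open>r\<close> of \<open>x\<close>; the summand 1
    keeps the denominator positive when \<open>a = b = 0\<close>.\<close>
  define h where "h = r / (norm a + norm b + 1)"
  have *: "norm a + norm b + 1 > 0" by (smt (verit) norm_ge_zero)
  then have "h > 0" using \<open>r > 0\<close> by (simp add: h_def)
  have hr: "h * (norm a + norm b) < r"
    using * \<open>r > 0\<close> by (simp add: h_def field_simps)
  have near: "dist (x + s *\<^sub>R a + t *\<^sub>R b) x < r" if "0 \<le> s" "s \<le> h" "0 \<le> t" "t \<le> h" for s t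
  proof -
    have "norm (s *\<^sub>R a + t *\<^sub>R b) \<le> s * norm a + t * norm b"
      using norm_triangle_ineq[of "s *\<^sub>R a" "t *\<^sub>R b"] that by simp
    also have "\<dots> \<le> h * norm a + h * norm b"
      using that by (intro add_mono mult_right_mono) auto
    finally show ?thesis using hr by (simp add: dist_norm algebra_simps)
  qed
  obtain s t where st: "0 < s" "s < h" "0 < t" "t < h"
    "f (x + h *\<^sub>R a + h *\<^sub>R b) - f (x + h *\<^sub>R a) - f (x + h *\<^sub>R b) + f x = h\<^sup>2 * A (x + s *\<^sub>R a + t *\<^sub>R b)"
    unfolding A_def
    by (rule second_difference_mvt[OF f \<open>open S\<close> \<open>h > 0\<close>, of x a b]) (use near r in auto)
  have swap: "x + t *\<^sub>R b + s *\<^sub>R a \<in> S" if "0 \<le> s" "s \<le> h" "0 \<le> t" "t \<le> h" for s t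
    using near[OF that] r by (simp add: algebra_simps)
  then obtain s' t' where st': "0 < s'" "s' < h" "0 < t'" "t' < h"
    "f (x + h *\<^sub>R b + h *\<^sub>R a) - f (x + h *\<^sub>R b) - f (x + h *\<^sub>R a) + f x = h\<^sup>2 * B (x + t' *\<^sub>R b + s' *\<^sub>R a)"
    unfolding B_def
    by (rule second_difference_mvt[OF f \<open>open S\<close> \<open>h > 0\<close>, of x b a]) (use swap in auto)
  have eqs: "x + h *\<^sub>R b + h *\<^sub>R a = x + h *\<^sub>R a + h *\<^sub>R b" "x + t' *\<^sub>R b + s' *\<^sub>R a = x + s' *\<^sub>R a + t' *\<^sub>R b"
    by (simp_all add: algebra_simps)
  have "h\<^sup>2 * A (x + s *\<^sub>R a + t *\<^sub>R b) = h\<^sup>2 * B (x + s' *\<^sub>R a + t' *\<^sub>R b)"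
    using st(5) st'(5)[unfolded eqs] by linarith
  then have "A (x + s *\<^sub>R a + t *\<^sub>R b) = B (x + s' *\<^sub>R a + t' *\<^sub>R b)"
    using \<open>h > 0\<close> by simp
  moreover have "dist (A (x + s *\<^sub>R a + t *\<^sub>R b)) (A x) < ?e"
    using r near st by auto
  moreover have "dist (B (x + s' *\<^sub>R a + t' *\<^sub>R b)) (B x) < ?e"
    using r near st' by auto
  ultimately have "dist (A x) (B x) < \<bar>A x - B x\<bar>"
    using dist_triangle_half_r by metis
  then show False by (simp add: dist_real_def)
qed

lemma fd_fd_commute:
  fixes f :: "'a::euclidean_space \<Rightarrow> 'b::euclidean_space"
  assumes f: "smooth_on S f" and "open S" and "x \<in> S"
  shows "fd (\<lambda>y. fd f y a) x b = fd (\<lambda>y. fd f y b) x a"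
proof (rule euclidean_eqI)
  fix i :: 'b
  let ?f = "\<lambda>y. f y \<bullet> i"
  have 1: "fd ?f y c = fd f y c \<bullet> i" if "y \<in> S" for y c
    by (simp add: fd_eqI[OF has_derivative_inner_left[OF smooth_on_has_derivative[OF f that]]])
  have 2: "fd (\<lambda>y. fd f y c) x d \<bullet> i = fd (\<lambda>y. fd ?f y c) x d" for c d
  proof -
    have "fd (\<lambda>y. fd ?f y c) x d = fd (\<lambda>y. fd f y c \<bullet> i) x d"
      by (rule arg_cong[where f="\<lambda>k. k d"], rule fd_cong[OF assms(2,3)]) (rule 1)
    also have "\<dots> = fd (\<lambda>y. fd f y c) x d \<bullet> i"
      by (simp add: fd_eqI[OF has_derivative_inner_left[OF smooth_on_has_derivative[OF
            smooth_on_fd_const[OF f \<open>open S\<close>] \<open>x \<in> S\<close>]]])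
    finally show ?thesis ..
  qed
  show "fd (\<lambda>y. fd f y a) x b \<bullet> i = fd (\<lambda>y. fd f y b) x a \<bullet> i"
    unfolding 2 by (rule fd_fd_commute_real[OF smooth_on_inner_left[OF f] _ \<open>x \<in> S\<close>]) (rule \<open>open S\<close>)+
qed

section \<open>Linear systems with smooth coefficients and local inverses\<close>

lemma smooth_on_det:
  fixes A :: "'a::euclidean_space \<Rightarrow> real^'n^'n"
  assumes "\<And>i j. smooth_on S (\<lambda>x. A x $ i $ j)" "open S"
  shows "smooth_on S (\<lambda>x. det (A x))"
  unfolding det_def
  by (intro smooth_on_sum smooth_on_mult smooth_on_const smooth_on_prod assms)

text \<open>Cramer's rule: the solution is a quotient of determinants. It serves both for the
  derivative of a local inverse and for the spray coefficients.\<close>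

lemma smooth_on_linear_solution:
  fixes A :: "'a::euclidean_space \<Rightarrow> real^'n^'n"
  assumes "\<And>i j. smooth_on S (\<lambda>x. A x $ i $ j)" "smooth_on S b" "open S"
    and "\<And>x. x \<in> S \<Longrightarrow> det (A x) \<noteq> 0" "\<And>x. x \<in> S \<Longrightarrow> A x *v X x = b x"
  shows "smooth_on S X"
proof -
  have 1: "smooth_on S (\<lambda>x. \<chi> k. det (\<chi> i j. if j = k then b x $ i else A x $ i $ j) / det (A x))"
  proof (intro smooth_on_vec)
    fix k
    have "smooth_on S (\<lambda>x. (\<chi> i j. if j = k then b x $ i else A x $ i $ j) $ i $ j)" for i j
      using assms smooth_on_vec_nth[of S b i] by (cases "j = k") auto
    from smooth_on_divide[OF smooth_on_det[OF this \<open>open S\<close>] smooth_on_det[OF assms(1) \<open>open S\<close>] \<open>open S\<close> assms(4)]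
    show "smooth_on S (\<lambda>x. (\<chi> k. det (\<chi> i j. if j = k then b x $ i else A x $ i $ j) / det (A x)) $ k)"
      by simp
  qed fact
  show ?thesis
    by (rule smooth_on_cong[OF 1 \<open>open S\<close>], rule sym, rule iffD1[OF cramer]) (simp_all only: assms(4,5) not_False_eq_True)
qed

text \<open>The derivative of a local inverse solves a linear system with smooth coefficients, so
  smoothness follows by bootstrapping.\<close>

lemma smooth_local_inverse:
  fixes f :: "real^'n \<Rightarrow> real^'n"
  assumes f: "smooth_on U f" and "open U" "x0 \<in> U" and inj: "inj (fd f x0)"
  obtains V g where "open V" "f x0 \<in> V" "smooth_on V g" "g ` V \<subseteq> U" "\<And>y. y \<in> V \<Longrightarrow> f (g y) = y"
    "g (f x0) = x0"
proof -
  define f' where "f' x = Blinfun (fd f x)" for x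
  have lin: "bounded_linear (fd f x)" if "x \<in> U" for x
    using smooth_on_has_derivative[OF f that] by (rule has_derivative_bounded_linear)
  have f': "blinfun_apply (f' x) = fd f x" if "x \<in> U" for x
    using lin[OF that] by (simp add: f'_def bounded_linear_Blinfun_apply)
  have "continuous_on U (\<lambda>x. fd f x b)" for b
    using smooth_on_continuous_on[OF smooth_on_fd_const[OF f \<open>open U\<close>]] .
  then have contf: "continuous_on U f'"
    by (intro continuous_on_blinfun_componentwise) (simp add: f' cong: continuous_on_cong)
  obtain g0 where g0: "linear g0" "g0 \<circ> fd f x0 = id"
    using linear_injective_left_inverse[OF bounded_linear.linear[OF lin[OF \<open>x0 \<in> U\<close>]] inj] by blast
  have "Blinfun g0 o\<^sub>L f' x0 = id_blinfun"
    by (rule blinfun_eqI)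
      (use g0 in \<open>simp add: f' \<open>x0 \<in> U\<close> bounded_linear_Blinfun_apply linear_conv_bounded_linear[symmetric] fun_eq_iff\<close>)
  from inverse_function_theorem[OF \<open>open U\<close> _ contf \<open>x0 \<in> U\<close> this, of f] obtain U' V g g' where
    V: "open U'" "U' \<subseteq> U" "x0 \<in> U'" "open V" "f x0 \<in> V" "homeomorphism U' V f g"
    and g': "\<And>y. y \<in> V \<Longrightarrow> (g has_derivative (g' y)) (at y)"
      "\<And>y. y \<in> V \<Longrightarrow> g' y = inv_into UNIV (blinfun_apply (f' (g y)))"
      "\<And>y. y \<in> V \<Longrightarrow> bij (blinfun_apply (f' (g y)))"
    using f' smooth_on_has_derivative[OF f] by metis
  have gV: "g y \<in> U'" "g y \<in> U" "f (g y) = y" if "y \<in> V" for y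
    using V that by (auto simp: homeomorphism_def)
  have fdg: "fd f (g y) (fd g y b) = b" "bij (fd f (g y))" if "y \<in> V" for y b
    using g'[OF that] f'[OF gV(2)[OF that]] fd_eqI[OF g'(1)[OF that]]
    by (simp_all add: bij_is_surj surj_f_inv_f)
  define A where "A y = matrix (fd f y)" for y
  have A: "smooth_on U (\<lambda>y. A y $ i $ j)" for i j
    unfolding A_def matrix_def by simp (intro smooth_on_vec_nth smooth_on_fd_const f \<open>open U\<close>)
  have A_app: "A y *v w = fd f y w" if "y \<in> U" for y w
    unfolding A_def using bounded_linear.linear[OF lin[OF that]] by (simp add: matrix_works)
  have detA: "det (A (g y)) \<noteq> 0" if "y \<in> V" for y
  proof -
    have "invertible (A (g y))"
      unfolding A_def using bij_is_inj[OF fdg(2)[OF that]] bounded_linear.linear[OF lin[OF gV(2)[OF that]]]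
      by (simp add: invertible_left_inverse matrix_left_invertible_injective matrix_works)
    then show ?thesis by (simp add: invertible_det_nz)
  qed
  have "Ck_on k V g" for k
  proof (induction k)
    case 0
    show ?case using V by (simp add: homeomorphism_def)
  next
    case (Suc k)
    have "Ck_on k V (\<lambda>y. fd g y b)" for b
    proof -
      \<comment> \<open>Cramer's solution as a function of the point \<open>z\<close> in the source.
        Its smoothness is known before anything about \<open>g\<close>, and the induction hypothesis
        is used only to compose it with \<open>g\<close>.\<close>
      define X where "X z = (\<chi> k. det (\<chi> i j. if j = k then b $ i else A z $ i $ j) / det (A z))" for z
      define W where "W = {z \<in> U. det (A z) \<noteq> 0}"
      have "open W"
      proof -
        have "continuous_on U (\<lambda>z. det (A z))"
          by (intro smooth_on_continuous_on[OF smooth_on_det] A \<open>open U\<close>)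
        then have "open (U \<inter> (\<lambda>z. det (A z)) -` (- {0}))"
          by (intro continuous_open_preimage \<open>open U\<close>) auto
        then show ?thesis by (simp add: W_def vimage_def Int_def)
      qed
      have "A z *v X z = b" if "z \<in> W" for z
        by (rule iffD2[OF cramer]) (use that in \<open>simp_all only: W_def X_def mem_Collect_eq not_False_eq_True\<close>)
      then have "smooth_on W X"
        by (rule smooth_on_linear_solution[of W A "\<lambda>_. b", OF smooth_on_subset[OF A] smooth_on_const \<open>open W\<close>, rotated 2])
          (auto simp: W_def)
      then have "Ck_on k V (\<lambda>y. X (g y))"
        by (intro Ck_on_compose[OF \<open>open V\<close> _ Suc.IH, of W X])
          (use gV detA in \<open>auto simp: W_def smooth_on_def\<close>)
      then show ?thesis
      proof (rule Ck_on_cong[OF \<open>open V\<close>, rotated])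
        show "X (g y) = fd g y b" if "y \<in> V" for y
          unfolding X_def
          by (rule iffD1[OF cramer[OF detA[OF that]], symmetric])
            (simp only: fdg(1)[OF that] A_app[OF gV(2)[OF that]])
      qed
    qed
    then show ?case using g'(1) by (auto simp: differentiable_def)
  qed
  then have "smooth_on V g" by (simp add: smooth_on_def)
  moreover have "g (f x0) = x0" using V by (auto simp: homeomorphism_def)
  ultimately show ?thesis using that V gV by blast
qed


section \<open>Killing fields of a Lagrangian and the curvature of its spray\<close>

lemma fd_Pair_split:
  assumes "f differentiable (at z)"
  shows "fd f z (a, b) = fd f z (a, 0) + fd f z (0, b)"
  using linear_add[OF linear_fd[OF assms], of "(a, 0)" "(0, b)"] by simp

lemma fd_zero_at: "f differentiable (at z) \<Longrightarrow> fd f z 0 = 0"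
  using linear_fd linear_0 by blast

lemma has_derivative_fd_at:
  fixes f :: "'b::euclidean_space \<Rightarrow> 'c::real_normed_vector"
  assumes "smooth_on S f" "open S" "z \<in> S" "smooth_on S h"
  shows "((\<lambda>z. fd f z (h z)) has_derivative
      (\<lambda>w. fd (\<lambda>y. fd f y (h z)) z w + fd f z (fd h z w))) (at z)"
  using has_derivative_fd[OF assms(1-2), of "\<lambda>z. z", OF _ has_derivative_ident smooth_on_has_derivative[OF assms(4)]]
  assms by simp

text \<open>The invariance is differentiated along \<open>a\<close>; symmetry of the second
  derivative then puts \<open>V z\<close> into the outer slot.\<close>

lemma invariant_function_fd:
  fixes L :: "'a::euclidean_space \<Rightarrow> 'b::euclidean_space"
  assumes L: "smooth_on S L" and V: "smooth_on S V" and "open S" "z \<in> S"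
    and inv: "\<And>z. z \<in> S \<Longrightarrow> fd L z (V z) = 0"
  shows "fd (\<lambda>z. fd L z a) z (V z) = - fd L z (fd V z a)"
proof -
  have "((\<lambda>z. fd L z (V z)) has_derivative (\<lambda>w. 0)) (at z)"
    by (rule has_derivative_transform_within_open[OF has_derivative_const[of 0] \<open>open S\<close> \<open>z \<in> S\<close>])
      (simp add: inv)
  from has_derivative_unique[OF this has_derivative_fd_at[OF L \<open>open S\<close> \<open>z \<in> S\<close> V]]
  have "fd (\<lambda>y. fd L y (V z)) z a + fd L z (fd V z a) = 0"
    by metis
  then show ?thesis
    using fd_fd_commute[OF L \<open>open S\<close> \<open>z \<in> S\<close>, of "V z" a] by (simp add: add_eq_0_iff)
qed

text \<open>The preceding identity is differentiated along \<open>b\<close>. It trades a third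
  derivative of \<open>L\<close> with \<open>V z\<close> in one slot for derivatives of lower
  order.\<close>

lemma invariant_function_fd_fd:
  fixes L :: "'a::euclidean_space \<Rightarrow> 'b::euclidean_space"
  assumes L: "smooth_on S L" and V: "smooth_on S V" and "open S" "z \<in> S"
    and inv: "\<And>z. z \<in> S \<Longrightarrow> fd L z (V z) = 0"
  shows "fd (\<lambda>z. fd (\<lambda>z. fd L z a) z b) z (V z) =
    - fd (\<lambda>z. fd L z a) z (fd V z b) - fd (\<lambda>z. fd L z b) z (fd V z a) - fd L z (fd (\<lambda>z. fd V z a) z b)"
proof -
  have La: "smooth_on S (\<lambda>z. fd L z a)" and Va: "smooth_on S (\<lambda>z. fd V z a)"
    using L V \<open>open S\<close> by (auto intro: smooth_on_fd_const)
  have 0: "((\<lambda>z. fd (\<lambda>z. fd L z a) z (V z) + fd L z (fd V z a)) has_derivative (\<lambda>w. 0)) (at z)"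
    by (rule has_derivative_transform_within_open[OF has_derivative_const[of 0] \<open>open S\<close> \<open>z \<in> S\<close>])
      (simp add: invariant_function_fd[OF L V \<open>open S\<close> _ inv])
  have "((\<lambda>z. fd (\<lambda>z. fd L z a) z (V z) + fd L z (fd V z a)) has_derivative
    (\<lambda>w. (fd (\<lambda>y. fd (\<lambda>z. fd L z a) y (V z)) z w + fd (\<lambda>z. fd L z a) z (fd V z w)) +
       (fd (\<lambda>y. fd L y (fd V z a)) z w + fd L z (fd (\<lambda>z. fd V z a) z w)))) (at z)"
    using assms La Va by (intro has_derivative_add has_derivative_fd_at[of S]) auto
  from has_derivative_unique[OF 0 this]
  have "(fd (\<lambda>y. fd (\<lambda>z. fd L z a) y (V z)) z b + fd (\<lambda>z. fd L z a) z (fd V z b)) +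
       (fd (\<lambda>y. fd L y (fd V z a)) z b + fd L z (fd (\<lambda>z. fd V z a) z b)) = 0"
    by metis
  moreover have "fd (\<lambda>y. fd (\<lambda>z. fd L z a) y (V z)) z b = fd (\<lambda>z. fd (\<lambda>z. fd L z a) z b) z (V z)"
    by (rule fd_fd_commute[OF La \<open>open S\<close> \<open>z \<in> S\<close>])
  moreover have "fd (\<lambda>y. fd L y (fd V z a)) z b = fd (\<lambda>z. fd L z b) z (fd V z a)"
    by (rule fd_fd_commute[OF L \<open>open S\<close> \<open>z \<in> S\<close>])
  ultimately show ?thesis by (simp add: algebra_simps eq_neg_iff_add_eq_0)
qed

definition complete_lift :: "('a::real_normed_vector \<Rightarrow> 'a) \<Rightarrow> 'a \<times> 'a \<Rightarrow> 'a \<times> 'a" where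
  "complete_lift X z = (X (fst z), fd X (fst z) (snd z))"

lemma complete_lift_Pair: "complete_lift X (x, y) = (X x, fd X x y)"
  by (simp add: complete_lift_def)

lemma open_Times_UNIV: "open T \<Longrightarrow> open (T \<times> UNIV)"
  by (simp add: open_Times)

lemma smooth_on_complete_lift:
  fixes X :: "'a::euclidean_space \<Rightarrow> 'a"
  assumes "smooth_on T X" "open T"
  shows "smooth_on (T \<times> UNIV) (complete_lift X)"
proof -
  have o: "open (T \<times> UNIV :: ('a \<times> 'a) set)"
    using \<open>open T\<close> by (rule open_Times_UNIV)
  show ?thesis
    unfolding complete_lift_def
    by (intro smooth_on_Pair smooth_on_compose[OF assms(1)] smooth_on_fd[OF assms(1)]
        smooth_on_fst smooth_on_snd smooth_on_ident o) auto
qed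

lemma fd_complete_lift:
  fixes X :: "'a::euclidean_space \<Rightarrow> 'a"
  assumes "smooth_on T X" "open T" "x \<in> T"
  shows "fd (complete_lift X) (x, y) (a, b) = (fd X x a, fd (\<lambda>x. fd X x y) x a + fd X x b)"
proof -
  have 1: "((\<lambda>z. X (fst z)) has_derivative (\<lambda>w. fd X x (fst w))) (at (x, y))"
    using has_derivative_compose[OF has_derivative_fst[OF has_derivative_ident], of X _ "(x, y)"]
      smooth_on_has_derivative[OF assms(1,3)] by simp
  have 2: "((\<lambda>z. fd X (fst z) (snd z)) has_derivative
     (\<lambda>w. fd (\<lambda>x. fd X x y) x (fst w) + fd X x (snd w))) (at (x, y))"
    using has_derivative_fd[OF assms(1,2), of fst "(x, y)" fst snd snd] assms(3)
    by (simp add: has_derivative_fst[OF has_derivative_ident] has_derivative_snd[OF has_derivative_ident])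
  show ?thesis
    unfolding complete_lift_def using fd_eqI[OF has_derivative_Pair[OF 1 2]] by simp
qed

text \<open>The lift is linear in the fibre coordinate, so its derivative along
  \<open>(0, w)\<close> no longer depends on \<open>y\<close>, and only the base direction
  \<open>a\<close> contributes to the next derivative.\<close>

lemma fd_fd_complete_lift:
  fixes X :: "'a::euclidean_space \<Rightarrow> 'a"
  assumes "smooth_on T X" "open T" "x \<in> T"
  shows "fd (\<lambda>z. fd (complete_lift X) z (0, w)) (x, y) (a, b) = (0, fd (\<lambda>x. fd X x w) x a)"
proof -
  have o: "open (T \<times> (UNIV :: 'a set))"
    using \<open>open T\<close> by (rule open_Times_UNIV)
  have s: "smooth_on T (\<lambda>x. fd X x w)" using assms by (intro smooth_on_fd_const)
  have "fd (\<lambda>z. fd (complete_lift X) z (0, w)) (x, y) = fd (\<lambda>z. (0, fd X (fst z) w)) (x, y)"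
  proof (rule fd_cong[OF o])
    show "fd (complete_lift X) z (0, w) = (0, fd X (fst z) w)" if "z \<in> T \<times> UNIV" for z
      using that fd_complete_lift[OF assms(1,2), of "fst z" "snd z" 0 w]
        fd_zero_at[OF smooth_on_differentiable[OF assms(1)]]
        fd_zero_at[OF smooth_on_differentiable[OF smooth_on_fd_const[OF assms(1,2)]]]
      by auto
  qed (use assms in auto)
  moreover have "((\<lambda>z. (0::'a, fd X (fst z) w)) has_derivative (\<lambda>h. (0, fd (\<lambda>x. fd X x w) x (fst h)))) (at (x, y))"
    using has_derivative_Pair[OF has_derivative_const[of 0]
       has_derivative_compose[OF has_derivative_fst[OF has_derivative_ident], of "\<lambda>x. fd X x w" _ "(x, y)"]]
      smooth_on_has_derivative[OF s assms(3)] by simp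
  ultimately show ?thesis by (simp add: fd_eqI)
qed


text \<open>\<open>L\<close> plays the role of the squared norm. The spray is characterised by an
  equation tested against all \<open>w\<close>, equivalent to the formula with the inverse matrix:
  the factor 2 comes from the quarter in the spray coefficients and the half in the metric. The last
  assumption is Euler's identity for the vertical derivative of \<open>L\<close>, which is
  homogeneous of degree 1.\<close>

locale spray =
  fixes \<Omega> :: "'a::euclidean_space set" and L :: "'a \<times> 'a \<Rightarrow> real" and Sp :: "'a \<times> 'a \<Rightarrow> 'a"
  assumes open_\<Omega>: "open \<Omega>"
    and smooth_L: "smooth_on (\<Omega> \<times> (UNIV - {0})) L"
    and smooth_Sp: "smooth_on (\<Omega> \<times> (UNIV - {0})) Sp"
    and euler_lagrange: "z \<in> \<Omega> \<times> (UNIV - {0}) \<Longrightarrow>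
      2 * fd (\<lambda>z. fd L z (0, w)) z (0, Sp z) = fd (\<lambda>z. fd L z (0, w)) z (snd z, 0) - fd L z (w, 0)"
    and nondegenerate: "z \<in> \<Omega> \<times> (UNIV - {0}) \<Longrightarrow> w \<noteq> 0 \<Longrightarrow> fd (\<lambda>z. fd L z (0, w)) z (0, w) > 0"
    and euler: "z \<in> \<Omega> \<times> (UNIV - {0}) \<Longrightarrow> fd (\<lambda>z. fd L z (0, w)) z (0, snd z) = fd L z (0, w)"
begin

abbreviation "S \<equiv> \<Omega> \<times> (UNIV - {0 :: 'a})"

text \<open>Twice the fundamental tensor.\<close>

abbreviation vert :: "'a \<times> 'a \<Rightarrow> 'a \<Rightarrow> 'a \<Rightarrow> real" where
  "vert z v w \<equiv> fd (\<lambda>z. fd L z (0, w)) z (0, v)"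

definition killing :: "('a \<Rightarrow> 'a) \<Rightarrow> bool" where
  "killing X \<longleftrightarrow> smooth_on \<Omega> X \<and> (\<forall>z\<in>S. fd L z (complete_lift X z) = 0)"

text \<open>The coordinate formula for the Riemann curvature, contracted with \<open>v\<close>.\<close>

definition curv :: "'a \<times> 'a \<Rightarrow> 'a \<Rightarrow> 'a" where
  "curv z v = 2 *\<^sub>R fd Sp z (v, 0) - fd (\<lambda>z. fd Sp z (0, v)) z (snd z, 0)
     + 2 *\<^sub>R fd (\<lambda>z. fd Sp z (0, v)) z (0, Sp z) - fd Sp z (0, fd Sp z (0, v))"

text \<open>The covariant derivative, in direction \<open>X\<close>, of fields that are invariant under the flow of
  the geodesic Killing field \<open>X\<close>.\<close>

definition conn :: "('a \<Rightarrow> 'a) \<Rightarrow> 'a \<times> 'a \<Rightarrow> 'a \<Rightarrow> 'a" where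
  "conn X z v = fd X (fst z) v + fd Sp z (0, v)"

lemma open_S: "open S"
  using open_\<Omega> by (intro open_Times) (auto intro: open_delete)

lemma smooth_L1: "smooth_on S (\<lambda>z. fd L z a)"
  using smooth_L open_S by (rule smooth_on_fd_const)

lemma smooth_Sp1: "smooth_on S (\<lambda>z. fd Sp z a)"
  using smooth_Sp open_S by (rule smooth_on_fd_const)

lemma differentiable_L: "z \<in> S \<Longrightarrow> L differentiable (at z)"
  using smooth_L smooth_on_differentiable by blast

lemma differentiable_L1: "z \<in> S \<Longrightarrow> (\<lambda>z. fd L z a) differentiable (at z)"
  using smooth_L1 smooth_on_differentiable by blast

lemma linear_L: "z \<in> S \<Longrightarrow> linear (fd L z)"
  using differentiable_L linear_fd by blast

lemma linear_L1: "z \<in> S \<Longrightarrow> linear (fd (\<lambda>z. fd L z a) z)"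
  using differentiable_L1 linear_fd by blast

lemma L1_commute: "z \<in> S \<Longrightarrow> fd (\<lambda>z. fd L z a) z b = fd (\<lambda>z. fd L z b) z a"
  using fd_fd_commute[OF smooth_L open_S] .

lemma vert_linear: "z \<in> S \<Longrightarrow> linear (\<lambda>v. vert z v w)"
  using linear_compose[OF _ linear_L1, of "\<lambda>v. (0, v)"] by (simp add: o_def linear_iff)

lemma vert_add: "z \<in> S \<Longrightarrow> vert z (a + b) w = vert z a w + vert z b w"
  and vert_diff: "z \<in> S \<Longrightarrow> vert z (a - b) w = vert z a w - vert z b w"
  and vert_minus: "z \<in> S \<Longrightarrow> vert z (- a) w = - vert z a w"
  and vert_scaleR: "z \<in> S \<Longrightarrow> vert z (c *\<^sub>R a) w = c * vert z a w"
  using linear_add[OF vert_linear] linear_diff[OF vert_linear] linear_neg[OF vert_linear]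
    linear_scale[OF vert_linear, unfolded real_scaleR_def] by blast+

lemma vert_commute: "z \<in> S \<Longrightarrow> vert z v w = vert z w v"
  by (rule L1_commute)

lemma vert_eqI:
  assumes "z \<in> S" "\<And>w. vert z a w = vert z b w"
  shows "a = b"
proof (rule ccontr)
  assume "a \<noteq> b"
  then have "vert z (a - b) (a - b) > 0" using nondegenerate \<open>z \<in> S\<close> by simp
  moreover have "vert z (a - b) (a - b) = 0"
    using linear_diff[OF vert_linear[OF \<open>z \<in> S\<close>]] assms(2) by simp
  ultimately show False by simp
qed

text \<open>The Euler-Lagrange equation differentiated along \<open>h\<close>. The terms in which
  \<open>h\<close> hits the inserted vectors \<open>Sp z\<close> and \<open>snd z\<close> are split
  off, so that third derivatives of \<open>L\<close> occur with frozen slots only.\<close>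

lemma euler_lagrange_fd:
  assumes z: "z \<in> S"
  shows "2 * (fd (\<lambda>z'. fd (\<lambda>z. fd L z (0, w)) z' (0, Sp z)) z h + vert z (fd Sp z h) w) =
    fd (\<lambda>z'. fd (\<lambda>z. fd L z (0, w)) z' (snd z, 0)) z h + fd (\<lambda>z. fd L z (0, w)) z (snd h, 0)
     - fd (\<lambda>z. fd L z (w, 0)) z h"
proof -
  let ?L = "\<lambda>z. fd L z (0, w)"
  have hd: "(Sp has_derivative fd Sp z) (at z)" using smooth_Sp z by (rule smooth_on_has_derivative)
  have 1: "((\<lambda>z. 2 * fd ?L z (0, Sp z)) has_derivative
      (\<lambda>h. 2 * (fd (\<lambda>z'. fd ?L z' (0, Sp z)) z h + fd ?L z (0, fd Sp z h)))) (at z)"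
    using has_derivative_fd[OF smooth_L1 open_S, of "\<lambda>z. z" z _ "\<lambda>z. (0, Sp z)",
        OF _ has_derivative_ident has_derivative_Pair[OF has_derivative_const hd]] z
    by (intro has_derivative_mult_right) simp
  have 2: "((\<lambda>z. fd ?L z (snd z, 0) - fd L z (w, 0)) has_derivative
      (\<lambda>h. fd (\<lambda>z'. fd ?L z' (snd z, 0)) z h + fd ?L z (snd h, 0) - fd (\<lambda>z. fd L z (w, 0)) z h)) (at z)"
    using has_derivative_fd[OF smooth_L1 open_S, of "\<lambda>z. z" z _ "\<lambda>z. (snd z, 0)",
        OF _ has_derivative_ident has_derivative_Pair[OF has_derivative_snd[OF has_derivative_ident] has_derivative_const]]
      smooth_on_has_derivative[OF smooth_L1 z] z
    by (intro has_derivative_diff) simp_all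
  have "((\<lambda>z. 2 * fd ?L z (0, Sp z)) has_derivative
      (\<lambda>h. fd (\<lambda>z'. fd ?L z' (snd z, 0)) z h + fd ?L z (snd h, 0) - fd (\<lambda>z. fd L z (w, 0)) z h)) (at z)"
    by (rule has_derivative_transform_within_open[OF 2 open_S z]) (simp only: euler_lagrange)
  from fun_cong[OF has_derivative_unique[OF 1 this], of h] show ?thesis .
qed

context
  fixes X assumes X: "killing X"
begin

lemma smooth_killing: "smooth_on \<Omega> X" using X by (simp add: killing_def)

lemma smooth_lift: "smooth_on S (complete_lift X)"
  using smooth_on_complete_lift[OF smooth_killing open_\<Omega>] by (rule smooth_on_subset) auto

lemma lift_L: "z \<in> S \<Longrightarrow> fd L z (complete_lift X z) = 0"
  using X unfolding killing_def by blast

lemma killing_fd_zero: "x \<in> \<Omega> \<Longrightarrow> fd X x 0 = 0" "x \<in> \<Omega> \<Longrightarrow> fd (\<lambda>x. fd X x w) x 0 = 0"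
  using fd_zero_at smooth_on_differentiable smooth_killing smooth_on_fd_const[OF smooth_killing open_\<Omega>] by blast+

lemma killing_fd:
  assumes "(x, y) \<in> S"
  shows "fd (\<lambda>z. fd L z (a, b)) (x, y) (X x, fd X x y) = - fd L (x, y) (fd X x a, fd (\<lambda>x. fd X x y) x a + fd X x b)"
  using invariant_function_fd[OF smooth_L smooth_lift open_S assms lift_L, of "(a, b)"]
    fd_complete_lift[OF smooth_killing open_\<Omega>, of x y a b] assms
  by (simp add: complete_lift_Pair)

lemma killing_fd_fd:
  assumes "(x, y) \<in> S"
  shows "fd (\<lambda>z. fd (\<lambda>z. fd L z (0, w)) z (a, b)) (x, y) (X x, fd X x y) =
    - fd (\<lambda>z. fd L z (0, w)) (x, y) (fd X x a, fd (\<lambda>x. fd X x y) x a + fd X x b)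
    - fd (\<lambda>z. fd L z (a, b)) (x, y) (0, fd X x w) - fd L (x, y) (0, fd (\<lambda>x. fd X x w) x a)"
proof -
  have "fd X x 0 = 0" "fd (\<lambda>x. fd X x y) x 0 = 0"
    using assms killing_fd_zero by auto
  then show ?thesis
    using invariant_function_fd_fd[OF smooth_L smooth_lift open_S assms lift_L, of "(0, w)" "(a, b)"]
      fd_complete_lift[OF smooth_killing open_\<Omega>, of x y] assms
      fd_fd_complete_lift[OF smooth_killing open_\<Omega>, of x w y a b]
    by (simp add: complete_lift_Pair)
qed

text \<open>This is the vertical component of the vanishing bracket of the complete lift with the
  spray field \<open>(y, -2 Sp)\<close>. The Euler-Lagrange equation is differentiated along the
  lift, the Killing identities remove the third derivatives of \<open>L\<close>, and nondegeneracy
  of \<open>vert\<close> strips the test vector \<open>w\<close>.\<close>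

lemma killing_spray:
  assumes "(x, y) \<in> S"
  shows "2 *\<^sub>R fd Sp (x, y) (X x, fd X x y) = 2 *\<^sub>R fd X x (Sp (x, y)) - fd (\<lambda>x. fd X x y) x y"
proof (rule vert_eqI[OF assms])
  fix w
  let ?z = "(x, y)" and ?V = "(X x, fd X x y)" and ?g = "Sp (x, y)" and ?L = "\<lambda>w z. fd L z (0, w)"
  have "2 * (fd (\<lambda>y. fd (?L w) y (0, ?g)) ?z ?V + fd (?L w) ?z (0, fd Sp ?z ?V)) =
    fd (\<lambda>z. fd (?L w) z (y, 0)) ?z ?V + fd (?L w) ?z (fd X x y, 0) - fd (\<lambda>z. fd L z (w, 0)) ?z ?V"
    using euler_lagrange_fd[OF assms, of w ?V] by simp
  moreover have "fd X x 0 = 0" "fd (\<lambda>x. fd X x y) x 0 = 0" "fd (\<lambda>x. fd X x w) x 0 = 0" "fd L ?z (0, 0) = 0"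
    using assms killing_fd_zero linear_0[OF linear_L[OF assms]] by (auto simp: zero_prod_def)
  moreover have "fd (\<lambda>x. fd X x y) x w = fd (\<lambda>x. fd X x w) x y"
    using fd_fd_commute[OF smooth_killing open_\<Omega>] assms by auto
  moreover have "fd (\<lambda>z. fd L z (0, ?g)) ?z (0, fd X x w) = fd (?L (fd X x w)) ?z (0, ?g)"
    "fd (\<lambda>z. fd L z (y, 0)) ?z (0, fd X x w) = fd (?L (fd X x w)) ?z (y, 0)"
    using L1_commute assms by auto
  \<comment> \<open>The terms in which the derivative falls on the test vector combine to the
    Euler-Lagrange equation with test vector \<open>fd X x w\<close>.\<close>
  moreover have "2 * fd (?L (fd X x w)) ?z (0, ?g) = fd (?L (fd X x w)) ?z (y, 0) - fd L ?z (fd X x w, 0)"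
    using euler_lagrange[OF assms] by simp
  moreover have "fd (?L w) ?z (fd X x y, fd (\<lambda>x. fd X x y) x y) = fd (?L w) ?z (fd X x y, 0) + vert ?z (fd (\<lambda>x. fd X x y) x y) w"
    "fd L ?z (fd X x w, fd (\<lambda>x. fd X x y) x w) = fd L ?z (fd X x w, 0) + fd L ?z (0, fd (\<lambda>x. fd X x y) x w)"
    using assms by (blast intro: fd_Pair_split differentiable_L1 differentiable_L)+
  ultimately have "2 * vert ?z (fd Sp ?z ?V) w = 2 * vert ?z (fd X x ?g) w - vert ?z (fd (\<lambda>x. fd X x y) x y) w"
    using killing_fd_fd[OF assms, of w 0 ?g] killing_fd_fd[OF assms, of w y 0] killing_fd[OF assms, of w 0]
    by simp
  then show "vert ?z (2 *\<^sub>R fd Sp ?z ?V) w = vert ?z (2 *\<^sub>R fd X x ?g - fd (\<lambda>x. fd X x y) x y) w"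
    by (simp only: vert_diff[OF assms] vert_scaleR[OF assms])
qed

end

text \<open>The conclusion is the geodesic equation \<open>x'' = -2 Sp (x, x')\<close> for the
  integral curve of \<open>U\<close>, since there \<open>x'' = fd U x y\<close>. In the
  Euler-Lagrange equation tested against \<open>w\<close>, the mixed term is read off from
  invariance under \<open>U\<close> and the base derivative from invariance under \<open>W\<close>;
  the leftovers differ by the vertical derivative of \<open>L\<close> along the bracket of
  \<open>U\<close> and \<open>W\<close>, which is assumed to vanish.\<close>

lemma geodesic_killing:
  assumes z: "(x, y) \<in> S" and U: "killing U" "U x = y"
    and W: "\<And>w. \<exists>W. killing W \<and> W x = w \<and> fd L (x, y) (0, fd W x y - fd U x w) = 0"
  shows "2 *\<^sub>R Sp (x, y) = - fd U x y"
proof (rule vert_eqI[OF z])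
  fix w
  obtain W where W: "killing W" "W x = w" "fd L (x, y) (0, fd W x y - fd U x w) = 0"
    using W by blast
  let ?z = "(x, y)"
  have 0: "fd U x 0 = 0" "fd (\<lambda>x. fd U x y) x 0 = 0"  "fd W x 0 = 0" "fd (\<lambda>x. fd W x y) x 0 = 0"
    using z killing_fd_zero[OF U(1)] killing_fd_zero[OF W(1)] by auto
  have "fd (\<lambda>z. fd L z (0, w)) ?z (y, fd U x y) = - fd L ?z (0, fd U x w)"
    using killing_fd[OF U(1) z, of 0 w] U(2) 0 by simp
  moreover have "fd (\<lambda>z. fd L z (0, w)) ?z (y, fd U x y) = fd (\<lambda>z. fd L z (0, w)) ?z (y, 0) + vert ?z (fd U x y) w"
    by (intro fd_Pair_split differentiable_L1 z)
  moreover have "fd L ?z (w, fd W x y) = fd L ?z (w, 0) + fd L ?z (0, fd W x y)"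
    by (intro fd_Pair_split differentiable_L z)
  moreover have "fd L ?z (w, fd W x y) = 0"
    using lift_L[OF W(1) z] W(2) by (simp add: complete_lift_Pair)
  moreover have "fd L ?z (0, fd W x y) = fd L ?z (0, fd U x w)"
    using W(3) linear_diff[OF linear_L[OF z], of "(0, fd W x y)" "(0, fd U x w)"] by simp
  ultimately have "2 * vert ?z (Sp ?z) w = - vert ?z (fd U x y) w"
    using euler_lagrange[OF z, of w] by simp
  then show "vert ?z (2 *\<^sub>R Sp ?z) w = vert ?z (- fd U x y) w"
    by (simp only: vert_minus[OF z] vert_scaleR[OF z])
qed

text \<open>The Euler-Lagrange equation with test vector \<open>w2\<close> is differentiated
  vertically along \<open>w1\<close>. Invariance under \<open>U\<close> disposes of the third
  derivatives of \<open>L\<close>; invariance under \<open>W1\<close> and \<open>W2\<close> replaces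
  the remaining base derivatives by brackets and vertical pairings.\<close>

lemma killing_koszul:
  assumes z: "(x, y) \<in> S" and U: "killing U" "U x = y" and geo: "2 *\<^sub>R Sp (x, y) = - fd U x y"
    and W1: "killing W1" "W1 x = w1" and W2: "killing W2" "W2 x = w2"
  shows "2 * vert (x, y) (conn U (x, y) w1) w2 = vert (x, y) (fd U x w1 - fd W1 x y) w2
     + vert (x, y) (fd W2 x y - fd U x w2) w1 + vert (x, y) (fd W2 x w1 - fd W1 x w2) y"
proof -
  let ?z = "(x, y)" and ?L = "\<lambda>w z. fd L z (0, w)" and ?g = "Sp (x, y)"
  have main: "2 * (fd (\<lambda>y. fd (?L w2) y (0, ?g)) ?z (0, w1) + vert ?z (fd Sp ?z (0, w1)) w2) =
    fd (\<lambda>z. fd (?L w2) z (y, 0)) ?z (0, w1) + fd (?L w2) ?z (w1, 0) - fd (\<lambda>z. fd L z (w2, 0)) ?z (0, w1)"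
    using euler_lagrange_fd[OF z, of w2 "(0, w1)"] by simp
  let ?T = "fd (\<lambda>z. fd (?L w2) z (0, w1)) ?z"
  have T: "linear ?T"
    using smooth_on_fd_const[OF smooth_L1 open_S] z smooth_on_differentiable by (intro linear_fd) blast
  have "fd (\<lambda>y. fd (?L w2) y b) ?z (0, w1) = ?T b" for b
    by (rule fd_fd_commute[OF smooth_L1 open_S z])
  \<comment> \<open>By \<open>geo\<close> the lift of \<open>U\<close> at \<open>(x, y)\<close> is
    the spray vector \<open>(y, -2 Sp)\<close>, so the third derivatives of \<open>L\<close> in
    \<open>main\<close> add up to a single one along this lift.\<close>
  moreover have "?T (y, fd U x y) = ?T (y, 0) - 2 * ?T (0, ?g)"
    using linear_diff[OF T, of "(y, 0)" "2 *\<^sub>R (0, ?g)"] linear_scale[OF T, of 2 "(0, ?g)"] geo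
    by simp
  moreover have 0: "fd U x 0 = 0" "fd (\<lambda>x. fd U x y) x 0 = 0" "fd (\<lambda>x. fd U x w2) x 0 = 0" "fd W1 x 0 = 0" "fd (\<lambda>x. fd W1 x y) x 0 = 0"
      "fd W2 x 0 = 0" "fd (\<lambda>x. fd W2 x y) x 0 = 0" "fd L ?z (0, 0) = 0"
    using z killing_fd_zero[OF U(1)] killing_fd_zero[OF W1(1)] killing_fd_zero[OF W2(1)] linear_0[OF linear_L[OF z]]
    by (auto simp: zero_prod_def)
  moreover have "?T (y, fd U x y) = - vert ?z (fd U x w1) w2 - vert ?z (fd U x w2) w1"
    using killing_fd_fd[OF U(1) z, of w2 0 w1] U(2) 0 by simp
  moreover have "fd (\<lambda>z. fd L z (w2, 0)) ?z (0, w1) = fd (?L w1) ?z (w2, 0)"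
    by (rule L1_commute[OF z])
  \<comment> \<open>Invariance under \<open>W\<close>, differentiated vertically, exchanges the base
    direction \<open>W x\<close> for vertical directions; Euler's identity writes the first-order
    remainder as a pairing with \<open>y\<close>.\<close>
  moreover have kill: "fd (?L b) ?z (W x, 0) = - vert ?z (fd W x y) b - vert ?z (fd W x b) y"
    if "killing W" for W b
  proof -
    have "fd W x 0 = 0" "fd (\<lambda>x. fd W x y) x 0 = 0"
      using z killing_fd_zero[OF that] by auto
    moreover have "fd (?L b) ?z (W x, fd W x y) = fd (?L b) ?z (W x, 0) + vert ?z (fd W x y) b"
      by (intro fd_Pair_split differentiable_L1 z)
    moreover have "fd L ?z (0, fd W x b) = vert ?z (fd W x b) y"
      using euler[OF z, of "fd W x b"] vert_commute[OF z] by simp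
    ultimately show ?thesis
      using killing_fd[OF that z, of 0 b] by simp
  qed
  ultimately have "2 * vert ?z (fd Sp ?z (0, w1)) w2 = - vert ?z (fd U x w1) w2 - vert ?z (fd U x w2) w1
     - vert ?z (fd W1 x y) w2 - vert ?z (fd W1 x w2) y + vert ?z (fd W2 x y) w1 + vert ?z (fd W2 x w1) y"
    using main kill[OF W1(1), of w2] kill[OF W2(1), of w1] W1(2) W2(2) by simp
  then show ?thesis
    unfolding conn_def by (simp add: vert_add[OF z] vert_diff[OF z])
qed

text \<open>Each piece of \<open>curv\<close> is rewritten by a Killing equation: the base
  derivative of the spray by \<open>killing_spray\<close> for \<open>V\<close>, the second
  derivatives of the spray by the vertical derivative of \<open>killing_spray\<close> for
  \<open>U\<close>. The second derivatives of \<open>U\<close> and \<open>V\<close> that this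
  produces are removed by differentiating \<open>comm\<close> along \<open>y\<close>.\<close>

lemma curv_killing:
  assumes z: "(x, y) \<in> S" and U: "killing U" "U x = y" and V: "killing V" "V x = v"
    and geo: "2 *\<^sub>R Sp (x, y) = - fd U x y"
    and comm: "\<And>x. x \<in> \<Omega> \<Longrightarrow> fd V x (U x) = fd U x (V x)"
  shows "curv (x, y) v = - conn U (x, y) (conn U (x, y) v)"
proof -
  let ?z = "(x, y)" and ?g = "Sp (x, y)"
  let ?N = "fd Sp ?z"
  have x: "x \<in> \<Omega>" using z by auto
  note sU = smooth_killing[OF U(1)] and sV = smooth_killing[OF V(1)]
  have N: "linear ?N" using smooth_Sp z smooth_on_differentiable linear_fd by blast
  have dU: "linear (fd U x)" and dV: "linear (fd V x)"
    using sU sV x smooth_on_differentiable linear_fd by blast+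
  let ?DU = "fd U x" and ?DV = "fd V x"
  let ?DDU = "\<lambda>a b. fd (\<lambda>x. fd U x a) x b" and ?DDV = "\<lambda>a b. fd (\<lambda>x. fd V x a) x b"
  have comm1: "?DDU v y + ?DU (?DV y) = ?DDV y y + ?DV (?DU y)"
  proof -
    have 1: "((\<lambda>x. fd U x (V x)) has_derivative (\<lambda>w. ?DDU v w + ?DU (?DV w))) (at x)"
      using has_derivative_fd_at[OF sU open_\<Omega> x sV] V(2) by simp
    have 2: "((\<lambda>x. fd V x (U x)) has_derivative (\<lambda>w. ?DDV y w + ?DV (?DU w))) (at x)"
      using has_derivative_fd_at[OF sV open_\<Omega> x sU] U(2) by simp
    have "((\<lambda>x. fd V x (U x)) has_derivative (\<lambda>w. ?DDU v w + ?DU (?DV w))) (at x)"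
      by (rule has_derivative_transform_within_open[OF 1 open_\<Omega> x]) (simp add: comm)
    from has_derivative_unique[OF 2 this] show ?thesis by metis
  qed
  have DVy: "?DV y = ?DU v" using comm[OF x] U V by simp
  have kV: "2 *\<^sub>R ?N (v, ?DV y) = 2 *\<^sub>R ?DV ?g - ?DDV y y"
    using killing_spray[OF V(1) z] V(2) by simp
  \<comment> \<open>For fixed \<open>x\<close>, \<open>killing_spray\<close> for \<open>U\<close> is
    an identity in the fibre coordinate; it is differentiated along \<open>v\<close>.\<close>
  have kU: "fd (\<lambda>z. fd Sp z (0, v)) ?z (y, ?DU y) + ?N (0, ?DU v) = ?DU (?N (0, v)) - ?DDU v y"
  proof -
    have B: "bounded_bilinear ?DDU"
    proof -
      have "linear (\<lambda>b. ?DDU a b)" for a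
        using smooth_on_differentiable[OF smooth_on_fd_const[OF sU open_\<Omega>] x] by (rule linear_fd)
      moreover have "?DDU a b = ?DDU b a" for a b
        by (rule fd_fd_commute[OF sU open_\<Omega> x])
      ultimately have "bilinear ?DDU" by (simp add: bilinear_def)
      then show ?thesis by (simp add: bilinear_conv_bounded_bilinear)
    qed
    have bU: "bounded_linear ?DU"
      using dU by (simp add: linear_conv_bounded_linear)
    have hz: "((\<lambda>y. (x, y)) has_derivative (\<lambda>w. (0, w))) (at y)"
      by (intro has_derivative_Pair has_derivative_const has_derivative_ident)
    have 1: "((\<lambda>y. fd Sp (x, y) (U x, ?DU y)) has_derivative
       (\<lambda>w. fd (\<lambda>q. fd Sp q (U x, ?DU y)) ?z (0, w) + ?N (0, ?DU w))) (at y)"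
      by (rule has_derivative_fd[OF smooth_Sp open_S z hz])
        (intro has_derivative_Pair has_derivative_const bounded_linear_imp_has_derivative bU)
    have 2: "((\<lambda>y. 2 *\<^sub>R ?DU (Sp (x, y)) - ?DDU y y) has_derivative
       (\<lambda>w. 2 *\<^sub>R ?DU (?N (0, w)) - (?DDU y w + ?DDU w y))) (at y)"
      by (intro has_derivative_diff has_derivative_scaleR_right bounded_linear.has_derivative[OF bU]
          has_derivative_compose[OF hz smooth_on_has_derivative[OF smooth_Sp z]]
          bounded_bilinear.FDERIV[OF B] has_derivative_ident)
    have "((\<lambda>y. 2 *\<^sub>R fd Sp (x, y) (U x, ?DU y)) has_derivative
       (\<lambda>w. 2 *\<^sub>R ?DU (?N (0, w)) - (?DDU y w + ?DDU w y))) (at y)"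
      by (rule has_derivative_transform_within_open[OF 2, of "- {0}"])
        (use z killing_spray[OF U(1), of x] in auto)
    from has_derivative_unique[OF has_derivative_scaleR_right[OF 1, of 2] this]
    have "2 *\<^sub>R (fd (\<lambda>q. fd Sp q (U x, ?DU y)) ?z (0, v) + ?N (0, ?DU v))
      = 2 *\<^sub>R ?DU (?N (0, v)) - (?DDU y v + ?DDU v y)"
      by metis
    moreover have "fd (\<lambda>q. fd Sp q (U x, ?DU y)) ?z (0, v) = fd (\<lambda>z. fd Sp z (0, v)) ?z (y, ?DU y)"
      using fd_fd_commute[OF smooth_Sp open_S z] U(2) by simp
    moreover have "?DDU y v = ?DDU v y"
      by (rule fd_fd_commute[OF sU open_\<Omega> x])
    ultimately have "2 *\<^sub>R (fd (\<lambda>z. fd Sp z (0, v)) ?z (y, ?DU y) + ?N (0, ?DU v)) = 2 *\<^sub>R (?DU (?N (0, v)) - ?DDU v y)"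
      by (simp add: algebra_simps scaleR_2)
    then show ?thesis by simp
  qed
  let ?P = "fd (\<lambda>z. fd Sp z (0, v)) ?z"
  have P: "linear ?P" using smooth_on_differentiable[OF smooth_Sp1 z] by (rule linear_fd)
  \<comment> \<open>Since \<open>(y, fd U x y)\<close> is the spray vector, this derivative is, up
    to sign, the pair of second-derivative terms in \<open>curv\<close>.\<close>
  have hP: "?P (y, ?DU y) = ?P (y, 0) - 2 *\<^sub>R ?P (0, ?g)"
    using linear_diff[OF P, of "(y, 0)" "2 *\<^sub>R (0, ?g)"] linear_scale[OF P, of 2 "(0, ?g)"] geo by simp
  moreover have "?N (v, ?DV y) = ?N (v, 0) + ?N (0, ?DU v)"
    unfolding DVy by (intro fd_Pair_split smooth_on_differentiable[OF smooth_Sp z])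
  moreover have "2 *\<^sub>R ?DV ?g = - ?DV (?DU y)"
    using linear_scale[OF dV, of 2 ?g] geo linear_neg[OF dV] by simp
  ultimately have e1: "2 *\<^sub>R ?N (v, 0) = - ?DV (?DU y) - ?DDV y y - 2 *\<^sub>R ?N (0, ?DU v)"
    using kV by (simp add: algebra_simps)
  have e2: "?P (y, 0) - 2 *\<^sub>R ?P (0, ?g) = ?DU (?N (0, v)) - ?DDU v y - ?N (0, ?DU v)"
    unfolding hP[symmetric] by (rule iffD2[OF eq_diff_eq kU])
  have e3: "curv ?z v = 2 *\<^sub>R ?N (v, 0) - (?P (y, 0) - 2 *\<^sub>R ?P (0, ?g)) - ?N (0, ?N (0, v))"
    by (simp add: curv_def)
  have e4: "curv ?z v = (?DDU v y - ?DDV y y - ?DV (?DU y)) - ?N (0, ?DU v) - ?DU (?N (0, v)) - ?N (0, ?N (0, v))"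
    unfolding e3 e1 e2 by (simp add: algebra_simps scaleR_2)
  have e5: "?DDU v y - ?DDV y y - ?DV (?DU y) = - ?DU (?DU v)"
    using comm1 unfolding DVy by (simp add: algebra_simps)
  have e6: "?N (0, ?DU v + ?N (0, v)) = ?N (0, ?DU v) + ?N (0, ?N (0, v))"
    using linear_add[OF N, of "(0, ?DU v)" "(0, ?N (0, v))"] by simp
  show ?thesis
    unfolding e4 e5 conn_def fst_conv linear_add[OF dU] e6 by simp
qed

end


section \<open>The spray and Riemann curvature coefficients in coordinates\<close>

text \<open>\<open>f\<close> has to agree with \<open>g\<close> on \<open>S\<close> only. This is
  what iterated partial derivatives require: the inner one is identified on \<open>S\<close>, and
  the outer one is then computed from its replacement.\<close>

lemma pdx_eq_fd:
  fixes g :: "(real^'n) \<times> (real^'n) \<Rightarrow> real"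
  assumes "open S" "z \<in> S" "smooth_on S g" "\<And>z. z \<in> S \<Longrightarrow> f z = g z"
  shows "pdx k f z = fd g z (axis k 1, 0)"
proof -
  have f: "f differentiable (at z)" "fd f z = fd g z"
    using differentiable_cong_open[OF assms(1,2), of g f] fd_cong[OF assms(1,2), of f g]
      smooth_on_differentiable[OF assms(3,2)] assms(4) by auto
  have "pdx k f z = deriv (\<lambda>t. f (z + t *\<^sub>R (axis k 1, 0))) 0"
    by (cases z) (simp add: pdx_def)
  then show ?thesis by (simp only: deriv_line[OF f(1)] f(2))
qed

lemma pdy_eq_fd:
  fixes g :: "(real^'n) \<times> (real^'n) \<Rightarrow> real"
  assumes "open S" "z \<in> S" "smooth_on S g" "\<And>z. z \<in> S \<Longrightarrow> f z = g z"
  shows "pdy k f z = fd g z (0, axis k 1)"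
proof -
  have f: "f differentiable (at z)" "fd f z = fd g z"
    using differentiable_cong_open[OF assms(1,2), of g f] fd_cong[OF assms(1,2), of f g]
      smooth_on_differentiable[OF assms(3,2)] assms(4) by auto
  have "pdy k f z = deriv (\<lambda>t. f (z + t *\<^sub>R (0, axis k 1))) 0"
    by (cases z) (simp add: pdy_def)
  then show ?thesis by (simp only: deriv_line[OF f(1)] f(2))
qed

lemma linear_vec_sum:
  fixes f :: "real^'n \<Rightarrow> 'b::real_vector"
  assumes "linear f"
  shows "(\<Sum>k\<in>UNIV. v $ k *\<^sub>R f (axis k 1)) = f v"
proof -
  have "f v = f (\<Sum>k\<in>UNIV. v $ k *\<^sub>R axis k 1)"
    using basis_expansion[of v] by (simp add: scalar_mult_eq_scaleR)
  then show ?thesis by (simp add: linear_sum[OF assms] linear_scale[OF assms])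
qed

lemma fd_vec_nth:
  fixes f :: "'a::real_normed_vector \<Rightarrow> real^'n"
  assumes "f differentiable (at z)"
  shows "fd (\<lambda>z. f z $ i) z w = fd f z w $ i"
  using fd_eqI[OF bounded_linear.has_derivative[OF bounded_linear_vec_nth fd_has_derivative[OF assms]]]
  by simp

lemma linear_fst_slot: "linear f \<Longrightarrow> linear (\<lambda>a. f (a, 0))"
  by (auto simp: linear_iff) (metis add.right_neutral add_Pair scaleR_Pair scaleR_zero_right)+

lemma linear_snd_slot: "linear f \<Longrightarrow> linear (\<lambda>a. f (0, a))"
  by (auto simp: linear_iff) (metis add.right_neutral add_Pair scaleR_Pair scaleR_zero_right)+

definition spray_vec :: "((real^'n) \<times> (real^'n) \<Rightarrow> real) \<Rightarrow> (real^'n) \<times> (real^'n) \<Rightarrow> real^'n" where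
  "spray_vec L z = (\<chi> i. spray_coeff L i z)"

lemma smooth_on_has_derivative_compose:
  assumes "smooth_on S f" "(h has_derivative h') (at t within T)" "h t \<in> S"
  shows "((\<lambda>s. f (h s)) has_derivative (\<lambda>s. fd f (h t) (h' s))) (at t within T)"
  using has_derivative_compose[OF assms(2) smooth_on_has_derivative[OF assms(1,3)]] .

lemma mult_matrix_inv:
  fixes A :: "real^'n^'n"
  assumes "invertible A"
  shows "A ** matrix_inv A = mat 1"
  using assms someI_ex[of "\<lambda>A'. A ** A' = mat 1 \<and> A' ** A = mat 1"]
  unfolding invertible_def matrix_inv_def by blast

text \<open>Passage from the coordinate formula to the locale. Positivity makes the metric matrix
  invertible, so the formula is equivalent to a linear system; linearity extends its rows from the
  coordinate vectors to all \<open>w\<close>; homogeneity of degree 2 yields Euler's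
  identity.\<close>

lemma spray_spray_vec:
  fixes L :: "(real^'n) \<times> (real^'n) \<Rightarrow> real"
  defines "S \<equiv> \<lambda>\<Omega> :: (real^'n) set. \<Omega> \<times> (UNIV - {0 :: real^'n})"
  assumes "open \<Omega>" and L: "smooth_on (S \<Omega>) L"
    and nondeg: "\<And>z w. z \<in> S \<Omega> \<Longrightarrow> w \<noteq> 0 \<Longrightarrow> fd (\<lambda>z. fd L z (0, w)) z (0, w) > 0"
    and hom: "\<And>x y a. x \<in> \<Omega> \<Longrightarrow> a > 0 \<Longrightarrow> L (x, a *\<^sub>R y) = a\<^sup>2 * L (x, y)"
  shows "spray \<Omega> L (spray_vec L)"
proof -
  let ?S = "S \<Omega>"
  have S: "open ?S"
    using \<open>open \<Omega>\<close> unfolding S_def by (intro open_Times) (auto intro: open_delete)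
  note L1 = smooth_on_fd_const[OF L S]
  note L2 = smooth_on_fd_const[OF L1 S]
  have comm: "fd (\<lambda>z. fd L z a) z b = fd (\<lambda>z. fd L z b) z a" if "z \<in> ?S" for z a b
    by (rule fd_fd_commute[OF L S that])
  have lin1: "linear (fd L z)" "linear (fd (\<lambda>z. fd L z a) z)" if "z \<in> ?S" for z a
    using linear_fd smooth_on_differentiable[OF L that] smooth_on_differentiable[OF L1 that] by blast+
  have lin2: "linear (\<lambda>w. fd (\<lambda>z. fd L z (0, w)) z b)" "linear (\<lambda>w. fd (\<lambda>z. fd L z (w, 0)) z b)" if "z \<in> ?S" for z b
    unfolding comm[OF that, of _ b] by (intro linear_fst_slot linear_snd_slot lin1(2) that)+
  have px: "pdx k L z = fd L z (axis k 1, 0)" and py: "pdy k L z = fd L z (0, axis k 1)" if "z \<in> ?S" for k z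
    using pdx_eq_fd[OF S that L] pdy_eq_fd[OF S that L] by auto
  have g: "metric_matrix L z $ i $ j = 1/2 * fd (\<lambda>z. fd L z (0, axis i 1)) z (0, axis j 1)" if "z \<in> ?S" for z i j
    using pdy_eq_fd[OF S that L1 py] by (simp add: metric_matrix_def)
  have pxy: "pdy l (pdx k L) z = fd (\<lambda>z. fd L z (0, axis l 1)) z (axis k 1, 0)" if "z \<in> ?S" for z k l
    using pdy_eq_fd[OF S that L1 px] comm[OF that] by simp
  have gv: "(metric_matrix L z *v a) $ i = 1/2 * fd (\<lambda>z. fd L z (0, axis i 1)) z (0, a)" if "z \<in> ?S" for z a i
    using linear_vec_sum[OF linear_snd_slot[OF lin1(2)[OF that]], of a]
    by (simp add: matrix_vector_mult_def g[OF that] mult.commute mult.left_commute flip: sum_divide_distrib)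
  have ginv: "invertible (metric_matrix L z)" if z: "z \<in> ?S" for z
    unfolding invertible_left_inverse matrix_left_invertible_ker
  proof (intro allI impI)
    fix a assume "metric_matrix L z *v a = 0"
    then have *: "fd (\<lambda>z. fd L z (0, axis i 1)) z (0, a) = 0" for i
      using gv[OF z, of a i] by simp
    have "fd (\<lambda>z. fd L z (0, a)) z (0, a) = 0"
      using linear_vec_sum[OF lin2(1)[OF z, of "(0, a)"], of a] by (simp add: *)
    then show "a = 0" using nondeg[OF z, of a] by fastforce
  qed
  define rhs where "rhs z = (\<chi> l. fd (\<lambda>z. fd L z (0, axis l 1)) z (snd z, 0) - fd L z (axis l 1, 0))" for z
  have rhs: "(\<Sum>k\<in>UNIV. pdy l (pdx k L) z * snd z $ k) - pdx l L z = rhs z $ l" if "z \<in> ?S" for z l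
    using linear_vec_sum[OF linear_fst_slot[OF lin1(2)[OF that]], of "snd z"]
    by (simp add: pxy[OF that] px[OF that] rhs_def mult.commute)
  have "spray_vec L z = (1/4) *\<^sub>R (matrix_inv (metric_matrix L z) *v rhs z)" if "z \<in> ?S" for z
    by (simp add: vec_eq_iff spray_vec_def spray_coeff_def rhs[OF that] matrix_vector_mult_def)
  then have sol: "metric_matrix L z *v spray_vec L z = (1/4) *\<^sub>R rhs z" if "z \<in> ?S" for z
    using that mult_matrix_inv[OF ginv[OF that]]
    by (simp add: matrix_vector_mult_scaleR matrix_vector_mul_assoc)
  show ?thesis
  proof
    show "open \<Omega>" by fact
    show "smooth_on (\<Omega> \<times> (UNIV - {0})) L" using L by (simp add: S_def)
    have "smooth_on ?S (spray_vec L)"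
    \<comment> \<open>Smoothness comes from the linear system that \<open>spray_vec L\<close>
      solves, so the inverse matrix itself is never differentiated.\<close>
    proof (rule smooth_on_linear_solution[OF _ _ S])
      show "smooth_on ?S (\<lambda>z. metric_matrix L z $ i $ j)" for i j
        by (rule smooth_on_cong[OF smooth_on_mult[OF smooth_on_const[of _ "1/2"] L2[of "(0, axis i 1)" "(0, axis j 1)"] S] S])
          (simp add: g)
      show "smooth_on ?S (\<lambda>z. (1/4) *\<^sub>R rhs z)"
        unfolding rhs_def
        by (intro smooth_on_scaleR smooth_on_const smooth_on_vec S)
          (simp, intro smooth_on_diff smooth_on_fd[OF L1] smooth_on_Pair smooth_on_snd smooth_on_ident smooth_on_const L1 S, auto)
      show "det (metric_matrix L z) \<noteq> 0" if "z \<in> ?S" for z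
        using ginv[OF that] by (simp add: invertible_det_nz)
    qed (use sol in auto)
    then show "smooth_on (\<Omega> \<times> (UNIV - {0})) (spray_vec L)" by (simp add: S_def)
    fix z :: "(real^'n) \<times> (real^'n)" and w :: "real^'n" assume z: "z \<in> \<Omega> \<times> (UNIV - {0})"
    then have z': "z \<in> ?S" by (simp add: S_def)
    show "0 < fd (\<lambda>z. fd L z (0, w)) z (0, w)" if "w \<noteq> 0"
      using nondeg[OF z' that] .
    have *: "2 * fd (\<lambda>z. fd L z (0, axis l 1)) z (0, spray_vec L z) =
       fd (\<lambda>z. fd L z (0, axis l 1)) z (snd z, 0) - fd L z (axis l 1, 0)" for l
      using sol[OF z'] gv[OF z', of "spray_vec L z" l] by (simp add: rhs_def)
    have "linear (\<lambda>w. 2 * fd (\<lambda>z. fd L z (0, w)) z (0, spray_vec L z))" (is "linear ?l")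
      using linear_compose_scale_right[OF lin2(1)[OF z'], of 2] by simp
    moreover have "linear (\<lambda>w. fd (\<lambda>z. fd L z (0, w)) z (snd z, 0) - fd L z (w, 0))" (is "linear ?r")
      by (intro linear_compose_sub lin2 z' linear_fst_slot lin1)
    ultimately have "?l w = ?r w"
      using linear_vec_sum[of ?l w] linear_vec_sum[of ?r w] * by simp
    then show "2 * fd (\<lambda>z. fd L z (0, w)) z (0, spray_vec L z) =
      fd (\<lambda>z. fd L z (0, w)) z (snd z, 0) - fd L z (w, 0)" .
    obtain x y where xy: "z = (x, y)" "x \<in> \<Omega>" "y \<noteq> 0" using z by auto
    \<comment> \<open>The vertical derivative of \<open>L\<close> is homogeneous of degree 1.
      Differentiating this in \<open>t\<close> at 1 gives Euler's identity.\<close>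
    have 1: "fd L (x, t *\<^sub>R y) (0, w) = t * fd L (x, y) (0, w)" if "t > 0" for t
    proof -
      have "(x, t *\<^sub>R y) \<in> ?S" using xy that by (simp add: S_def)
      moreover have "((\<lambda>s. (x, t *\<^sub>R (y + s *\<^sub>R w))) has_derivative (\<lambda>s. (0, t *\<^sub>R s *\<^sub>R w))) (at 0)"
        by (auto intro!: derivative_eq_intros)
      ultimately have "((\<lambda>s. L (x, t *\<^sub>R (y + s *\<^sub>R w))) has_derivative (\<lambda>s. fd L (x, t *\<^sub>R y) (0, t *\<^sub>R s *\<^sub>R w))) (at 0)"
        using smooth_on_has_derivative_compose[OF L, of "\<lambda>s. (x, t *\<^sub>R (y + s *\<^sub>R w))"] by fastforce
      moreover have "((\<lambda>s. (x, y + s *\<^sub>R w)) has_derivative (\<lambda>s. (0, s *\<^sub>R w))) (at 0)"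
        by (auto intro!: derivative_eq_intros)
      then have "((\<lambda>s. t\<^sup>2 * L (x, y + s *\<^sub>R w)) has_derivative (\<lambda>s. t\<^sup>2 * fd L (x, y) (0, s *\<^sub>R w))) (at 0)"
        using smooth_on_has_derivative_compose[OF L, of "\<lambda>s. (x, y + s *\<^sub>R w)"] z' xy
        by (intro has_derivative_mult_right) fastforce
      ultimately have "fd L (x, t *\<^sub>R y) (0, t *\<^sub>R 1 *\<^sub>R w) = t\<^sup>2 * fd L (x, y) (0, 1 *\<^sub>R w)"
        unfolding hom[OF xy(2) that] using has_derivative_unique by metis
      moreover have "fd L (x, t *\<^sub>R y) (0, t *\<^sub>R w) = t * fd L (x, t *\<^sub>R y) (0, w)"
        using linear_scale[OF lin1(1)[OF \<open>(x, t *\<^sub>R y) \<in> ?S\<close>], of t "(0, w)"] by simp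
      ultimately show ?thesis using that by (simp add: power2_eq_square)
    qed
    have "((\<lambda>t. (x, t *\<^sub>R y)) has_derivative (\<lambda>s. (0, s *\<^sub>R y))) (at 1)"
      by (auto intro!: derivative_eq_intros)
    then have "((\<lambda>t. fd L (x, t *\<^sub>R y) (0, w)) has_derivative (\<lambda>s. fd (\<lambda>z. fd L z (0, w)) (x, y) (0, s *\<^sub>R y))) (at 1)"
      using smooth_on_has_derivative_compose[OF L1, of "\<lambda>t. (x, t *\<^sub>R y)"] z' xy by fastforce
    moreover have "((\<lambda>t. fd L (x, t *\<^sub>R y) (0, w)) has_derivative (\<lambda>s. s * fd L (x, y) (0, w))) (at 1)"
    proof (rule has_derivative_transform_within_open[of "\<lambda>t. t * fd L (x, y) (0, w)" _ _ _ "{0<..}"])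
      show "((\<lambda>t. t * fd L (x, y) (0, w)) has_derivative (\<lambda>s. s * fd L (x, y) (0, w))) (at 1)"
        by (auto intro!: derivative_eq_intros)
    qed (use 1 in auto)
    ultimately have "fd (\<lambda>z. fd L z (0, w)) (x, y) (0, 1 *\<^sub>R y) = 1 * fd L (x, y) (0, w)"
      using has_derivative_unique by metis
    then show "fd (\<lambda>z. fd L z (0, w)) z (0, snd z) = fd L z (0, w)"
      using xy by simp
  qed
qed

text \<open>Index sums are linear maps evaluated by \<open>linear_vec_sum\<close>. The mixed partial
  derivatives are reordered so that the sums over \<open>j\<close> act on the outer slot, whose
  linearity is immediate.\<close>

lemma riemann_coeff_eq_curv:
  fixes L :: "(real^'n) \<times> (real^'n) \<Rightarrow> real"
  assumes "spray \<Omega> L (spray_vec L)" and z: "z \<in> \<Omega> \<times> (UNIV - {0})"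
  shows "(\<Sum>k\<in>UNIV. riemann_coeff L i k z * v $ k) = spray.curv (spray_vec L) z v $ i"
proof -
  interpret spray \<Omega> L "spray_vec L" by fact
  let ?G = "spray_vec L"
  have c: "spray_coeff L i z = ?G z $ i" for i z by (simp add: spray_vec_def)
  have dG: "?G differentiable (at z)" "(\<lambda>z. fd ?G z a) differentiable (at z)" if "z \<in> S" for z a
    using that smooth_on_differentiable smooth_Sp smooth_Sp1 by blast+
  have s: "smooth_on S (\<lambda>z. ?G z $ i)" "smooth_on S (\<lambda>z. fd ?G z a $ i)" for i a
    by (intro smooth_on_vec_nth smooth_Sp smooth_Sp1 open_S)+
  have px: "pdx k (spray_coeff L i) z = fd ?G z (axis k 1, 0) $ i"
    and py: "pdy k (spray_coeff L i) z = fd ?G z (0, axis k 1) $ i" if "z \<in> S" for k i z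
    using pdx_eq_fd[OF open_S that s(1) c] pdy_eq_fd[OF open_S that s(1) c] fd_vec_nth[OF dG(1)[OF that]] by auto
  have pxy: "pdy k (pdx j (spray_coeff L i)) z = fd (\<lambda>z. fd ?G z (0, axis k 1)) z (axis j 1, 0) $ i"
    and pyy: "pdy k (pdy j (spray_coeff L i)) z = fd (\<lambda>z. fd ?G z (0, axis k 1)) z (0, axis j 1) $ i" for k j i
    using pdy_eq_fd[OF open_S z s(2) px] pdy_eq_fd[OF open_S z s(2) py] fd_vec_nth[OF dG(2)[OF z]]
      fd_fd_commute[OF smooth_Sp open_S z] by auto
  have lin: "linear (fd ?G z)" "linear (fd (\<lambda>z. fd ?G z a) z)" for a
    using dG[OF z] linear_fd by blast+
  have lin2: "linear (\<lambda>w. fd (\<lambda>z. fd ?G z (0, w)) z b)" for b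
    unfolding fd_fd_commute[OF smooth_Sp open_S z, of _ b] by (intro linear_snd_slot lin)
  have ex: "(\<Sum>k\<in>UNIV. v $ k * f (axis k 1) $ i) = f v $ i" if "linear f" for f :: "real^'n \<Rightarrow> real^'n" and v i
    using arg_cong[OF linear_vec_sum[OF that, of v], of "\<lambda>x. x $ i"] by simp
  have nth: "linear (\<lambda>w. f w $ i)" if "linear f" for f :: "real^'n \<Rightarrow> real^'n" and i
    using linear_compose[OF that, of "\<lambda>x. x $ i"] by (simp add: o_def linear_iff)
  have r: "riemann_coeff L i k z = (2 *\<^sub>R fd ?G z (axis k 1, 0) - fd (\<lambda>z. fd ?G z (0, axis k 1)) z (snd z, 0)
     + 2 *\<^sub>R fd (\<lambda>z. fd ?G z (0, axis k 1)) z (0, ?G z) - fd ?G z (0, fd ?G z (0, axis k 1))) $ i" for k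
    using ex[OF linear_fst_slot[OF lin(2)[of "(0, axis k 1)"]], of "snd z" i] ex[OF linear_snd_slot[OF lin(2)[of "(0, axis k 1)"]], of "?G z" i]
      ex[OF linear_snd_slot[OF lin(1)], of "fd ?G z (0, axis k 1)" i]
    by (simp add: riemann_coeff_def px[OF z] py[OF z] pxy pyy mult.commute c)
  have "linear (\<lambda>v. curv z v)"
    unfolding curv_def
    by (intro linear_compose_sub linear_compose_add linear_compose_scale_right lin2 linear_fst_slot[OF lin(1)]
      linear_compose[OF linear_snd_slot[OF lin(1)] linear_snd_slot[OF lin(1)], unfolded o_def])
  from ex[OF this, of v i] show ?thesis
    by (simp add: r curv_def mult.commute)
qed


section \<open>Integral curves and one-parameter groups\<close>

lemma smooth_on_lipschitz_cball:
  fixes f :: "'a::euclidean_space \<Rightarrow> 'b::real_normed_vector"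
  assumes f: "smooth_on T f" and "open T" "cball x0 r \<subseteq> T"
  obtains B where "B \<ge> 0" "\<And>x y. x \<in> cball x0 r \<Longrightarrow> y \<in> cball x0 r \<Longrightarrow> norm (f x - f y) \<le> B * norm (x - y)"
proof -
  have "continuous_on (cball x0 r) (\<lambda>x. \<Sum>b\<in>Basis. norm (fd f x b))"
    using continuous_on_subset[OF smooth_on_continuous_on[OF smooth_on_fd_const[OF f \<open>open T\<close>]] assms(3)]
    by (intro continuous_on_sum continuous_on_norm)
  then have "bounded ((\<lambda>x. \<Sum>b\<in>Basis. norm (fd f x b)) ` cball x0 r)"
    by (intro compact_imp_bounded compact_continuous_image) auto
  then obtain B where B: "B > 0" "\<And>x. x \<in> cball x0 r \<Longrightarrow> norm (\<Sum>b\<in>Basis. norm (fd f x b)) \<le> B"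
    unfolding bounded_pos by auto
  have "norm (f x - f y) \<le> B * norm (x - y)" if "x \<in> cball x0 r" "y \<in> cball x0 r" for x y
  proof (rule differentiable_bound[OF convex_cball _ _ that])
    fix z assume z: "z \<in> cball x0 r"
    then have "z \<in> T" using assms(3) by auto
    from smooth_on_has_derivative[OF f this]
    show "(f has_derivative fd f z) (at z within cball x0 r)"
      by (rule has_derivative_at_withinI)
    from \<open>z \<in> T\<close> f have "bounded_linear (fd f z)"
      using smooth_on_has_derivative has_derivative_bounded_linear by blast
    from onorm_componentwise[OF this] B(2)[OF z]
    show "onorm (fd f z) \<le> B" by simp
  qed
  with B(1) show ?thesis using that[of B] by simp
qed

text \<open>The integral from 0 to \<open>t\<close> for either sign of \<open>t\<close>; an integral
  over \<open>{0..t}\<close> would be 0 for negative \<open>t\<close>.\<close>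

definition centred_integral :: "real \<Rightarrow> (real \<Rightarrow> 'a::euclidean_space) \<Rightarrow> real \<Rightarrow> 'a" where
  "centred_integral e g t = integral {-e..t} g - integral {-e..0} g"

lemma centred_integral_has_vector_derivative:
  assumes "continuous_on UNIV g" "t \<in> {-e..e}"
  shows "(centred_integral e g has_vector_derivative g t) (at t within {-e..e})"
proof -
  have "((\<lambda>t. integral {-e..t} g) has_vector_derivative g t) (at t within {-e..e})"
    using assms by (intro integral_has_vector_derivative) (auto intro: continuous_on_subset)
  from has_vector_derivative_diff[OF this has_vector_derivative_const] show ?thesis
    by (simp add: centred_integral_def[abs_def])
qed

lemma centred_integral_bound:
  assumes g: "continuous_on UNIV g" and "t \<in> {-e..e}" and B: "\<And>s. norm (g s) \<le> B"
  shows "norm (centred_integral e g t) \<le> B * e"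
proof -
  have t0: "0 \<in> {-e..e}" using assms(2) by auto
  have "norm (centred_integral e g t - centred_integral e g 0) \<le> B * norm (t - 0)"
  proof (rule differentiable_bound[OF _ _ _ assms(2) t0])
    show "(centred_integral e g has_derivative (\<lambda>h. h *\<^sub>R g s)) (at s within {-e..e})" if "s \<in> {-e..e}" for s
      using centred_integral_has_vector_derivative[OF g that] by (simp add: has_vector_derivative_def)
    show "onorm (\<lambda>h. h *\<^sub>R g s) \<le> B" for s
      by (rule onorm_le) (metis B abs_ge_zero mult.commute mult_left_mono norm_scaleR real_norm_def)
  qed auto
  also have "\<dots> \<le> B * e"
    using assms(2) order_trans[OF norm_ge_zero B] by (intro mult_left_mono) auto
  finally show ?thesis by (simp add: centred_integral_def)
qed

lemma centred_integral_diff: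
  assumes "continuous_on UNIV g" "continuous_on UNIV h"
  shows "centred_integral e g t - centred_integral e h t = centred_integral e (\<lambda>s. g s - h s) t"
proof -
  have "g integrable_on {a..b}" "h integrable_on {a..b}" for a b
    using assms by (auto intro: integrable_continuous_real continuous_on_subset)
  then show ?thesis by (simp add: centred_integral_def integral_diff)
qed

text \<open>Picard iteration as a contraction of the bounded continuous functions on the whole line.
  To make it defined there, the field is composed with the closest-point map onto a ball, which
  renders it bounded and globally Lipschitz, and time is clamped to \<open>[-e, e]\<close>. The
  fixed point stays in the ball, where the modified field is the original one.\<close>

lemma picard_local:
  fixes f :: "'a::euclidean_space \<Rightarrow> 'a"
  assumes f: "smooth_on T f" and "open T" "x0 \<in> T"
  obtains e x where "e > 0" "x 0 = x0"
    "\<And>t. \<bar>t\<bar> < e \<Longrightarrow> x t \<in> T \<and> (x has_vector_derivative f (x t)) (at t)"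
proof -
  obtain r where r: "r > 0" "cball x0 r \<subseteq> T"
    using \<open>open T\<close> \<open>x0 \<in> T\<close> open_contains_cball by blast
  obtain B where B: "B \<ge> 0" "\<And>x y. x \<in> cball x0 r \<Longrightarrow> y \<in> cball x0 r \<Longrightarrow> norm (f x - f y) \<le> B * norm (x - y)"
    by (rule smooth_on_lipschitz_cball[OF f \<open>open T\<close> r(2)]) blast
  define p where "p = closest_point (cball x0 r)"
  have p: "p z \<in> cball x0 r" for z
    unfolding p_def by (rule closest_point_in_set) (use r in auto)
  have p_id: "p z = z" if "z \<in> cball x0 r" for z
    using that unfolding p_def by (simp add: closest_point_self)
  have p_lip: "norm (p y - p z) \<le> norm (y - z)" for y z
    unfolding p_def dist_norm[symmetric] by (rule closest_point_lipschitz) (use r in auto)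
  define F where "F z = f (p z)" for z
  have F_lip: "norm (F y - F z) \<le> B * norm (y - z)" for y z
    using B(2)[OF p p, of y z] mult_left_mono[OF p_lip B(1), of y z] unfolding F_def by linarith
  then have "continuous_on UNIV F"
    by (intro lipschitz_on_continuous_on[of B] lipschitz_onI) (simp_all add: dist_norm B)
  then have F_cont: "continuous_on UNIV (\<lambda>s. F (g s))" if "continuous_on UNIV g" for g :: "real \<Rightarrow> 'a"
    using that continuous_on_compose2 by blast
  \<comment> \<open>A bound for the modified field; the summand 1 makes it positive, so that it can
    be divided by.\<close>
  define K where "K = norm (f x0) + B * r + 1"
  have F_bound: "norm (F z) \<le> K" for z
  proof -
    have "norm (f (p z) - f x0) \<le> B * norm (p z - x0)"
      by (rule B(2)[OF p]) (use r in auto)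
    also have "\<dots> \<le> B * r" using p[of z] B(1) by (intro mult_left_mono) (auto simp: dist_norm norm_minus_commute)
    finally show ?thesis
      unfolding K_def F_def using norm_triangle_ineq2[of "f (p z)" "f x0"] by linarith
  qed
  have "K > 0" using B(1) r(1) by (auto simp: K_def intro!: add_nonneg_pos)
  \<comment> \<open>The first bound gives contraction factor 1/2, the second keeps the iterates
    within distance \<open>r\<close> of \<open>x0\<close>.\<close>
  define e where "e = min (1 / (2 * (B + 1))) (r / K)"
  have e: "e > 0" "e * B \<le> 1/2" "K * e \<le> r"
    using B(1) r(1) \<open>K > 0\<close> by (auto simp: e_def field_simps min_def)
  define c where "c t = max (-e) (min e t)" for t
  have c: "c t \<in> {-e..e}" for t using e by (auto simp: c_def)
  have c_cont: "continuous_on UNIV c" unfolding c_def by (intro continuous_intros)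
  have I_cont: "continuous_on UNIV (\<lambda>t. centred_integral e g (c t))" if "continuous_on UNIV g" for g :: "real \<Rightarrow> 'a"
  proof (rule continuous_on_compose2[OF _ c_cont])
    show "continuous_on {-e..e} (centred_integral e g)"
      using centred_integral_has_vector_derivative[OF that]
      by (meson continuous_on_eq_continuous_within has_vector_derivative_continuous)
  qed (use c in auto)
  define P :: "(real \<Rightarrow>\<^sub>C 'a) \<Rightarrow> (real \<Rightarrow>\<^sub>C 'a)" where
    "P \<phi> = Bcontfun (\<lambda>t. x0 + centred_integral e (\<lambda>s. F (apply_bcontfun \<phi> s)) (c t))" for \<phi>
  have P: "apply_bcontfun (P \<phi>) t = x0 + centred_integral e (\<lambda>s. F (apply_bcontfun \<phi> s)) (c t)" for \<phi> t
  proof -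
    have "(\<lambda>t. x0 + centred_integral e (\<lambda>s. F (apply_bcontfun \<phi> s)) (c t)) \<in> bcontfun"
    proof (rule bcontfun_normI)
      show "continuous_on UNIV (\<lambda>t. x0 + centred_integral e (\<lambda>s. F (apply_bcontfun \<phi> s)) (c t))"
        by (intro continuous_on_add continuous_on_const I_cont F_cont) auto
      show "norm (x0 + centred_integral e (\<lambda>s. F (apply_bcontfun \<phi> s)) (c t)) \<le> norm x0 + K * e" for t
        by (intro norm_triangle_mono order_refl centred_integral_bound c F_bound F_cont) auto
    qed
    then show ?thesis by (simp add: P_def Bcontfun_inverse)
  qed
  have "dist (P \<phi>) (P \<psi>) \<le> 1/2 * dist \<phi> \<psi>" for \<phi> \<psi>
  proof (rule dist_bound)
    fix t
    have "dist (apply_bcontfun (P \<phi>) t) (apply_bcontfun (P \<psi>) t) =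
      norm (centred_integral e (\<lambda>s. F (apply_bcontfun \<phi> s) - F (apply_bcontfun \<psi> s)) (c t))"
      by (simp add: P dist_norm centred_integral_diff F_cont)
    also have "\<dots> \<le> B * dist \<phi> \<psi> * e"
    proof (rule centred_integral_bound[OF _ c])
      show "norm (F (apply_bcontfun \<phi> s) - F (apply_bcontfun \<psi> s)) \<le> B * dist \<phi> \<psi>" for s
        using F_lip[of "apply_bcontfun \<phi> s" "apply_bcontfun \<psi> s"] mult_left_mono[OF dist_bounded[of \<phi> s \<psi>] B(1)]
        by (simp add: dist_norm)
    qed (intro continuous_on_diff F_cont; auto)
    also have "\<dots> \<le> 1/2 * dist \<phi> \<psi>"
      using mult_right_mono[OF e(2), of "dist \<phi> \<psi>"] by (simp add: ac_simps)
    finally show "dist (apply_bcontfun (P \<phi>) t) (apply_bcontfun (P \<psi>) t) \<le> 1/2 * dist \<phi> \<psi>" .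
  qed
  then obtain \<phi> where \<phi>: "P \<phi> = \<phi>"
    using banach_fix_type[of "1/2" P] by auto
  define x where "x = apply_bcontfun \<phi>"
  have x: "x t = x0 + centred_integral e (\<lambda>s. F (x s)) (c t)" for t
    unfolding x_def using P[of \<phi> t] \<phi> by simp
  have x_cont: "continuous_on UNIV (\<lambda>s. F (x s))"
    by (intro F_cont) (simp add: x_def)
  have xb: "x t \<in> cball x0 r" for t
  proof -
    have "norm (centred_integral e (\<lambda>s. F (x s)) (c t)) \<le> K * e"
      by (rule centred_integral_bound[OF x_cont c F_bound])
    then show ?thesis using e(3) by (simp add: x[of t] dist_norm)
  qed
  show ?thesis
  proof (rule that[OF e(1), of x])
    show "x 0 = x0" using e by (simp add: x[of 0] c_def centred_integral_def)
    fix t :: real assume t: "\<bar>t\<bar> < e"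
    then have "(centred_integral e (\<lambda>s. F (x s)) has_vector_derivative F (x t)) (at t within {-e..e})"
      by (intro centred_integral_has_vector_derivative x_cont) auto
    moreover have "t \<in> interior {-e..e}" using t by auto
    ultimately have "(centred_integral e (\<lambda>s. F (x s)) has_vector_derivative F (x t)) (at t)"
      by (simp only: at_within_interior)
    then have "((\<lambda>t. x0 + centred_integral e (\<lambda>s. F (x s)) t) has_vector_derivative F (x t)) (at t)"
      by (auto intro!: derivative_eq_intros)
    then have "(x has_vector_derivative F (x t)) (at t)"
    proof (rule has_vector_derivative_transform_within_open[of _ _ _ "{-e<..<e}"])
      show "x0 + centred_integral e (\<lambda>s. F (x s)) s = x s" if "s \<in> {-e<..<e}" for s
        using that by (subst x) (simp add: c_def)
    qed (use t in auto)
    then show "x t \<in> T \<and> (x has_vector_derivative f (x t)) (at t)"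
      using xb[of t] r(2) p_id by (auto simp: F_def)
  qed
qed

text \<open>Bootstrapping: the derivative of \<open>x\<close> is \<open>f\<close> composed with
  \<open>x\<close>, hence as regular as \<open>x\<close> itself.\<close>

lemma smooth_on_integral_curve:
  fixes f :: "'a::euclidean_space \<Rightarrow> 'a" and x :: "real \<Rightarrow> 'a"
  assumes f: "smooth_on T f" and "open J"
    and x: "\<And>t. t \<in> J \<Longrightarrow> x t \<in> T \<and> (x has_vector_derivative f (x t)) (at t)"
  shows "smooth_on J x"
proof -
  have d: "(x has_derivative (\<lambda>h. h *\<^sub>R f (x t))) (at t)" if "t \<in> J" for t
    using x[OF that] by (simp add: has_vector_derivative_def)
  have "Ck_on k J x" for k
  proof (induction k)
    case 0
    show ?case
      using d by (auto simp: intro!: continuous_at_imp_continuous_on has_derivative_continuous)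
  next
    case (Suc k)
    have 1: "Ck_on k J (\<lambda>t. f (x t))"
      by (rule Ck_on_compose[OF \<open>open J\<close> _ Suc]) (use x f in \<open>auto simp: smooth_on_def\<close>)
    have "Ck_on k J (\<lambda>t. fd x t 1)"
      by (rule Ck_on_cong[OF \<open>open J\<close> _ 1]) (simp add: fd_eqI[OF d])
    then show ?case using d by (auto simp: differentiable_def)
  qed
  then show ?thesis by (simp add: smooth_on_def)
qed

text \<open>The extension is the \<open>n\<close>-th power of \<open>g0 (t / n)\<close> for any
  \<open>n\<close> large enough to bring \<open>t / n\<close> into the domain of
  \<open>g0\<close>.\<close>

lemma (in group) local_hom_extend:
  fixes g0 :: "real \<Rightarrow> 'a"
  assumes "e > 0" and car: "\<And>t. \<bar>t\<bar> < e \<Longrightarrow> g0 t \<in> carrier G"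
    and hom: "\<And>s t. \<bar>s\<bar> < e \<Longrightarrow> \<bar>t\<bar> < e \<Longrightarrow> \<bar>s + t\<bar> < e \<Longrightarrow> g0 (s + t) = g0 s \<otimes> g0 t"
  obtains g where "\<And>t. g t \<in> carrier G" "\<And>s t. g (s + t) = g s \<otimes> g t" "\<And>t. \<bar>t\<bar> < e \<Longrightarrow> g t = g0 t"
proof -
  have pow: "g0 (real k * s) = g0 s [^] k" if "real k * \<bar>s\<bar> < e" "k > 0" for k s
    using that
  proof (induction k)
    case (Suc k)
    show ?case
    proof (cases "k = 0")
      case True
      then show ?thesis using Suc.prems car[of s] by simp
    next
      case False
      have "real k * \<bar>s\<bar> \<le> real (Suc k) * \<bar>s\<bar>" "1 * \<bar>s\<bar> \<le> real (Suc k) * \<bar>s\<bar>"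
        by (intro mult_right_mono; simp)+
      then have b: "real k * \<bar>s\<bar> < e" "\<bar>s\<bar> < e" using Suc.prems by auto
      have "g0 (real k * s + s) = g0 (real k * s) \<otimes> g0 s"
      proof (rule hom)
        have "real k * s + s = real (Suc k) * s" by (simp add: algebra_simps)
        then show "\<bar>real k * s + s\<bar> < e" using Suc.prems(1) by (simp only: abs_mult abs_of_nat)
      qed (use b in \<open>simp_all add: abs_mult\<close>)
      then show ?thesis using Suc.IH b False by (simp add: algebra_simps)
    qed
  qed auto
  \<comment> \<open>The successor makes the quotient strictly smaller than \<open>e\<close> and
    keeps \<open>N t\<close> positive at \<open>t = 0\<close>.\<close>
  define N where "N t = Suc (nat \<lceil>\<bar>t\<bar> / e\<rceil>)" for t
  have N: "\<bar>t\<bar> / real (N t) < e" for t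
  proof -
    have "\<bar>t\<bar> / e < real (N t)" unfolding N_def by linarith
    moreover have "real (N t) > 0" by (simp add: N_def)
    ultimately show ?thesis
      using \<open>e > 0\<close> by (simp only: pos_divide_less_eq mult.commute)
  qed
  define g where "g t = g0 (t / real (N t)) [^] N t" for t
  \<comment> \<open>Two admissible subdivisions \<open>k\<close> and \<open>l\<close> are compared
    with their common refinement \<open>k * l\<close>.\<close>
  have eq: "g0 (t / real k) [^] k = g0 (t / real l) [^] l"
    if "\<bar>t\<bar> / real k < e" "\<bar>t\<bar> / real l < e" "k > 0" "l > 0" for t k l
  proof -
    have "g0 (t / real k) [^] k = g0 (t / real (k * l)) [^] (k * l)"
      if "\<bar>t\<bar> / real k < e" "k > 0" "l > 0" for k l
    proof -
      have "t / real k = real l * (t / real (k * l))" "real l * \<bar>t / real (k * l)\<bar> = \<bar>t\<bar> / real k"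
        using that by (auto simp: field_simps abs_mult)
      moreover have "\<bar>t / real (k * l)\<bar> < e"
      proof -
        have "\<bar>t\<bar> / real (k * l) \<le> \<bar>t\<bar> / real k"
          using that by (intro divide_left_mono) auto
        then show ?thesis using that by simp
      qed
      ultimately show ?thesis
        using pow[of l "t / real (k * l)"] that car[of "t / real (k * l)"] by (simp add: nat_pow_pow mult.commute)
    qed
    from this[of k l] this[of l k] show ?thesis using that by (simp add: mult.commute)
  qed
  have gN: "g t = g0 (t / real k) [^] k" if "\<bar>t\<bar> / real k < e" "k > 0" for t k
    unfolding g_def by (rule eq) (use that N in \<open>auto simp: N_def\<close>)
  show ?thesis
  proof (rule that)
    show "g t \<in> carrier G" for t
      unfolding g_def using car N[of t] by simp
    show "g t = g0 t" if "\<bar>t\<bar> < e" for t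
      using gN[of t 1] that car[of t] by simp
    show "g (s + t) = g s \<otimes> g t" for s t
    proof -
      let ?k = "N (\<bar>s\<bar> + \<bar>t\<bar>)"
      have k: "?k > 0" by (simp add: N_def)
      have b: "(\<bar>s\<bar> + \<bar>t\<bar>) / real ?k < e" using N[of "\<bar>s\<bar> + \<bar>t\<bar>"] by simp
      have "\<bar>s\<bar> / real ?k \<le> (\<bar>s\<bar> + \<bar>t\<bar>) / real ?k" "\<bar>t\<bar> / real ?k \<le> (\<bar>s\<bar> + \<bar>t\<bar>) / real ?k"
        "\<bar>s + t\<bar> / real ?k \<le> (\<bar>s\<bar> + \<bar>t\<bar>) / real ?k"
        using k by (auto intro: divide_right_mono)
      then have bs: "\<bar>s\<bar> / real ?k < e" "\<bar>t\<bar> / real ?k < e" "\<bar>s + t\<bar> / real ?k < e" using b by auto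
      let ?s = "s / real ?k" and ?t = "t / real ?k"
      \<comment> \<open>Both orders of the sum are recorded: they show that the two factors commute,
        so that the power of the product splits.\<close>
      have st: "g0 (?s + ?t) = g0 ?s \<otimes> g0 ?t" "g0 (?t + ?s) = g0 ?t \<otimes> g0 ?s"
        by (rule hom; use bs in \<open>simp add: add.commute flip: add_divide_distrib\<close>)+
      have "g (s + t) = g0 (?s + ?t) [^] ?k"
        using gN[OF bs(3) k] by (simp add: add_divide_distrib)
      also have "\<dots> = g0 ?s [^] ?k \<otimes> g0 ?t [^] ?k"
        unfolding st(1) using car bs st by (intro pow_mult_distrib) (auto simp: add.commute)
      also have "\<dots> = g s \<otimes> g t"
        using gN bs k by simp
      finally show ?thesis .
    qed
  qed
qed

text \<open>Every \<open>g t\<close> is a power of a value of \<open>g\<close> at a small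
  argument.\<close>

lemma (in group) real_hom_in_subgroup:
  fixes g :: "real \<Rightarrow> 'a"
  assumes hom: "\<And>s t. g (s + t) = g s \<otimes> g t" and H: "subgroup H G"
    and "e > 0" and small: "\<And>s. \<bar>s\<bar> < e \<Longrightarrow> g s \<in> H"
  shows "g t \<in> H"
proof -
  define n where "n = Suc (nat \<lceil>\<bar>t\<bar> / e\<rceil>)"
  have "\<bar>t\<bar> / e < real n" unfolding n_def by linarith
  moreover have "real n > 0" by (simp add: n_def)
  ultimately have s: "\<bar>t / real n\<bar> < e"
    using \<open>e > 0\<close> by (simp only: abs_divide abs_of_nat pos_divide_less_eq mult.commute)
  have "g (real k * (t / real n)) \<in> H" for k
  proof (induction k)
    case 0
    show ?case using small[of 0] \<open>e > 0\<close> by simp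
  next
    case (Suc k)
    have "real (Suc k) * (t / real n) = real k * (t / real n) + t / real n" by (simp add: algebra_simps add_divide_distrib)
    then show ?case using Suc small[OF s] H by (simp add: hom subgroup.m_closed)
  qed
  from this[of n] show ?thesis by (simp add: n_def)
qed


section \<open>Smooth maps and their differentials\<close>

lemma charts_at_iff: "c \<in> charts_at M p \<longleftrightarrow> c \<in> atlas M \<and> p \<in> fst c"
  by (simp add: charts_at_def)

context
  fixes M :: "('a, 'e::euclidean_space) manifold"
  assumes M: "smooth_manifold M"
begin

lemma chart_openin: "c \<in> atlas M \<Longrightarrow> openin (mtop M) (fst c)"
  and chart_open_image: "c \<in> atlas M \<Longrightarrow> open (snd c ` fst c)"
  and chart_homeomorphic:
    "c \<in> atlas M \<Longrightarrow> homeomorphic_map (subtopology (mtop M) (fst c)) (top_of_set (snd c ` fst c)) (snd c)"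
  and chart_smooth_transition:
    "c \<in> atlas M \<Longrightarrow> d \<in> atlas M \<Longrightarrow> smooth_on (snd c ` (fst c \<inter> fst d)) (\<lambda>x. snd d (chart_inv c x))"
  using M unfolding smooth_manifold_def o_def by blast+

lemma chart_inj:
  assumes "c \<in> atlas M" shows "inj_on (snd c) (fst c)"
proof -
  have "fst c \<subseteq> topspace (mtop M)" using chart_openin[OF assms] by (rule openin_subset)
  then show ?thesis
    using homeomorphic_imp_injective_map[OF chart_homeomorphic[OF assms]] by (simp add: Int_absorb1)
qed

lemma chart_inv_chart: "c \<in> atlas M \<Longrightarrow> p \<in> fst c \<Longrightarrow> chart_inv c (snd c p) = p"
  using chart_inj by simp

lemma chart_image_open:
  assumes "c \<in> atlas M" "openin (mtop M) W"
  shows "open (snd c ` (fst c \<inter> W))"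
proof -
  have "openin (subtopology (mtop M) (fst c)) (fst c \<inter> W)"
    using assms(2) by (simp add: openin_subtopology_Int2)
  then have "openin (top_of_set (snd c ` fst c)) (snd c ` (fst c \<inter> W))"
    using homeomorphic_imp_open_map[OF chart_homeomorphic[OF assms(1)]] by (simp add: open_map_def)
  then show ?thesis
    using chart_open_image[OF assms(1)] openin_open_trans by blast
qed

lemma chart_preimage_openin:
  assumes "c \<in> atlas M" "open T"
  shows "openin (mtop M) {p \<in> fst c. snd c p \<in> T}"
proof -
  have "continuous_map (subtopology (mtop M) (fst c)) (top_of_set (snd c ` fst c)) (snd c)"
    using chart_homeomorphic[OF assms(1)] by (rule homeomorphic_imp_continuous_map)
  then have "continuous_map (subtopology (mtop M) (fst c)) euclidean (snd c)"
    by (rule continuous_map_into_fulltopology)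
  then have "openin (subtopology (mtop M) (fst c)) {p \<in> topspace (subtopology (mtop M) (fst c)). snd c p \<in> T}"
    using assms(2) by (intro openin_continuous_map_preimage) auto
  moreover have "fst c \<subseteq> topspace (mtop M)" using chart_openin[OF assms(1)] by (rule openin_subset)
  ultimately have "openin (subtopology (mtop M) (fst c)) {p \<in> fst c. snd c p \<in> T}"
    by (simp add: Int_absorb1)
  then show ?thesis using chart_openin[OF assms(1)] openin_trans_full by blast
qed

lemma charts_at_nonempty: "p \<in> topspace (mtop M) \<Longrightarrow> \<exists>c. c \<in> charts_at M p"
  using M unfolding smooth_manifold_def charts_at_def by blast

lemma transition_open: "c \<in> atlas M \<Longrightarrow> d \<in> atlas M \<Longrightarrow> open (snd c ` (fst c \<inter> fst d))"
  using chart_image_open chart_openin by blast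

lemma transition_differentiable:
  "c \<in> charts_at M p \<Longrightarrow> d \<in> charts_at M p \<Longrightarrow> (\<lambda>x. snd d (chart_inv c x)) differentiable (at (snd c p))"
  using smooth_on_differentiable[OF chart_smooth_transition] by (auto simp: charts_at_iff)

lemma transition_compose:
  assumes "c \<in> charts_at M p" "d \<in> charts_at M p" "e \<in> charts_at M p"
  shows "fd (snd e \<circ> chart_inv c) (snd c p) y = fd (snd e \<circ> chart_inv d) (snd d p) (fd (snd d \<circ> chart_inv c) (snd c p) y)"
proof -
  note ch = assms[unfolded charts_at_iff]
  have 1: "fd (snd e \<circ> chart_inv c) (snd c p) = fd (\<lambda>x. (snd e \<circ> chart_inv d) ((snd d \<circ> chart_inv c) x)) (snd c p)"
  proof (rule fd_cong[OF transition_open[of c d]])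
    show "(snd e \<circ> chart_inv c) x = (snd e \<circ> chart_inv d) ((snd d \<circ> chart_inv c) x)"
      if "x \<in> snd c ` (fst c \<inter> fst d)" for x
      using that ch by (auto simp: chart_inv_chart)
  qed (use ch in auto)
  show ?thesis
    unfolding 1 using ch transition_differentiable[OF assms(1,2)] transition_differentiable[OF assms(2,3)]
    by (subst fd_compose) (auto simp: o_def chart_inv_chart)
qed

lemma transition_self:
  assumes "c \<in> charts_at M p"
  shows "fd (snd c \<circ> chart_inv c) (snd c p) y = y"
proof -
  note ch = assms[unfolded charts_at_iff]
  have "fd (snd c \<circ> chart_inv c) (snd c p) = fd (\<lambda>x. x) (snd c p)"
    by (rule fd_cong[OF chart_open_image[of c]]) (use ch in \<open>auto simp: chart_inv_chart\<close>)
  then show ?thesis by (simp add: fd_eqI[OF has_derivative_ident])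
qed

lemma tangent_spaceD:
  "v \<in> tangent_space M p \<Longrightarrow> c \<in> charts_at M p \<Longrightarrow> d \<in> charts_at M p \<Longrightarrow>
    v d = fd (snd d \<circ> chart_inv c) (snd c p) (v c)"
  "v \<in> tangent_space M p \<Longrightarrow> c \<notin> charts_at M p \<Longrightarrow> v c = 0"
  unfolding tangent_space_def by blast+

lemma tangent_space_eqI:
  assumes "v \<in> tangent_space M p" "w \<in> tangent_space M p" "c \<in> charts_at M p" "v c = w c"
  shows "v = w"
proof
  fix d
  show "v d = w d"
    using tangent_spaceD[OF assms(1)] tangent_spaceD[OF assms(2)] assms(3,4) by metis
qed

lemma tvec_of_tangent_space: "c \<in> charts_at M p \<Longrightarrow> tvec_of M p c y \<in> tangent_space M p"
  unfolding tangent_space_def tvec_of_def by (auto intro: transition_compose)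

lemma tvec_of_apply: "c \<in> charts_at M p \<Longrightarrow> tvec_of M p c y c = y"
  unfolding tvec_of_def using transition_self by auto

lemma tvec_of_component: "v \<in> tangent_space M p \<Longrightarrow> c \<in> charts_at M p \<Longrightarrow> tvec_of M p c (v c) = v"
  by (rule tangent_space_eqI) (auto simp: tvec_of_tangent_space tvec_of_apply)

lemma subspace_tangent_space:
  assumes "p \<in> topspace (mtop M)" shows "subspace (tangent_space M p)"
proof -
  have lin: "linear (fd (snd d \<circ> chart_inv c) (snd c p))" if "c \<in> charts_at M p" "d \<in> charts_at M p" for c d
    using transition_differentiable[OF that] by (simp add: linear_fd o_def)
  show ?thesis
  proof (rule subspaceI)
    show "0 \<in> tangent_space M p"
      by (simp add: tangent_space_def linear_0[OF lin])
    fix v w assume v: "v \<in> tangent_space M p" and w: "w \<in> tangent_space M p"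
    have "(v + w) d = fd (snd d \<circ> chart_inv c) (snd c p) ((v + w) c)"
      if "c \<in> charts_at M p" "d \<in> charts_at M p" for c d
      using tangent_spaceD(1)[OF v that] tangent_spaceD(1)[OF w that] by (simp add: linear_add[OF lin[OF that]])
    moreover have "(v + w) c = 0" if "c \<notin> charts_at M p" for c
      using tangent_spaceD(2)[OF v that] tangent_spaceD(2)[OF w that] by simp
    ultimately show "v + w \<in> tangent_space M p"
      unfolding tangent_space_def by blast
  next
    fix a v assume v: "v \<in> tangent_space M p"
    have "(a *\<^sub>R v) d = fd (snd d \<circ> chart_inv c) (snd c p) ((a *\<^sub>R v) c)"
      if "c \<in> charts_at M p" "d \<in> charts_at M p" for c d
      using tangent_spaceD(1)[OF v that] by (simp add: linear_scale[OF lin[OF that]] scaleR_fun_def)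
    moreover have "(a *\<^sub>R v) c = 0" if "c \<notin> charts_at M p" for c
      using tangent_spaceD(2)[OF v that] by (simp add: scaleR_fun_def)
    ultimately show "a *\<^sub>R v \<in> tangent_space M p"
      unfolding tangent_space_def by blast
  qed
qed

end

text \<open>Unlike \<^const>\<open>smooth_map\<close>, this can be checked in a single pair of charts.\<close>

definition smooth_at ::
    "('a, 'e::euclidean_space) manifold \<Rightarrow> ('b, 'f::euclidean_space) manifold \<Rightarrow> ('a \<Rightarrow> 'b) \<Rightarrow> 'a \<Rightarrow> bool" where
  "smooth_at M N f p \<longleftrightarrow>
     (\<forall>c\<in>charts_at M p. \<forall>d\<in>charts_at N (f p). \<exists>T. open T \<and> snd c p \<in> T \<and> T \<subseteq> snd c ` fst c \<and>
        (\<forall>x\<in>T. f (chart_inv c x) \<in> fst d) \<and> smooth_on T (\<lambda>x. snd d (f (chart_inv c x))))"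

lemma smooth_atD:
  assumes "smooth_at M N f p" "c \<in> charts_at M p" "d \<in> charts_at N (f p)"
  obtains T where "open T" "snd c p \<in> T" "T \<subseteq> snd c ` fst c"
    "\<And>x. x \<in> T \<Longrightarrow> f (chart_inv c x) \<in> fst d" "smooth_on T (\<lambda>x. snd d (f (chart_inv c x)))"
  using assms unfolding smooth_at_def by metis

lemma smooth_at_differentiable:
  assumes "smooth_at M N f p" "c \<in> charts_at M p" "d \<in> charts_at N (f p)"
  shows "(\<lambda>x. snd d (f (chart_inv c x))) differentiable (at (snd c p))"
  using smooth_atD[OF assms] smooth_on_differentiable by metis

lemma open_preimage_smooth:
  assumes "smooth_on T f" "open T" "open W"
  shows "open {x \<in> T. f x \<in> W}"
proof -
  have "open (T \<inter> f -` W)"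
    by (rule continuous_open_preimage[OF smooth_on_continuous_on[OF assms(1)] assms(2,3)])
  then show ?thesis by (simp add: vimage_def Int_def)
qed

lemma smooth_atI:
  assumes M: "smooth_manifold M" and N: "smooth_manifold N"
    and c: "c \<in> charts_at M p" and d: "d \<in> charts_at N (f p)"
    and T: "open T" "snd c p \<in> T" "T \<subseteq> snd c ` fst c"
    "\<And>x. x \<in> T \<Longrightarrow> f (chart_inv c x) \<in> fst d" "smooth_on T (\<lambda>x. snd d (f (chart_inv c x)))"
  shows "smooth_at M N f p"
  unfolding smooth_at_def
proof (intro ballI)
  fix c' d' assume c': "c' \<in> charts_at M p" and d': "d' \<in> charts_at N (f p)"
  note ch = c[unfolded charts_at_iff] d[unfolded charts_at_iff] c'[unfolded charts_at_iff] d'[unfolded charts_at_iff]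
  let ?t = "\<lambda>x. snd c (chart_inv c' x)" and ?s = "\<lambda>y. snd d' (chart_inv d y)" and ?f = "\<lambda>x. snd d (f (chart_inv c x))"
  \<comment> \<open>The neighbourhood is shrunk until both coordinate changes are defined:
    \<open>T1\<close> takes care of the target charts, \<open>T'\<close> of the source
    charts.\<close>
  define T1 where "T1 = {x \<in> T. ?f x \<in> snd d ` (fst d \<inter> fst d')}"
  define T' where "T' = {x \<in> snd c' ` (fst c' \<inter> fst c). ?t x \<in> T1}"
  have "open T1"
    unfolding T1_def by (rule open_preimage_smooth[OF T(5,1)]) (use ch transition_open[OF N] in blast)
  have t: "smooth_on (snd c' ` (fst c' \<inter> fst c)) ?t" "open (snd c' ` (fst c' \<inter> fst c))"
    using ch chart_smooth_transition[OF M] transition_open[OF M] by blast+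
  have "open T'"
    unfolding T'_def by (rule open_preimage_smooth[OF t \<open>open T1\<close>])
  have inv: "chart_inv c (?t x) = chart_inv c' x" "chart_inv d (?f (?t x)) = f (chart_inv c' x)"
    "f (chart_inv c' x) \<in> fst d'" if "x \<in> T'" for x
  proof -
    have x: "?t x \<in> T" "?f (?t x) \<in> snd d ` (fst d \<inter> fst d')" "x \<in> snd c' ` (fst c' \<inter> fst c)"
      using that unfolding T'_def T1_def by blast+
    then obtain q where q: "q \<in> fst c'" "q \<in> fst c" "x = snd c' q" by blast
    then show 1: "chart_inv c (?t x) = chart_inv c' x"
      using ch by (simp add: chart_inv_chart[OF M])
    obtain r where r: "r \<in> fst d" "r \<in> fst d'" "?f (?t x) = snd d r" using x(2) by blast
    have "f (chart_inv c (?t x)) \<in> fst d" using T(4) x(1) by blast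
    then have "r = f (chart_inv c' x)"
      using r(1,3) 1 ch inj_onD[OF chart_inj[OF N, of d]] by metis
    then show "chart_inv d (?f (?t x)) = f (chart_inv c' x)" "f (chart_inv c' x) \<in> fst d'"
      using r ch by (auto simp: chart_inv_chart[OF N])
  qed
  show "\<exists>T. open T \<and> snd c' p \<in> T \<and> T \<subseteq> snd c' ` fst c' \<and>
        (\<forall>x\<in>T. f (chart_inv c' x) \<in> fst d') \<and> smooth_on T (\<lambda>x. snd d' (f (chart_inv c' x)))"
  proof (intro exI[of _ T'] conjI ballI)
    show "open T'" by fact
    show "snd c' p \<in> T'"
      using ch T(2) by (auto simp: T'_def T1_def chart_inv_chart[OF M])
    show "T' \<subseteq> snd c' ` fst c'" by (auto simp: T'_def)
    show "f (chart_inv c' x) \<in> fst d'" if "x \<in> T'" for x using inv that by blast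
    have 1: "smooth_on T' (\<lambda>x. ?f (?t x))"
      by (rule smooth_on_compose[OF T(5) smooth_on_subset[OF t(1)] \<open>open T'\<close>]) (auto simp: T'_def T1_def)
    have "smooth_on T' (\<lambda>x. ?s (?f (?t x)))"
      by (rule smooth_on_compose[OF chart_smooth_transition[OF N, of d d'] 1 \<open>open T'\<close>])
        (use ch in \<open>auto simp: T'_def T1_def\<close>)
    then show "smooth_on T' (\<lambda>x. snd d' (f (chart_inv c' x)))"
      by (rule smooth_on_cong[OF _ \<open>open T'\<close>]) (simp add: inv(2))
  qed
qed

lemma smooth_at_compose:
  assumes M: "smooth_manifold M" and N: "smooth_manifold N" and P: "smooth_manifold P"
    and f: "smooth_at M N f p" and g: "smooth_at N P g (f p)"
    and top: "p \<in> topspace (mtop M)" "f p \<in> topspace (mtop N)" "g (f p) \<in> topspace (mtop P)"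
  shows "smooth_at M P (\<lambda>x. g (f x)) p"
proof -
  obtain c d e where ch: "c \<in> charts_at M p" "d \<in> charts_at N (f p)" "e \<in> charts_at P (g (f p))"
    using charts_at_nonempty M N P top by metis
  note ch' = ch[unfolded charts_at_iff]
  obtain T where T: "open T" "snd c p \<in> T" "T \<subseteq> snd c ` fst c"
    "\<And>x. x \<in> T \<Longrightarrow> f (chart_inv c x) \<in> fst d" "smooth_on T (\<lambda>x. snd d (f (chart_inv c x)))"
    using smooth_atD[OF f ch(1,2)] by blast
  obtain W where W: "open W" "snd d (f p) \<in> W" "W \<subseteq> snd d ` fst d"
    "\<And>x. x \<in> W \<Longrightarrow> g (chart_inv d x) \<in> fst e" "smooth_on W (\<lambda>x. snd e (g (chart_inv d x)))"
    using smooth_atD[OF g ch(2,3)] by blast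
  define T' where "T' = {x \<in> T. snd d (f (chart_inv c x)) \<in> W}"
  have "open T'" unfolding T'_def by (rule open_preimage_smooth[OF T(5,1) W(1)])
  have eq: "chart_inv d (snd d (f (chart_inv c x))) = f (chart_inv c x)" if "x \<in> T" for x
    using T(4)[OF that] ch' chart_inv_chart[OF N] by blast
  show ?thesis
  proof (rule smooth_atI[where f="\<lambda>x. g (f x)" and T=T', OF M P ch(1,3)])
    show "snd c p \<in> T'" using T(2) W(2) ch' by (simp add: T'_def chart_inv_chart[OF M])
    have "smooth_on T' (\<lambda>x. snd e (g (chart_inv d (snd d (f (chart_inv c x))))))"
      by (rule smooth_on_compose[OF W(5) smooth_on_subset[OF T(5)] \<open>open T'\<close>]) (auto simp: T'_def)
    then show "smooth_on T' (\<lambda>x. snd e (g (f (chart_inv c x))))"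
      by (rule smooth_on_cong[OF _ \<open>open T'\<close>]) (simp add: eq T'_def)
    show "g (f (chart_inv c x)) \<in> fst e" if "x \<in> T'" for x
      using that W(4)[of "snd d (f (chart_inv c x))"] eq by (auto simp: T'_def)
  qed (use T(3) \<open>open T'\<close> in \<open>auto simp: T'_def\<close>)
qed

lemma smooth_map_smooth_at:
  assumes M: "smooth_manifold M" and N: "smooth_manifold N"
    and f: "smooth_map M N f" and "p \<in> topspace (mtop M)"
  shows "smooth_at M N f p"
  unfolding smooth_at_def
proof (intro ballI exI conjI)
  fix c d assume c: "c \<in> charts_at M p" and d: "d \<in> charts_at N (f p)"
  note ch = c[unfolded charts_at_iff] d[unfolded charts_at_iff]
  let ?T = "snd c ` {p \<in> fst c. f p \<in> fst d}"
  have "openin (mtop M) {p \<in> topspace (mtop M). f p \<in> fst d}"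
  proof (rule openin_continuous_map_preimage)
    show "continuous_map (mtop M) (mtop N) f" using f by (simp add: smooth_map_def)
    show "openin (mtop N) (fst d)" using ch chart_openin[OF N] by blast
  qed
  then have "open (snd c ` (fst c \<inter> {p \<in> topspace (mtop M). f p \<in> fst d}))"
    using ch by (intro chart_image_open[OF M]) auto
  moreover have "fst c \<subseteq> topspace (mtop M)" using ch chart_openin[OF M] openin_subset by blast
  then have "fst c \<inter> {p \<in> topspace (mtop M). f p \<in> fst d} = {p \<in> fst c. f p \<in> fst d}" by auto
  ultimately show "open ?T" by simp
  show "snd c p \<in> ?T" using ch by auto
  show "?T \<subseteq> snd c ` fst c" by auto
  show "f (chart_inv c x) \<in> fst d" if "x \<in> ?T" for x
    using that ch by (auto simp: chart_inv_chart[OF M])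
  show "smooth_on ?T (\<lambda>x. snd d (f (chart_inv c x)))"
    using f ch by (auto simp: smooth_map_def o_def)
qed

text \<open>The Jacobians of one map in two pairs of charts differ by the Jacobians of the
  coordinate changes. This makes the chart selected in \<open>differential\<close>
  immaterial.\<close>

lemma smooth_at_fd_change:
  assumes M: "smooth_manifold M" and N: "smooth_manifold N" and f: "smooth_at M N f p"
    and ch: "c \<in> charts_at M p" "c' \<in> charts_at M p" "d \<in> charts_at N (f p)" "d' \<in> charts_at N (f p)"
  shows "fd (snd d' \<circ> f \<circ> chart_inv c) (snd c p) y =
    fd (snd d' \<circ> chart_inv d) (snd d (f p)) (fd (snd d \<circ> f \<circ> chart_inv c') (snd c' p) (fd (snd c' \<circ> chart_inv c) (snd c p) y))"
proof -
  note ch' = ch[unfolded charts_at_iff]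
  obtain T where T: "open T" "snd c p \<in> T" "T \<subseteq> snd c ` fst c"
    "\<And>x. x \<in> T \<Longrightarrow> f (chart_inv c x) \<in> fst d" "smooth_on T (\<lambda>x. snd d (f (chart_inv c x)))"
    using smooth_atD[OF f ch(1,3)] by blast
  let ?T = "T \<inter> snd c ` (fst c \<inter> fst c')"
  have o: "open ?T" using T(1) transition_open[OF M] ch' by blast
  have p: "snd c p \<in> ?T" using T(2) ch' by auto
  have e: "chart_inv c' (snd c' (chart_inv c x)) = chart_inv c x"
     "chart_inv d (snd d (f (chart_inv c x))) = f (chart_inv c x)" if "x \<in> ?T" for x
    using that ch' T(4)[of x] by (auto simp: chart_inv_chart[OF M] chart_inv_chart[OF N])
  let ?f = "\<lambda>x. snd d (f (chart_inv c' x))" and ?t = "\<lambda>x. snd c' (chart_inv c x)" and ?s = "\<lambda>y. snd d' (chart_inv d y)"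
  have "fd (snd d' \<circ> f \<circ> chart_inv c) (snd c p) = fd (\<lambda>x. ?s (?f (?t x))) (snd c p)"
    by (rule fd_cong[OF o p]) (simp add: e)
  moreover have pp: "?t (snd c p) = snd c' p" "?f (snd c' p) = snd d (f p)"
    using ch' by (simp_all add: chart_inv_chart[OF M])
  moreover have dt: "?t differentiable (at (snd c p))" by (rule transition_differentiable[OF M ch(1,2)])
  moreover have df: "?f differentiable (at (snd c' p))" by (rule smooth_at_differentiable[OF f ch(2,3)])
  moreover have ds: "?s differentiable (at (snd d (f p)))" by (rule transition_differentiable[OF N ch(3,4)])
  moreover have "(\<lambda>x. ?f (?t x)) differentiable (at (snd c p))"
    using differentiable_compose[of ?f ?t "snd c p"] dt df pp by simp
  ultimately show ?thesis
    by (simp add: fd_compose[of ?s "\<lambda>x. ?f (?t x)"] fd_compose[of ?f ?t] o_def)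
qed

lemma differential_component:
  assumes M: "smooth_manifold M" and N: "smooth_manifold N" and f: "smooth_at M N f p"
    and v: "v \<in> tangent_space M p" and c: "c \<in> charts_at M p" and d: "d \<in> charts_at N (f p)"
  shows "differential M N f p v d = fd (\<lambda>x. snd d (f (chart_inv c x))) (snd c p) (v c)"
proof -
  define c' where "c' = (SOME c. c \<in> charts_at M p)"
  have c': "c' \<in> charts_at M p" unfolding c'_def using c by (rule someI)
  have "v c = fd (snd c \<circ> chart_inv c') (snd c' p) (v c')"
    using tangent_spaceD(1)[OF M v c' c] .
  moreover have "fd (snd d \<circ> f \<circ> chart_inv c') (snd c' p) (v c') =
    fd (snd d \<circ> chart_inv d) (snd d (f p)) (fd (snd d \<circ> f \<circ> chart_inv c) (snd c p) (fd (snd c \<circ> chart_inv c') (snd c' p) (v c')))"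
    by (rule smooth_at_fd_change[OF M N f c' c d d])
  ultimately show ?thesis
    using d by (simp add: differential_def Let_def c'_def[symmetric] transition_self[OF N d]) (simp add: o_def)
qed

lemma differential_outside: "d \<notin> charts_at N (f p) \<Longrightarrow> differential M N f p v d = 0"
  by (simp add: differential_def)

lemma differential_tangent_space:
  assumes M: "smooth_manifold M" and N: "smooth_manifold N" and f: "smooth_at M N f p"
    and v: "v \<in> tangent_space M p" and p: "p \<in> topspace (mtop M)"
  shows "differential M N f p v \<in> tangent_space N (f p)"
proof -
  obtain c where c: "c \<in> charts_at M p" using charts_at_nonempty[OF M p] by blast
  have "differential M N f p v d' = fd (snd d' \<circ> chart_inv d) (snd d (f p)) (differential M N f p v d)"
    if d: "d \<in> charts_at N (f p)" "d' \<in> charts_at N (f p)" for d d'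
    unfolding differential_component[OF M N f v c d(1)] differential_component[OF M N f v c d(2)]
    using smooth_at_fd_change[OF M N f c c d, of "v c"] by (simp only: transition_self[OF M c, unfolded o_def] o_def)
  moreover have "differential M N f p v d = 0" if "d \<notin> charts_at N (f p)" for d
    using that by (rule differential_outside)
  ultimately show ?thesis
    unfolding tangent_space_def by blast
qed


section \<open>Lie groups in a chart around the unit\<close>

text \<open>Brackets of related fields are related: differentiating
  \<open>Z' (f a) = fd f a (Z a)\<close> produces a second derivative of \<open>f\<close>, which
  cancels in the bracket by symmetry. It serves for coordinate changes and for orbit maps.\<close>

lemma related_fields_bracket:
  fixes f :: "'a::euclidean_space \<Rightarrow> 'b::euclidean_space"
  assumes f: "smooth_on S f" and S: "open S" "a \<in> S"
    and d: "X differentiable (at a)" "Y differentiable (at a)" "X' differentiable (at (f a))" "Y' differentiable (at (f a))"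
    and X: "\<And>a. a \<in> S \<Longrightarrow> X' (f a) = fd f a (X a)" and Y: "\<And>a. a \<in> S \<Longrightarrow> Y' (f a) = fd f a (Y a)"
  shows "fd Y' (f a) (X' (f a)) - fd X' (f a) (Y' (f a)) = fd f a (fd Y a (X a) - fd X a (Y a))"
proof -
  have df: "f differentiable (at a)" using f S smooth_on_differentiable by blast
  have *: "fd Z' (f a) (fd f a w) = fd (\<lambda>x. fd f x (Z a)) a w + fd f a (fd Z a w)"
    if Z: "\<And>a. a \<in> S \<Longrightarrow> Z' (f a) = fd f a (Z a)" "Z differentiable (at a)" "Z' differentiable (at (f a))" for Z Z' w
  proof -
    have 1: "((\<lambda>x. Z' (f x)) has_derivative (\<lambda>w. fd Z' (f a) (fd f a w))) (at a)"
      using has_derivative_compose[OF fd_has_derivative[OF df] fd_has_derivative[OF Z(3)]] .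
    have 2: "((\<lambda>x. fd f x (Z x)) has_derivative (\<lambda>w. fd (\<lambda>x. fd f x (Z a)) a w + fd f a (fd Z a w))) (at a)"
      by (rule has_derivative_fd[OF f S has_derivative_ident fd_has_derivative[OF Z(2)]])
    have "((\<lambda>x. Z' (f x)) has_derivative (\<lambda>w. fd (\<lambda>x. fd f x (Z a)) a w + fd f a (fd Z a w))) (at a)"
      by (rule has_derivative_transform_within_open[OF 2 S]) (simp add: Z(1))
    from has_derivative_unique[OF 1 this] show ?thesis by metis
  qed
  have "fd (\<lambda>x. fd f x (Y a)) a (X a) = fd (\<lambda>x. fd f x (X a)) a (Y a)"
    by (rule fd_fd_commute[OF f S])
  then show ?thesis
    using *[OF Y d(2,4), of "X a"] *[OF X d(1,3), of "Y a"]
    by (simp add: X[OF S(2)] Y[OF S(2)] linear_diff[OF linear_fd[OF df]])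
qed

locale lie_chart =
  fixes G :: "'g monoid" (structure) and MG :: "('g, 'e::euclidean_space) manifold" and d :: "('g, 'e) chart"
  assumes lie: "lie_group G MG" and d: "d \<in> charts_at MG \<one>"
begin

sublocale group G using lie by (simp add: lie_group_def)

lemma MG: "smooth_manifold MG" and topMG: "topspace (mtop MG) = carrier G"
  and smooth_mult: "smooth_map (prod_manifold MG MG) MG (\<lambda>(x, y). x \<otimes> y)"
  and smooth_inv: "smooth_map MG MG (\<lambda>x. inv x)"
  using lie by (auto simp: lie_group_def)

lemma chart_carrier: "c \<in> atlas MG \<Longrightarrow> fst c \<subseteq> carrier G"
  using chart_openin[OF MG] openin_subset topMG by blast

lemma chart_inv_in: "x \<in> snd c ` fst c \<Longrightarrow> chart_inv c x \<in> fst c" for c :: "('g, 'e) chart"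
  by (rule inv_into_into)

text \<open>Smoothness of multiplication, unpacked from the product manifold into one function on a
  box of coordinates. Continuity provides the box, and on it the inverse of the product chart splits
  into the two inverse charts.\<close>

lemma mult_local:
  assumes "c1 \<in> charts_at MG g" "c2 \<in> charts_at MG h" "c3 \<in> charts_at MG (g \<otimes> h)"
  obtains A B where "open A" "open B" "snd c1 g \<in> A" "snd c2 h \<in> B" "A \<subseteq> snd c1 ` fst c1" "B \<subseteq> snd c2 ` fst c2"
    "\<And>a b. a \<in> A \<Longrightarrow> b \<in> B \<Longrightarrow> chart_inv c1 a \<otimes> chart_inv c2 b \<in> fst c3"
    "smooth_on (A \<times> B) (\<lambda>z. snd c3 (chart_inv c1 (fst z) \<otimes> chart_inv c2 (snd z)))"
proof -
  note ch = assms[unfolded charts_at_iff]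
  have gh: "g \<in> carrier G" "h \<in> carrier G" using ch chart_carrier by blast+
  have mt: "mtop (prod_manifold MG MG) = prod_topology (mtop MG) (mtop MG)" by (simp add: prod_manifold_def)
  let ?W = "{p \<in> topspace (mtop (prod_manifold MG MG)). (case p of (x, y) \<Rightarrow> x \<otimes> y) \<in> fst c3}"
  have "openin (mtop (prod_manifold MG MG)) {p \<in> topspace (mtop (prod_manifold MG MG)). (case p of (x, y) \<Rightarrow> x \<otimes> y) \<in> fst c3}"
  proof (rule openin_continuous_map_preimage)
    show "continuous_map (mtop (prod_manifold MG MG)) (mtop MG) (\<lambda>(x, y). x \<otimes> y)"
      using smooth_mult by (simp add: smooth_map_def)
    show "openin (mtop MG) (fst c3)" using ch chart_openin[OF MG] by blast
  qed
  then have W: "openin (prod_topology (mtop MG) (mtop MG)) ?W" by (simp only: mt)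
  have "(g, h) \<in> ?W" using gh ch by (simp add: mt topMG)
  from openin_prod_topology_alt[THEN iffD1, OF W, rule_format, OF this]
  obtain U V where UV: "openin (mtop MG) U" "openin (mtop MG) V" "g \<in> U" "h \<in> V" "U \<times> V \<subseteq> ?W"
    by (elim exE conjE)
  define A where "A = snd c1 ` (fst c1 \<inter> U)"
  define B where "B = snd c2 ` (fst c2 \<inter> V)"
  have AB: "chart_inv c1 a \<in> fst c1 \<inter> U" "chart_inv c2 b \<in> fst c2 \<inter> V" if "a \<in> A" "b \<in> B" for a b
    using that ch by (auto simp: A_def B_def chart_inv_chart[OF MG])
  have prod: "chart_inv c1 a \<otimes> chart_inv c2 b \<in> fst c3" if "a \<in> A" "b \<in> B" for a b
    using AB[OF that] UV(5) by auto
  let ?c = "(fst c1 \<times> fst c2, map_prod (snd c1) (snd c2))"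
  have inj: "inj_on (snd ?c) (fst ?c)"
    using map_prod_inj_on[OF chart_inj[OF MG, of c1] chart_inj[OF MG, of c2]] ch by simp
  have inv_prod: "chart_inv ?c (a, b) = (chart_inv c1 a, chart_inv c2 b)" if "a \<in> A" "b \<in> B" for a b
  proof -
    have "(a, b) = snd ?c (chart_inv c1 a, chart_inv c2 b)"
      using that by (auto simp: A_def B_def f_inv_into_f)
    then show ?thesis using inv_into_f_f[OF inj, of "(chart_inv c1 a, chart_inv c2 b)"] AB[OF that] by simp
  qed
  have o: "open A" "open B"
    unfolding A_def B_def using ch UV by (auto intro: chart_image_open[OF MG])
  have "?c \<in> atlas (prod_manifold MG MG)" using ch by (simp add: prod_manifold_def del: split_paired_Ex) blast
  then have 1: "smooth_on (snd ?c ` {p \<in> fst ?c. (case p of (x, y) \<Rightarrow> x \<otimes> y) \<in> fst c3})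
     (snd c3 \<circ> (\<lambda>(x, y). x \<otimes> y) \<circ> chart_inv ?c)"
    using smooth_mult ch unfolding smooth_map_def by blast
  have "A \<times> B \<subseteq> snd ?c ` {p \<in> fst ?c. (case p of (x, y) \<Rightarrow> x \<otimes> y) \<in> fst c3}"
  proof clarify
    fix a b assume ab: "a \<in> A" "b \<in> B"
    have "(a, b) = snd ?c (chart_inv c1 a, chart_inv c2 b)"
      using ab by (auto simp: A_def B_def f_inv_into_f)
    then show "(a, b) \<in> snd ?c ` {p \<in> fst ?c. (case p of (x, y) \<Rightarrow> x \<otimes> y) \<in> fst c3}"
      using AB[OF ab] prod[OF ab] by (intro image_eqI[of _ _ "(chart_inv c1 a, chart_inv c2 b)"]) auto
  qed
  then have "smooth_on (A \<times> B) (snd c3 \<circ> (\<lambda>(x, y). x \<otimes> y) \<circ> chart_inv ?c)"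
    by (rule smooth_on_subset[OF 1])
  then have "smooth_on (A \<times> B) (\<lambda>z. snd c3 (chart_inv c1 (fst z) \<otimes> chart_inv c2 (snd z)))"
    by (rule smooth_on_cong) (use o inv_prod in \<open>auto intro: open_Times\<close>)
  moreover have "snd c1 g \<in> A" "snd c2 h \<in> B" "A \<subseteq> snd c1 ` fst c1" "B \<subseteq> snd c2 ` fst c2"
    using ch UV by (auto simp: A_def B_def)
  ultimately show ?thesis using that o prod by blast
qed

lemma smooth_at_left_mult:
  assumes g: "g \<in> carrier G" and h: "h \<in> carrier G"
  shows "smooth_at MG MG (\<lambda>x. g \<otimes> x) h"
proof -
  obtain c1 c2 c3 where ch: "c1 \<in> charts_at MG g" "c2 \<in> charts_at MG h" "c3 \<in> charts_at MG (g \<otimes> h)"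
    using charts_at_nonempty[OF MG] assms by (metis m_closed topMG)
  note ch' = ch[unfolded charts_at_iff]
  obtain A B where AB: "open A" "open B" "snd c1 g \<in> A" "snd c2 h \<in> B" "A \<subseteq> snd c1 ` fst c1" "B \<subseteq> snd c2 ` fst c2"
    "\<And>a b. a \<in> A \<Longrightarrow> b \<in> B \<Longrightarrow> chart_inv c1 a \<otimes> chart_inv c2 b \<in> fst c3"
    "smooth_on (A \<times> B) (\<lambda>z. snd c3 (chart_inv c1 (fst z) \<otimes> chart_inv c2 (snd z)))"
    using mult_local[OF ch] by blast
  have g': "chart_inv c1 (snd c1 g) = g" using ch' by (simp add: chart_inv_chart[OF MG])
  show ?thesis
  proof (rule smooth_atI[where f="\<lambda>x. g \<otimes> x" and T=B, OF MG MG ch(2,3)])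
    show "g \<otimes> chart_inv c2 x \<in> fst c3" if "x \<in> B" for x
      using AB(7)[OF AB(3) that] g' by simp
    have "smooth_on B (\<lambda>b. snd c3 (chart_inv c1 (fst (snd c1 g, b)) \<otimes> chart_inv c2 (snd (snd c1 g, b))))"
      by (rule smooth_on_compose[OF AB(8)]) (use AB in \<open>auto intro: smooth_on_Pair smooth_on_const smooth_on_ident\<close>)
    then show "smooth_on B (\<lambda>b. snd c3 (g \<otimes> chart_inv c2 b))" by (simp add: g')
  qed (use AB in auto)
qed

definition a0 :: 'e where "a0 = snd d \<one>"

abbreviation gd :: "'e \<Rightarrow> 'g" where "gd \<equiv> chart_inv d"

definition \<mu> :: "'e \<times> 'e \<Rightarrow> 'e" where "\<mu> z = snd d (gd (fst z) \<otimes> gd (snd z))"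

text \<open>The same set serves for both factors, so that products can be formed from either side
  with \<open>a0\<close> as unit. It is fixed once by choice, to be shared by all lemmas of the
  locale.\<close>

definition dom :: "'e set" where
  "dom = (SOME A. open A \<and> a0 \<in> A \<and> A \<subseteq> snd d ` fst d \<and> (\<forall>a\<in>A. \<forall>b\<in>A. gd a \<otimes> gd b \<in> fst d) \<and> smooth_on (A \<times> A) \<mu>)"

lemma chart_unit: "d \<in> atlas MG" "\<one> \<in> fst d"
  using d by (auto simp: charts_at_iff)

lemma dom: "open dom" "a0 \<in> dom" "dom \<subseteq> snd d ` fst d" "a \<in> dom \<Longrightarrow> b \<in> dom \<Longrightarrow> gd a \<otimes> gd b \<in> fst d"
  "smooth_on (dom \<times> dom) \<mu>"
proof -
  have "\<exists>A. open A \<and> a0 \<in> A \<and> A \<subseteq> snd d ` fst d \<and> (\<forall>a\<in>A. \<forall>b\<in>A. gd a \<otimes> gd b \<in> fst d) \<and> smooth_on (A \<times> A) \<mu>"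
  proof -
    have d1: "d \<in> charts_at MG (\<one> \<otimes> \<one>)" using d by simp
    obtain A B where AB: "open A" "open B" "snd d \<one> \<in> A" "snd d \<one> \<in> B" "A \<subseteq> snd d ` fst d" "B \<subseteq> snd d ` fst d"
      "\<And>a b. a \<in> A \<Longrightarrow> b \<in> B \<Longrightarrow> gd a \<otimes> gd b \<in> fst d"
      "smooth_on (A \<times> B) (\<lambda>z. snd d (gd (fst z) \<otimes> gd (snd z)))"
      using mult_local[OF d d d1] by blast
    show ?thesis
      by (rule exI[of _ "A \<inter> B"])
        (use AB in \<open>auto simp: a0_def \<mu>_def[abs_def] intro: smooth_on_subset[OF AB(8)]\<close>)
  qed
  from someI_ex[OF this, folded dom_def]
  show "open dom" "a0 \<in> dom" "dom \<subseteq> snd d ` fst d" "a \<in> dom \<Longrightarrow> b \<in> dom \<Longrightarrow> gd a \<otimes> gd b \<in> fst d"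
    "smooth_on (dom \<times> dom) \<mu>" by blast+
qed

lemma open_dom2: "open (dom \<times> dom)"
  using dom(1) by (intro open_Times)

lemma gd_snd: "g \<in> fst d \<Longrightarrow> gd (snd d g) = g"
  using chart_inv_chart[OF MG chart_unit(1)] .

lemma snd_gd: "a \<in> dom \<Longrightarrow> snd d (gd a) = a"
  using dom(3) by (auto simp: f_inv_into_f)

lemma gd_fst: "a \<in> dom \<Longrightarrow> gd a \<in> fst d"
  using dom(3) chart_inv_in by blast

lemma gd_carrier: "a \<in> dom \<Longrightarrow> gd a \<in> carrier G"
  using gd_fst chart_carrier chart_unit by blast

lemma gd_a0: "gd a0 = \<one>"
  unfolding a0_def using chart_unit by (intro gd_snd)

lemma gd_\<mu>: "a \<in> dom \<Longrightarrow> b \<in> dom \<Longrightarrow> gd (\<mu> (a, b)) = gd a \<otimes> gd b"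
  by (simp add: \<mu>_def gd_snd dom(4))

lemma \<mu>_unit: "a \<in> dom \<Longrightarrow> \<mu> (a, a0) = a" "a \<in> dom \<Longrightarrow> \<mu> (a0, a) = a"
  by (simp_all add: \<mu>_def gd_a0 gd_carrier snd_gd)

text \<open>The left-invariant field with value \<open>y\<close> at the unit.\<close>

definition lf :: "'e \<Rightarrow> 'e \<Rightarrow> 'e" where "lf y a = fd \<mu> (a, a0) (0, y)"

lemma smooth_lf: "smooth_on dom (lf y)"
  unfolding lf_def
  by (rule smooth_on_fd[OF dom(5)])
    (use dom in \<open>auto intro!: smooth_on_Pair smooth_on_ident smooth_on_const\<close>)

lemma fd_\<mu>_right:
  assumes "a \<in> dom" "b \<in> dom"
  shows "((\<lambda>b. \<mu> (a, b)) has_derivative (\<lambda>y. fd \<mu> (a, b) (0, y))) (at b)"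
  using smooth_on_has_derivative_compose[OF dom(5), of "\<lambda>b. (a, b)" "\<lambda>y. (0, y)" b]
    has_derivative_Pair[OF has_derivative_const has_derivative_ident] assms by auto

lemma fd_\<mu>_left:
  assumes "a \<in> dom" "b \<in> dom"
  shows "((\<lambda>a. \<mu> (a, b)) has_derivative (\<lambda>y. fd \<mu> (a, b) (y, 0))) (at a)"
  using smooth_on_has_derivative_compose[OF dom(5), of "\<lambda>a. (a, b)" "\<lambda>y. (y, 0)" a]
    has_derivative_Pair[OF has_derivative_ident has_derivative_const] assms by auto

lemma lf_a0: "lf y a0 = y"
proof -
  have "fd (\<lambda>b. \<mu> (a0, b)) a0 = fd (\<lambda>b. b) a0"
    by (rule fd_cong[OF dom(1,2)]) (simp add: \<mu>_unit)
  then show ?thesis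
    using fd_eqI[OF fd_\<mu>_right[OF dom(2) dom(2)], THEN fun_cong, of y]
    by (simp add: lf_def fd_eqI[OF has_derivative_ident])
qed

lemma one_carrier_top: "\<one> \<in> topspace (mtop MG)" by (simp add: topMG)

lemma left_invariant_field_tangent_space:
  assumes "u \<in> lie_algebra G MG" "g \<in> carrier G"
  shows "left_invariant_field G MG u g \<in> tangent_space MG g"
  using differential_tangent_space[OF MG MG smooth_at_left_mult[OF assms(2) one_closed] assms(1) one_carrier_top] assms
  by (simp add: left_invariant_field_def)

lemma left_invariant_field_component:
  assumes u: "u \<in> lie_algebra G MG" and a: "a \<in> dom"
  shows "left_invariant_field G MG u (gd a) d = lf (u d) a"
proof -
  have g: "gd a \<in> carrier G" using a gd_carrier by blast
  then have dg: "d \<in> charts_at MG (gd a \<otimes> \<one>)" using a gd_fst chart_unit by (simp add: charts_at_iff)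
  have "left_invariant_field G MG u (gd a) d = fd (\<lambda>x. snd d (gd a \<otimes> gd x)) (snd d \<one>) (u d)"
    unfolding left_invariant_field_def
    by (rule differential_component[OF MG MG smooth_at_left_mult[OF g one_closed] u d dg])
  also have "(\<lambda>x. snd d (gd a \<otimes> gd x)) = (\<lambda>b. \<mu> (a, b))" by (simp add: \<mu>_def)
  finally show ?thesis
    using fd_eqI[OF fd_\<mu>_right[OF a dom(2)]] by (simp add: lf_def a0_def)
qed

lemma fd_left_invariant_field:
  assumes "u \<in> lie_algebra G MG"
  shows "fd (\<lambda>x. left_invariant_field G MG u (gd x) d) a0 = fd (lf (u d)) a0"
  by (rule fd_cong[OF dom(1,2)]) (rule left_invariant_field_component[OF assms])

lemma lie_bracket_component:
  assumes u: "u \<in> lie_algebra G MG" and v: "v \<in> lie_algebra G MG"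
  shows "lie_bracket G MG u v d = fd (lf (v d)) a0 (u d) - fd (lf (u d)) a0 (v d)"
  using left_invariant_field_component[OF u dom(2)] left_invariant_field_component[OF v dom(2)] d
    fd_left_invariant_field[OF u] fd_left_invariant_field[OF v]
  by (simp add: lie_bracket_def field_bracket_def gd_a0 lf_a0 a0_def[symmetric])

lemma fd_lf: "fd (lf y) a0 w = fd (\<lambda>z. fd \<mu> z (0, y)) (a0, a0) (w, 0)"
proof -
  have "((\<lambda>a. fd \<mu> (a, a0) (0, y)) has_derivative (\<lambda>w. fd (\<lambda>z. fd \<mu> z (0, y)) (a0, a0) (w, 0))) (at a0)"
    by (rule smooth_on_has_derivative_compose[OF smooth_on_fd_const[OF dom(5) open_dom2], of "\<lambda>a. (a, a0)" "\<lambda>w. (w, 0)" a0])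
      (use dom(2) in \<open>auto intro!: has_derivative_Pair has_derivative_ident\<close>)
  then show ?thesis
    unfolding lf_def by (simp add: fd_eqI)
qed

end

text \<open>Membership means that the components in two charts correspond under the coordinate
  change. That change relates the two coordinate forms of each left-invariant field, so brackets
  correspond at the unit.\<close>

lemma (in lie_chart) lie_bracket_lie_algebra:
  assumes u: "u \<in> lie_algebra G MG" and v: "v \<in> lie_algebra G MG"
  shows "lie_bracket G MG u v \<in> lie_algebra G MG"
proof -
  have "lie_bracket G MG u v e = fd (snd e \<circ> chart_inv c) (snd c \<one>) (lie_bracket G MG u v c)"
    if c: "c \<in> charts_at MG \<one>" and e: "e \<in> charts_at MG \<one>" for c e
  proof -
    interpret c: lie_chart G MG c by unfold_locales (use lie c in auto)
    interpret e: lie_chart G MG e by unfold_locales (use lie e in auto)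
    let ?t = "\<lambda>a. snd e (chart_inv c a)"
    let ?S = "{a \<in> c.dom \<inter> snd c ` (fst c \<inter> fst e). ?t a \<in> e.dom}"
    have o: "open (c.dom \<inter> snd c ` (fst c \<inter> fst e))"
      using c.dom(1) transition_open[OF MG c.chart_unit(1) e.chart_unit(1)] by blast
    have t: "smooth_on (c.dom \<inter> snd c ` (fst c \<inter> fst e)) ?t"
      by (rule smooth_on_subset[OF chart_smooth_transition[OF MG c.chart_unit(1) e.chart_unit(1)]]) auto
    have S: "open ?S" by (rule open_preimage_smooth[OF t o e.dom(1)])
    have t0: "?t c.a0 = e.a0" by (simp add: c.gd_a0 e.a0_def)
    have aS: "c.a0 \<in> ?S"
      using c.dom(2) e.dom(2) t0 c.chart_unit(2) e.chart_unit(2) by (auto simp: c.a0_def)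
    have rel: "e.lf (w e) (?t a) = fd ?t a (c.lf (w c) a)" if "w \<in> lie_algebra G MG" "a \<in> ?S" for w a
    proof -
      let ?g = "chart_inv c a"
      have g: "?g \<in> fst c" "?g \<in> fst e" "snd c ?g = a"
        using that by (auto simp: chart_inv_chart[OF MG c.chart_unit(1)])
      then have ch: "c \<in> charts_at MG ?g" "e \<in> charts_at MG ?g" "?g \<in> carrier G"
        using c.chart_unit e.chart_unit chart_carrier[OF c.chart_unit(1)] by (auto simp: charts_at_iff)
      have "left_invariant_field G MG w ?g e = fd (snd e \<circ> chart_inv c) (snd c ?g) (left_invariant_field G MG w ?g c)"
        by (rule tangent_spaceD(1)[OF MG left_invariant_field_tangent_space[OF that(1) ch(3)] ch(1,2)])
      moreover have "left_invariant_field G MG w ?g c = c.lf (w c) a"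
        using that by (intro c.left_invariant_field_component) auto
      moreover have "left_invariant_field G MG w (chart_inv e (?t a)) e = e.lf (w e) (?t a)"
        using that by (intro e.left_invariant_field_component) auto
      moreover have "chart_inv e (?t a) = ?g" using g by (intro e.gd_snd)
      ultimately show ?thesis using g by (simp add: o_def)
    qed
    have diff: "c.lf y differentiable (at c.a0)" "e.lf y differentiable (at (?t c.a0))" for y
      using smooth_on_differentiable[OF c.smooth_lf c.dom(2)] smooth_on_differentiable[OF e.smooth_lf e.dom(2)] t0 by auto
    have tS: "smooth_on ?S ?t" by (rule smooth_on_subset[OF t]) auto
    have lin: "fd (e.lf (v e)) (?t c.a0) (e.lf (u e) (?t c.a0)) - fd (e.lf (u e)) (?t c.a0) (e.lf (v e) (?t c.a0)) =
      fd ?t c.a0 (fd (c.lf (v c)) c.a0 (c.lf (u c) c.a0) - fd (c.lf (u c)) c.a0 (c.lf (v c) c.a0))"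
      by (rule related_fields_bracket[OF tS S aS diff(1) diff(1) diff(2) diff(2)]) (use rel u v in auto)
    then show ?thesis
      by (simp only: t0 c.lf_a0 e.lf_a0 c.lie_bracket_component[OF u v] e.lie_bracket_component[OF u v] o_def c.a0_def[symmetric])
  qed
  moreover have "lie_bracket G MG u v c = 0" if "c \<notin> charts_at MG \<one>" for c
    using that by (simp add: lie_bracket_def field_bracket_def)
  ultimately show ?thesis unfolding tangent_space_def by blast
qed

lemma smooth_at_imp_smooth_map:
  assumes M: "smooth_manifold M" and N: "smooth_manifold N"
    and f: "\<And>p. p \<in> topspace (mtop M) \<Longrightarrow> f p \<in> topspace (mtop N)"
    "\<And>p. p \<in> topspace (mtop M) \<Longrightarrow> smooth_at M N f p"
  shows "smooth_map M N f"
  unfolding smooth_map_def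
proof (intro conjI ballI)
  show "continuous_map (mtop M) (mtop N) f"
    unfolding continuous_map_def
  proof (intro conjI allI impI)
    show "f \<in> topspace (mtop M) \<rightarrow> topspace (mtop N)" using f(1) by auto
    fix V assume V: "openin (mtop N) V"
    show "openin (mtop M) {x \<in> topspace (mtop M). f x \<in> V}"
    proof (subst openin_subopen, rule ballI)
      fix p assume "p \<in> {x \<in> topspace (mtop M). f x \<in> V}"
      then have p: "p \<in> topspace (mtop M)" "f p \<in> V" by auto
      obtain c d where ch: "c \<in> charts_at M p" "d \<in> charts_at N (f p)"
        using charts_at_nonempty M N p(1) f(1) by metis
      note ch' = ch[unfolded charts_at_iff]
      obtain T where T: "open T" "snd c p \<in> T" "T \<subseteq> snd c ` fst c"
        "\<And>x. x \<in> T \<Longrightarrow> f (chart_inv c x) \<in> fst d" "smooth_on T (\<lambda>x. snd d (f (chart_inv c x)))"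
        using smooth_atD[OF f(2)[OF p(1)] ch] by blast
      let ?T = "{x \<in> T. snd d (f (chart_inv c x)) \<in> snd d ` (fst d \<inter> V)}"
      have "open ?T"
        by (rule open_preimage_smooth[OF T(5,1)]) (use ch' V chart_image_open[OF N] in blast)
      then have "openin (mtop M) {q \<in> fst c. snd c q \<in> ?T}"
        using ch' chart_preimage_openin[OF M] by blast
      moreover have "p \<in> {q \<in> fst c. snd c q \<in> ?T}"
        using ch' p T(2) by (simp add: chart_inv_chart[OF M])
      moreover have "{q \<in> fst c. snd c q \<in> ?T} \<subseteq> {x \<in> topspace (mtop M). f x \<in> V}"
      proof (rule subsetI)
        fix q assume "q \<in> {q \<in> fst c. snd c q \<in> ?T}"
        then have q: "q \<in> fst c" "snd c q \<in> T" "snd d (f (chart_inv c (snd c q))) \<in> snd d ` (fst d \<inter> V)" by auto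
        have q': "chart_inv c (snd c q) = q" using q ch' by (simp add: chart_inv_chart[OF M])
        have "f q \<in> fst d" using T(4)[OF q(2)] q' by simp
        moreover obtain r where "r \<in> fst d" "r \<in> V" "snd d (f q) = snd d r" using q(3) q' by auto
        ultimately have "f q \<in> V" using inj_onD[OF chart_inj[OF N, of d]] ch' by metis
        moreover have "q \<in> topspace (mtop M)" using q(1) ch' chart_openin[OF M] openin_subset by blast
        ultimately show "q \<in> {x \<in> topspace (mtop M). f x \<in> V}" by simp
      qed
      ultimately show "\<exists>T. openin (mtop M) T \<and> p \<in> T \<and> T \<subseteq> {x \<in> topspace (mtop M). f x \<in> V}" by blast
    qed
  qed
next
  fix c d assume c: "c \<in> atlas M" and d: "d \<in> atlas N"
  show "smooth_on (snd c ` {p \<in> fst c. f p \<in> fst d}) (snd d \<circ> f \<circ> chart_inv c)"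
  proof (rule smooth_on_local)
    fix x assume "x \<in> snd c ` {p \<in> fst c. f p \<in> fst d}"
    then obtain p where p: "p \<in> fst c" "f p \<in> fst d" "x = snd c p" by blast
    have top: "p \<in> topspace (mtop M)" using p c chart_openin[OF M] openin_subset by blast
    have ch: "c \<in> charts_at M p" "d \<in> charts_at N (f p)" using p c d by (auto simp: charts_at_iff)
    obtain T where "open T" "snd c p \<in> T" "smooth_on T (\<lambda>x. snd d (f (chart_inv c x)))"
      by (rule smooth_atD[OF f(2)[OF top] ch])
    then show "\<exists>T. open T \<and> x \<in> T \<and> smooth_on T (snd d \<circ> f \<circ> chart_inv c)"
      using p by (auto simp: o_def)
  qed
qed

lemma smooth_manifold_real_line: "smooth_manifold real_line"
proof -
  obtain B :: "real set set" where B: "countable B" "\<And>C. C \<in> B \<Longrightarrow> open C"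
    "\<And>S. open S \<Longrightarrow> \<exists>U. U \<subseteq> B \<and> S = \<Union>U"
    by (rule univ_second_countable) blast
  then have "second_countable (euclidean :: real topology)"
    unfolding second_countable_def by (metis Union_iff Union_upper open_openin subset_iff)
  moreover have "homeomorphic_map (subtopology euclidean (UNIV :: real set)) (top_of_set (range (\<lambda>x :: real. x))) (\<lambda>x. x)"
    using homeomorphic_map_id[of "euclidean :: real topology" euclidean] by (simp add: id_def)
  ultimately show ?thesis
    by (simp add: smooth_manifold_def real_line_def Hausdorff_space_euclidean smooth_on_ident o_def)
qed

lemma topspace_real_line: "topspace (mtop real_line) = UNIV"
  by (simp add: real_line_def)

lemma charts_at_real_line: "charts_at real_line t = {(UNIV, \<lambda>x. x)}"
  by (auto simp: charts_at_def real_line_def)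

section \<open>One-parameter subgroups with prescribed initial velocity\<close>

context lie_chart
begin

text \<open>The quotient of two group elements in coordinates. It is constant along a pair of points
  moving with the same left-invariant field, which replaces a uniqueness theorem for integral
  curves.\<close>

definition \<kappa> :: "'e \<times> 'e \<Rightarrow> 'e" where "\<kappa> z = snd d (gd (fst z) \<otimes> inv (gd (snd z)))"

lemma quotient_chart:
  obtains C where "open C" "a0 \<in> C" "C \<subseteq> dom" "smooth_on (C \<times> C) \<kappa>"
    "\<And>a b. a \<in> C \<Longrightarrow> b \<in> C \<Longrightarrow> gd a \<otimes> inv (gd b) \<in> fst d"
proof -
  have "smooth_at MG MG (\<lambda>x. inv x) \<one>"
    by (rule smooth_map_smooth_at[OF MG MG smooth_inv one_carrier_top])
  moreover have "d \<in> charts_at MG (inv \<one>)" using d by simp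
  ultimately obtain T where T: "open T" "snd d \<one> \<in> T" "\<And>x. x \<in> T \<Longrightarrow> inv (gd x) \<in> fst d"
    "smooth_on T (\<lambda>x. snd d (inv (gd x)))"
    using smooth_atD[OF _ d] by metis
  define \<iota> where "\<iota> b = snd d (inv (gd b))" for b
  define C where "C = {b \<in> T \<inter> dom. \<iota> b \<in> dom}"
  have \<iota>: "smooth_on (T \<inter> dom) \<iota>" using smooth_on_subset[OF T(4)] unfolding \<iota>_def by blast
  have "open C"
    unfolding C_def by (rule open_preimage_smooth[OF \<iota>]) (use T dom in auto)
  have gi: "gd (\<iota> b) = inv (gd b)" if "b \<in> C" for b
    using that T(3) by (simp add: \<iota>_def C_def gd_snd)
  have "a0 \<in> C"
    using T(2) dom(2) by (simp add: C_def \<iota>_def gd_a0) (simp add: a0_def)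
  moreover have "smooth_on (C \<times> C) \<kappa>"
  proof (rule smooth_on_cong)
    show "smooth_on (C \<times> C) (\<lambda>z. \<mu> (fst z, \<iota> (snd z)))"
      by (rule smooth_on_compose[OF dom(5) smooth_on_Pair[OF _ smooth_on_compose[OF \<iota>]]])
        (use \<open>open C\<close> in \<open>auto simp: C_def intro!: smooth_on_fst smooth_on_snd smooth_on_ident open_Times\<close>)
    show "open (C \<times> C)" using \<open>open C\<close> by (intro open_Times)
  qed (auto simp: \<mu>_def \<kappa>_def gi)
  moreover have "gd a \<otimes> inv (gd b) \<in> fst d" if "a \<in> C" "b \<in> C" for a b
    using dom(4)[of a "\<iota> b"] that gi by (auto simp: C_def)
  moreover have "C \<subseteq> dom" by (auto simp: C_def)
  ultimately show ?thesis using that \<open>open C\<close> by blast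
qed

text \<open>Differentiate \<open>(a c) (b c)\<^sup>-\<^sup>1 = a b\<^sup>-\<^sup>1\<close> with respect to \<open>c\<close> at the unit.\<close>

lemma fd_\<kappa>_lf:
  assumes C: "open C" "C \<subseteq> dom" "smooth_on (C \<times> C) \<kappa>" and ab: "a \<in> C" "b \<in> C"
  shows "fd \<kappa> (a, b) (lf y a, lf y b) = 0"
proof -
  have \<mu>r: "smooth_on dom (\<lambda>c. \<mu> (a, c))" if "a \<in> C" for a
    by (rule smooth_on_compose[OF dom(5)])
      (use dom(1) C(2) that in \<open>auto intro!: smooth_on_Pair smooth_on_const smooth_on_ident\<close>)
  define W where "W = {c \<in> dom. \<mu> (a, c) \<in> C} \<inter> {c \<in> dom. \<mu> (b, c) \<in> C}"
  have "open W"
    unfolding W_def by (intro open_Int open_preimage_smooth \<mu>r ab dom(1) C(1))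
  have "a \<in> dom" "b \<in> dom" using ab C(2) by auto
  then have "a0 \<in> W" using ab dom(2) by (simp add: W_def \<mu>_unit)
  have "\<kappa> (\<mu> (a, c), \<mu> (b, c)) = \<kappa> (a, b)" if "c \<in> W" for c
  proof -
    have c: "c \<in> dom" using that by (simp add: W_def)
    note car = gd_carrier[OF \<open>a \<in> dom\<close>] gd_carrier[OF \<open>b \<in> dom\<close>] gd_carrier[OF c]
    have "gd a \<otimes> gd c \<otimes> inv (gd b \<otimes> gd c) = gd a \<otimes> (gd c \<otimes> inv (gd c)) \<otimes> inv (gd b)"
    proof -
      have "gd c \<otimes> (inv (gd c) \<otimes> inv (gd b)) = inv (gd b)"
        using car by (simp add: m_assoc[symmetric])
      then show ?thesis using car by (simp add: inv_mult_group m_assoc)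
    qed
    then show ?thesis
      using car c \<open>a \<in> dom\<close> \<open>b \<in> dom\<close> by (simp add: \<kappa>_def gd_\<mu>)
  qed
  then have 1: "((\<lambda>c. \<kappa> (\<mu> (a, c), \<mu> (b, c))) has_derivative (\<lambda>w. 0)) (at a0)"
    by (intro has_derivative_transform_within_open[OF has_derivative_const \<open>open W\<close> \<open>a0 \<in> W\<close>]) simp
  have 2: "((\<lambda>c. \<kappa> (\<mu> (a, c), \<mu> (b, c))) has_derivative
      (\<lambda>w. fd \<kappa> (\<mu> (a, a0), \<mu> (b, a0)) (lf w a, lf w b))) (at a0)"
    unfolding lf_def
  proof (rule smooth_on_has_derivative_compose[OF C(3)
        has_derivative_Pair[OF fd_\<mu>_right[OF \<open>a \<in> dom\<close> dom(2)] fd_\<mu>_right[OF \<open>b \<in> dom\<close> dom(2)]]])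
    show "(\<mu> (a, a0), \<mu> (b, a0)) \<in> C \<times> C"
      using ab \<mu>_unit(1)[OF \<open>a \<in> dom\<close>] \<mu>_unit(1)[OF \<open>b \<in> dom\<close>] by simp
  qed
  from has_derivative_unique[OF 1 2] show ?thesis
    unfolding \<mu>_unit(1)[OF \<open>a \<in> dom\<close>] \<mu>_unit(1)[OF \<open>b \<in> dom\<close>] by metis
qed

text \<open>Let \<open>x\<close> be the integral curve through the unit. For fixed \<open>s\<close>
  the quotient of \<open>x (s + r)\<close> by \<open>x r\<close> has zero derivative in
  \<open>r\<close>, so its value at \<open>r = t\<close> is that at \<open>r = 0\<close>, which is
  \<open>x s\<close>.\<close>

lemma local_one_parameter_subgroup:
  obtains e x where "e > 0" "x 0 = a0"
    "\<And>t. \<bar>t\<bar> < e \<Longrightarrow> x t \<in> dom" "\<And>t. \<bar>t\<bar> < e \<Longrightarrow> (x has_vector_derivative lf y (x t)) (at t)"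
    "\<And>s t. \<bar>s\<bar> < e \<Longrightarrow> \<bar>t\<bar> < e \<Longrightarrow> \<bar>s + t\<bar> < e \<Longrightarrow> gd (x (s + t)) = gd (x s) \<otimes> gd (x t)"
proof -
  obtain C where C: "open C" "a0 \<in> C" "C \<subseteq> dom" "smooth_on (C \<times> C) \<kappa>"
    "\<And>a b. a \<in> C \<Longrightarrow> b \<in> C \<Longrightarrow> gd a \<otimes> inv (gd b) \<in> fst d"
    using quotient_chart by blast
  obtain e x where ex: "e > 0" "x 0 = a0"
    "\<And>t. \<bar>t\<bar> < e \<Longrightarrow> x t \<in> C \<and> (x has_vector_derivative lf y (x t)) (at t)"
    using picard_local[OF smooth_on_subset[OF smooth_lf C(3)] C(1,2)] by blast
  have dom_x: "x t \<in> dom" if "\<bar>t\<bar> < e" for t using ex(3)[OF that] C(3) by blast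
  have "gd (x (s + t)) = gd (x s) \<otimes> gd (x t)" if st: "\<bar>s\<bar> < e" "\<bar>t\<bar> < e" "\<bar>s + t\<bar> < e" for s t
  proof -
    \<comment> \<open>The times \<open>r\<close> at which both \<open>r\<close> and
      \<open>s + r\<close> are admissible; an interval containing 0 and \<open>t\<close>.\<close>
    define I where "I = {-e<..<e} \<inter> {-e-s<..<e-s}"
    have I: "r \<in> I \<longleftrightarrow> \<bar>r\<bar> < e \<and> \<bar>s + r\<bar> < e" for r by (auto simp: I_def)
    have "((\<lambda>r. \<kappa> (x (s + r), x r)) has_derivative (\<lambda>h. 0)) (at r within I)" if "r \<in> I" for r
    proof -
      have r: "\<bar>r\<bar> < e" "\<bar>s + r\<bar> < e" using that I by auto
      have 1: "(x has_derivative (\<lambda>h. h *\<^sub>R lf y (x r))) (at r)"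
        using ex(3)[OF r(1)] by (simp add: has_vector_derivative_def)
      have "(x has_derivative (\<lambda>h. h *\<^sub>R lf y (x (s + r)))) (at (s + r))"
        using ex(3)[OF r(2)] by (simp add: has_vector_derivative_def)
      then have 2: "((\<lambda>r. x (s + r)) has_derivative (\<lambda>h. h *\<^sub>R lf y (x (s + r)))) (at r)"
        by (rule has_derivative_compose[rotated]) (auto intro!: derivative_eq_intros)
      have "((\<lambda>r. \<kappa> (x (s + r), x r)) has_derivative
        (\<lambda>h. fd \<kappa> (x (s + r), x r) (h *\<^sub>R lf y (x (s + r)), h *\<^sub>R lf y (x r)))) (at r)"
        by (rule smooth_on_has_derivative_compose[OF C(4) has_derivative_Pair[OF 2 1]])
          (use ex(3) r in auto)
      moreover have "fd \<kappa> (x (s + r), x r) (h *\<^sub>R lf y (x (s + r)), h *\<^sub>R lf y (x r)) = 0" for h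
      proof -
        have "(x (s + r), x r) \<in> C \<times> C" using ex(3) r by auto
        then have "linear (fd \<kappa> (x (s + r), x r))"
          using smooth_on_differentiable[OF C(4)] linear_fd by blast
        from linear_scale[OF this, of h "(lf y (x (s + r)), lf y (x r))"] show ?thesis
          using fd_\<kappa>_lf[OF C(1,3,4), of "x (s + r)" "x r" y] ex(3) r by simp
      qed
      ultimately show ?thesis by (simp add: has_derivative_at_withinI)
    qed
    moreover have "convex I" unfolding I_def by (intro convex_Int) auto
    moreover have "0 \<in> I" "t \<in> I" using st ex(1) I by auto
    ultimately have "\<kappa> (x (s + t), x t) = \<kappa> (x (s + 0), x 0)"
      using has_derivative_zero_unique[of I "\<lambda>r. \<kappa> (x (s + r), x r)"] by blast
    moreover have "\<kappa> (x s, a0) = snd d (gd (x s))"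
      using gd_carrier[OF dom_x[OF st(1)]] by (simp add: \<kappa>_def gd_a0)
    ultimately have "snd d (gd (x (s + t)) \<otimes> inv (gd (x t))) = snd d (gd (x s))"
      by (simp add: \<kappa>_def ex(2))
    moreover have "gd (x (s + t)) \<otimes> inv (gd (x t)) \<in> fst d"
      using C(5) ex(3) st by blast
    ultimately have "gd (x (s + t)) \<otimes> inv (gd (x t)) = gd (x s)"
      using gd_snd gd_fst[OF dom_x[OF st(1)]] by metis
    then show ?thesis
      using gd_carrier[OF dom_x] st by (metis inv_solve_right)
  qed
  then show ?thesis using that[of e x] ex dom_x by blast
qed

text \<open>The local homomorphism is extended to the line. The extension is smooth near 0 by
  construction, and elsewhere because it is a left translate of its values near 0. The local
  integral curve is returned as well, for the study of the subgroup \<open>H\<close>.\<close>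

lemma one_parameter_subgroup_exists:
  assumes u: "u \<in> lie_algebra G MG"
  obtains \<gamma> e x where "one_parameter_subgroup G MG \<gamma>" "velocity MG \<gamma> 0 = u" "e > 0" "x 0 = a0"
    "\<And>t. \<bar>t\<bar> < e \<Longrightarrow> x t \<in> dom" "\<And>t. \<bar>t\<bar> < e \<Longrightarrow> (x has_vector_derivative lf (u d) (x t)) (at t)"
    "\<And>t. \<bar>t\<bar> < e \<Longrightarrow> \<gamma> t = gd (x t)"
proof -
  obtain e x where ex: "e > 0" "x 0 = a0"
    "\<And>t. \<bar>t\<bar> < e \<Longrightarrow> x t \<in> dom" "\<And>t. \<bar>t\<bar> < e \<Longrightarrow> (x has_vector_derivative lf (u d) (x t)) (at t)"
    "\<And>s t. \<bar>s\<bar> < e \<Longrightarrow> \<bar>t\<bar> < e \<Longrightarrow> \<bar>s + t\<bar> < e \<Longrightarrow> gd (x (s + t)) = gd (x s) \<otimes> gd (x t)"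
    by (rule local_one_parameter_subgroup[of "u d"]) blast
  obtain \<gamma> where \<gamma>: "\<And>t. \<gamma> t \<in> carrier G" "\<And>s t. \<gamma> (s + t) = \<gamma> s \<otimes> \<gamma> t" "\<And>t. \<bar>t\<bar> < e \<Longrightarrow> \<gamma> t = gd (x t)"
    using local_hom_extend[OF ex(1) gd_carrier[OF ex(3)] ex(5)] by blast
  have x_smooth: "smooth_on {-e<..<e} x"
    by (rule smooth_on_integral_curve[OF smooth_lf[of "u d"]]) (use ex in auto)
  have \<gamma>0: "\<gamma> 0 = \<one>" using \<gamma>(3)[of 0] ex(1,2) gd_a0 by simp
  let ?c = "(UNIV :: real set, \<lambda>x :: real. x)"
  have at0: "smooth_at real_line MG \<gamma> 0"
  proof (rule smooth_atI[OF smooth_manifold_real_line MG, of ?c _ d _ "{-e<..<e}"])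
    have "smooth_on {-e<..<e} (\<lambda>t. snd d (\<gamma> t))"
      by (rule smooth_on_cong[OF x_smooth]) (use \<gamma>(3) ex(3) snd_gd in auto)
    then show "smooth_on {-e<..<e} (\<lambda>t. snd d (\<gamma> (chart_inv ?c t)))"
      by simp
    show "\<gamma> (chart_inv ?c t) \<in> fst d" if "t \<in> {-e<..<e}" for t
      using that \<gamma>(3)[of t] ex(3)[of t] gd_fst by (simp add: abs_less_iff)
  qed (use d ex(1) \<gamma>0 in \<open>auto simp: charts_at_real_line\<close>)
  have "smooth_at real_line MG \<gamma> t0" for t0
  proof -
    have shift: "smooth_at real_line real_line (\<lambda>t. t - t0) t0"
    proof (rule smooth_atI[OF smooth_manifold_real_line smooth_manifold_real_line, of ?c _ ?c _ UNIV])
      show "smooth_on UNIV (\<lambda>x. snd ?c (chart_inv ?c x - t0))"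
        by simp (intro smooth_on_diff smooth_on_ident smooth_on_const open_UNIV)
    qed (auto simp: charts_at_real_line)
    have 1: "smooth_at real_line MG (\<lambda>t. \<gamma> (t - t0)) t0"
      by (rule smooth_at_compose[where f="\<lambda>t. t - t0" and g=\<gamma>,
            OF smooth_manifold_real_line smooth_manifold_real_line MG shift])
        (simp_all add: at0 \<gamma>(1) topspace_real_line topMG)
    have "smooth_at real_line MG (\<lambda>t. \<gamma> t0 \<otimes> \<gamma> (t - t0)) t0"
      by (rule smooth_at_compose[where f="\<lambda>t. \<gamma> (t - t0)" and g="\<lambda>x. \<gamma> t0 \<otimes> x",
            OF smooth_manifold_real_line MG MG 1 smooth_at_left_mult])
        (simp_all add: \<gamma>(1) topspace_real_line topMG)
    moreover have "(\<lambda>t. \<gamma> t0 \<otimes> \<gamma> (t - t0)) = \<gamma>"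
    proof
      show "\<gamma> t0 \<otimes> \<gamma> (t - t0) = \<gamma> t" for t using \<gamma>(2)[of t0 "t - t0"] by simp
    qed
    ultimately show ?thesis by simp
  qed
  then have "smooth_map real_line MG \<gamma>"
    using \<gamma>(1) by (intro smooth_at_imp_smooth_map smooth_manifold_real_line MG) (auto simp: topMG)
  then have "one_parameter_subgroup G MG \<gamma>"
    using \<gamma>(2) by (simp add: one_parameter_subgroup_def)
  moreover have "velocity MG \<gamma> 0 = u"
  proof
    fix c
    show "velocity MG \<gamma> 0 c = u c"
    proof (cases "c \<in> charts_at MG \<one>")
      case True
      have dx: "(x has_derivative (\<lambda>h. h *\<^sub>R u d)) (at 0)"
        using ex(4)[of 0] ex(1,2) lf_a0 by (simp add: has_vector_derivative_def)
      have dt: "((\<lambda>a. snd c (gd a)) has_derivative fd (snd c \<circ> gd) a0) (at (x 0))"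
        using fd_has_derivative[OF transition_differentiable[OF MG d True]] ex(2) by (simp add: o_def a0_def)
      have "linear (fd (snd c \<circ> gd) a0)"
        using linear_fd[OF transition_differentiable[OF MG d True]] by (simp add: o_def a0_def)
      then have "((\<lambda>t. snd c (gd (x t))) has_derivative (\<lambda>h. h *\<^sub>R u c)) (at 0)"
        using has_derivative_compose[OF dx dt] tangent_spaceD(1)[OF MG u d True]
        by (simp add: linear_scale a0_def)
      then have "((snd c \<circ> \<gamma>) has_derivative (\<lambda>h. h *\<^sub>R u c)) (at 0)"
        by (rule has_derivative_transform_within_open[of _ _ _ _ "{-e<..<e}"]) (use ex(1) \<gamma>(3) in auto)
      then show ?thesis
        using True \<gamma>0 by (simp add: velocity_def vector_derivative_at has_vector_derivative_def)
    next
      case False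
      then show ?thesis using tangent_spaceD(2)[OF MG u] \<gamma>0 by (simp add: velocity_def)
    qed
  qed
  ultimately show ?thesis
    using that[of \<gamma> e x] ex \<gamma>(3) by simp
qed

end


section \<open>Homogeneous spaces in a chart around the origin\<close>

locale coset_chart = lie_chart G MG d
  for G :: "'g monoid" (structure) and MG :: "('g, 'e::euclidean_space) manifold" and d :: "('g, 'e) chart" +
  fixes H :: "'g set" and M :: "('g set, real^'n) manifold" and c :: "('g set, real^'n) chart"
  assumes H: "subgroup H G" and coset: "coset_manifold G MG H M" and c: "c \<in> charts_at M H"
begin

lemma M: "smooth_manifold M" and topM: "topspace (mtop M) = lcosets H"
  and smooth_proj: "smooth_map MG M (coset_proj G H)"
  and submersion: "g \<in> carrier G \<Longrightarrow>
    differential MG M (coset_proj G H) g ` tangent_space MG g = tangent_space M (g <# H)"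
  using coset by (auto simp: coset_manifold_def)

lemma H_carrier: "H \<subseteq> carrier G" using H by (rule subgroup.subset)

lemma one_H: "\<one> <# H = H" using H_carrier by (rule lcos_mult_one)

lemma chart_origin: "c \<in> atlas M" "H \<in> fst c" "c \<in> charts_at M (\<one> <# H)"
  using c one_H by (auto simp: charts_at_iff)

lemma H_top: "H \<in> topspace (mtop M)"
  using chart_origin chart_openin[OF M] openin_subset by blast

lemma smooth_at_proj: "g \<in> carrier G \<Longrightarrow> smooth_at MG M (coset_proj G H) g"
  by (intro smooth_map_smooth_at MG M smooth_proj) (simp add: topMG)

definition x0 :: "real^'n" where "x0 = snd c H"

abbreviation gc :: "real^'n \<Rightarrow> 'g set" where "gc \<equiv> chart_inv c"

definition \<psi> :: "'e \<Rightarrow> real^'n" where "\<psi> a = snd c (gd a <# H)"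

definition \<Phi> :: "'e \<times> (real^'n) \<Rightarrow> real^'n" where "\<Phi> z = snd c (gd (fst z) <# gc (snd z))"

lemma gc_snd: "p \<in> fst c \<Longrightarrow> gc (snd c p) = p"
  using chart_inv_chart[OF M chart_origin(1)] .

lemma gc_x0: "gc x0 = H" unfolding x0_def using chart_origin gc_snd by simp

lemma \<psi>_a0: "\<psi> a0 = x0" by (simp add: \<psi>_def gd_a0 one_H x0_def)

lemma proj_chart:
  obtains E where "open E" "a0 \<in> E" "E \<subseteq> dom" "\<And>a. a \<in> E \<Longrightarrow> gd a <# H \<in> fst c" "smooth_on E \<psi>"
proof -
  obtain T where T: "open T" "snd d \<one> \<in> T" "\<And>x. x \<in> T \<Longrightarrow> gd x <# H \<in> fst c" "smooth_on T (\<lambda>x. snd c (gd x <# H))"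
    by (rule smooth_atD[OF smooth_at_proj[OF one_closed] d chart_origin(3)]) blast
  show ?thesis
  proof (rule that[of "T \<inter> dom"])
    show "smooth_on (T \<inter> dom) \<psi>"
      unfolding \<psi>_def[abs_def] by (rule smooth_on_subset[OF T(4)]) auto
  qed (use T dom in \<open>auto simp: a0_def\<close>)
qed

lemma \<psi>_differentiable: "\<psi> differentiable (at a0)"
  by (rule proj_chart) (use smooth_on_differentiable in blast)

lemma to_origin_component:
  assumes "u \<in> lie_algebra G MG"
  shows "to_origin G MG H M u c = fd \<psi> a0 (u d)"
proof -
  have "\<psi> = (\<lambda>x. snd c (gd x <# H))" by (simp add: \<psi>_def[abs_def])
  then show ?thesis
    using differential_component[OF MG M smooth_at_proj[OF one_closed] assms d chart_origin(3)]
    by (simp add: to_origin_def a0_def)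
qed

lemma to_origin_tangent_space: "u \<in> lie_algebra G MG \<Longrightarrow> to_origin G MG H M u \<in> tangent_space M H"
  using submersion[OF one_closed] by (auto simp: to_origin_def one_H)

lemma to_origin_surj: "w \<in> tangent_space M H \<Longrightarrow> \<exists>u\<in>lie_algebra G MG. to_origin G MG H M u = w"
  using submersion[OF one_closed] unfolding to_origin_def one_H by (metis image_iff)

lemma surj_\<psi>: "surj (fd \<psi> a0)"
proof (rule surjI)
  fix y
  have "tvec_of M H c y \<in> tangent_space M H" by (rule tvec_of_tangent_space[OF M c])
  then obtain u where u: "u \<in> lie_algebra G MG" "to_origin G MG H M u = tvec_of M H c y"
    using to_origin_surj by blast
  have "\<exists>v. fd \<psi> a0 v = y"
    using to_origin_component[OF u(1)] u(2) tvec_of_apply[OF M c, of y] by (intro exI[of _ "u d"]) simp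
  then show "fd \<psi> a0 (SOME v. fd \<psi> a0 v = y) = y" by (rule someI_ex)
qed

text \<open>A linear right inverse \<open>R\<close> of the derivative of \<open>\<psi>\<close> spans
  a slice through \<open>a0\<close> on which \<open>\<psi>\<close> has derivative \<open>id\<close>
  at the centre; the local inverse along this slice is the section.\<close>

lemma local_section:
  assumes E: "open E" "a0 \<in> E" "smooth_on E \<psi>"
  obtains V \<sigma> where "open V" "x0 \<in> V" "smooth_on V \<sigma>" "\<sigma> x0 = a0" "\<And>y. y \<in> V \<Longrightarrow> \<sigma> y \<in> E" "\<And>y. y \<in> V \<Longrightarrow> \<psi> (\<sigma> y) = y"
proof -
  obtain R where R: "linear R" "fd \<psi> a0 \<circ> R = id"
    using linear_surjective_right_inverse[OF linear_fd[OF \<psi>_differentiable] surj_\<psi>] by blast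
  then have bR: "bounded_linear R" by (simp add: linear_conv_bounded_linear)
  have shift: "smooth_on UNIV (\<lambda>z. a0 + R z)"
    by (intro smooth_on_add smooth_on_const bounded_linear_smooth_on bR open_UNIV)
  define U where "U = {z \<in> UNIV. a0 + R z \<in> E}"
  have "open U" unfolding U_def by (rule open_preimage_smooth[OF shift open_UNIV E(1)])
  have "0 \<in> U" using E(2) linear_0[OF R(1)] by (simp add: U_def)
  define f where "f z = \<psi> (a0 + R z)" for z
  have f: "smooth_on U f"
    unfolding f_def
    by (rule smooth_on_compose[OF E(3) smooth_on_subset[OF shift] \<open>open U\<close>]) (auto simp: U_def)
  have "((\<lambda>z. a0 + R z) has_derivative R) (at 0)"
    using bounded_linear_imp_has_derivative[OF bR] by (auto intro!: derivative_eq_intros)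
  then have "(f has_derivative (\<lambda>z. fd \<psi> a0 (R z))) (at 0)"
    using smooth_on_has_derivative_compose[OF E(3), of "\<lambda>z. a0 + R z" R 0] E(2) linear_0[OF R(1)]
    by (simp add: f_def[abs_def])
  then have "fd f 0 = id" using R(2) fd_eqI by (fastforce simp: o_def)
  then have "inj (fd f 0)" by simp
  then obtain V g where V: "open V" "f 0 \<in> V" "smooth_on V g" "g ` V \<subseteq> U" "\<And>y. y \<in> V \<Longrightarrow> f (g y) = y" "g (f 0) = 0"
    using smooth_local_inverse[OF f \<open>open U\<close> \<open>0 \<in> U\<close>] by blast
  have f0: "f 0 = x0" using linear_0[OF R(1)] \<psi>_a0 by (simp add: f_def)
  show ?thesis
  proof (rule that[of V "\<lambda>y. a0 + R (g y)"])
    show "smooth_on V (\<lambda>y. a0 + R (g y))"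
      by (rule smooth_on_compose[OF shift V(3,1)]) simp
  qed (use V f0 linear_0[OF R(1)] in \<open>auto simp: U_def f_def\<close>)
qed

definition action_boxes :: "'e set \<Rightarrow> (real^'n) set \<Rightarrow> bool" where
  "action_boxes A \<Omega> \<longleftrightarrow> open A \<and> open \<Omega> \<and> a0 \<in> A \<and> x0 \<in> \<Omega> \<and> A \<subseteq> dom \<and> \<Omega> \<subseteq> snd c ` fst c \<and>
     (\<forall>a\<in>A. \<forall>y\<in>\<Omega>. gd a <# gc y \<in> fst c) \<and> smooth_on (A \<times> \<Omega>) \<Phi> \<and> smooth_on A \<psi> \<and> (\<forall>a\<in>A. gd a <# H \<in> fst c)"

lemma action_boxes_exist: "\<exists>A \<Omega>. action_boxes A \<Omega>"
proof -
  obtain E where E: "open E" "a0 \<in> E" "E \<subseteq> dom" "\<And>a. a \<in> E \<Longrightarrow> gd a <# H \<in> fst c" "smooth_on E \<psi>"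
    using proj_chart by blast
  obtain V \<sigma> where V: "open V" "x0 \<in> V" "smooth_on V \<sigma>" "\<sigma> x0 = a0" "\<And>y. y \<in> V \<Longrightarrow> \<sigma> y \<in> E" "\<And>y. y \<in> V \<Longrightarrow> \<psi> (\<sigma> y) = y"
    using local_section[OF E(1,2,5)] by blast
  have gc_\<sigma>: "gc y = gd (\<sigma> y) <# H" "y \<in> snd c ` fst c" if "y \<in> V" for y
  proof -
    have "gd (\<sigma> y) <# H \<in> fst c" "snd c (gd (\<sigma> y) <# H) = y" using that V(5,6) E(4) by (auto simp: \<psi>_def)
    then show "gc y = gd (\<sigma> y) <# H" "y \<in> snd c ` fst c" using gc_snd by force+
  qed
  have o: "open (E \<times> V)" using E V by (intro open_Times)
  have 1: "smooth_on (E \<times> V) (\<lambda>z. \<mu> (fst z, \<sigma> (snd z)))"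
    by (rule smooth_on_compose[OF dom(5) smooth_on_Pair[OF smooth_on_fst[OF smooth_on_ident o] smooth_on_compose[OF V(3) smooth_on_snd[OF smooth_on_ident o] o] o] o])
      (use E(3) V(5) in auto)
  define W where "W = {z \<in> E \<times> V. \<mu> (fst z, \<sigma> (snd z)) \<in> E}"
  have "open W" unfolding W_def by (rule open_preimage_smooth[OF 1 o E(1)])
  moreover have "(a0, x0) \<in> W" using E V \<mu>_unit(1)[OF dom(2)] by (simp add: W_def)
  ultimately obtain A \<Omega> where A: "open A" "open \<Omega>" "a0 \<in> A" "x0 \<in> \<Omega>" "A \<times> \<Omega> \<subseteq> W"
    by (auto elim: open_prod_elim)
  have AE: "A \<subseteq> E" "\<Omega> \<subseteq> V" using A(3-5) by (auto simp: W_def)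
  \<comment> \<open>The coset with coordinate \<open>y\<close> is represented by
    \<open>\<sigma> y\<close>, so the action becomes \<open>\<psi>\<close> applied to a product in
    the group.\<close>
  have act: "gd a <# gc y = gd (\<mu> (a, \<sigma> y)) <# H" "\<mu> (a, \<sigma> y) \<in> E" if "a \<in> A" "y \<in> \<Omega>" for a y
  proof -
    have ay: "a \<in> dom" "\<sigma> y \<in> dom" "y \<in> V" using that AE E(3) V(5) by blast+
    then show "gd a <# gc y = gd (\<mu> (a, \<sigma> y)) <# H"
      using gd_carrier H_carrier by (simp add: gc_\<sigma> gd_\<mu> lcos_m_assoc)
    show "\<mu> (a, \<sigma> y) \<in> E" using A(5) that by (auto simp: W_def)
  qed
  have oA: "open (A \<times> \<Omega>)" using A by (intro open_Times)
  have "smooth_on (A \<times> \<Omega>) (\<lambda>z. \<psi> (\<mu> (fst z, \<sigma> (snd z))))"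
    by (rule smooth_on_compose[OF E(5) smooth_on_subset[OF 1] oA]) (use A(5) AE in \<open>auto simp: W_def\<close>)
  then have "smooth_on (A \<times> \<Omega>) \<Phi>"
    by (rule smooth_on_cong[OF _ oA]) (use act in \<open>auto simp: \<Phi>_def \<psi>_def\<close>)
  moreover have "smooth_on A \<psi>" using E(5) AE(1) by (rule smooth_on_subset)
  ultimately have "action_boxes A \<Omega>"
    unfolding action_boxes_def using A AE E act gc_\<sigma>(2) by auto
  then show ?thesis by blast
qed

definition A where "A = (SOME A. \<exists>\<Omega>. action_boxes A \<Omega>)"
definition \<Omega> where "\<Omega> = (SOME \<Omega>. action_boxes A \<Omega>)"

lemma boxes: "open A" "open \<Omega>" "a0 \<in> A" "x0 \<in> \<Omega>" "A \<subseteq> dom" "\<Omega> \<subseteq> snd c ` fst c"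
  "a \<in> A \<Longrightarrow> y \<in> \<Omega> \<Longrightarrow> gd a <# gc y \<in> fst c" "smooth_on (A \<times> \<Omega>) \<Phi>" "smooth_on A \<psi>" "a \<in> A \<Longrightarrow> gd a <# H \<in> fst c"
proof -
  have "\<exists>\<Omega>. action_boxes A \<Omega>" unfolding A_def by (rule someI_ex[OF action_boxes_exist])
  then have "action_boxes A \<Omega>" unfolding \<Omega>_def by (rule someI_ex)
  then show "open A" "open \<Omega>" "a0 \<in> A" "x0 \<in> \<Omega>" "A \<subseteq> dom" "\<Omega> \<subseteq> snd c ` fst c"
    "a \<in> A \<Longrightarrow> y \<in> \<Omega> \<Longrightarrow> gd a <# gc y \<in> fst c" "smooth_on (A \<times> \<Omega>) \<Phi>" "smooth_on A \<psi>" "a \<in> A \<Longrightarrow> gd a <# H \<in> fst c"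
    unfolding action_boxes_def by blast+
qed

lemma open_boxes: "open (A \<times> \<Omega>)" using boxes(1,2) by (rule open_Times)

lemma gc_fst: "x \<in> \<Omega> \<Longrightarrow> gc x \<in> fst c" by (rule inv_into_into) (use boxes(6) in blast)

lemma snd_gc: "x \<in> \<Omega> \<Longrightarrow> snd c (gc x) = x" by (rule f_inv_into_f) (use boxes(6) in blast)

lemma gc_carrier: "x \<in> \<Omega> \<Longrightarrow> gc x \<subseteq> carrier G"
proof -
  assume "x \<in> \<Omega>"
  then have "gc x \<in> topspace (mtop M)" using gc_fst chart_origin chart_openin[OF M] openin_subset by blast
  then obtain g where "g \<in> carrier G" "gc x = g <# H" by (auto simp: topM LCOSETS_def)
  then show ?thesis using l_coset_subset_G[OF H_carrier] by simp
qed

lemma \<Phi>_a0: "x \<in> \<Omega> \<Longrightarrow> \<Phi> (a0, x) = x"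
  by (simp add: \<Phi>_def gd_a0 lcos_mult_one gc_carrier snd_gc)

lemma \<Phi>_x0: "\<Phi> (a, x0) = \<psi> a" by (simp add: \<Phi>_def \<psi>_def gc_x0)

lemma gc_\<Phi>: "a \<in> A \<Longrightarrow> x \<in> \<Omega> \<Longrightarrow> gc (\<Phi> (a, x)) = gd a <# gc x"
  by (simp add: \<Phi>_def gc_snd boxes(7))

lemma gd_carrier': "a \<in> A \<Longrightarrow> gd a \<in> carrier G" using boxes(5) gd_carrier by blast

lemma \<Phi>_left: "a \<in> A \<Longrightarrow> x \<in> \<Omega> \<Longrightarrow> ((\<lambda>a. \<Phi> (a, x)) has_derivative (\<lambda>y. fd \<Phi> (a, x) (y, 0))) (at a)"
  by (rule smooth_on_has_derivative_compose[OF boxes(8) has_derivative_Pair[OF has_derivative_ident has_derivative_const]]) simp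

lemma \<Phi>_right: "a \<in> A \<Longrightarrow> x \<in> \<Omega> \<Longrightarrow> ((\<lambda>x. \<Phi> (a, x)) has_derivative (\<lambda>y. fd \<Phi> (a, x) (0, y))) (at x)"
  by (rule smooth_on_has_derivative_compose[OF boxes(8) has_derivative_Pair[OF has_derivative_const has_derivative_ident]]) simp

lemma fd_\<Phi>_right_a0: "x \<in> \<Omega> \<Longrightarrow> fd \<Phi> (a0, x) (0, y) = y"
proof -
  assume x: "x \<in> \<Omega>"
  have "((\<lambda>x. \<Phi> (a0, x)) has_derivative (\<lambda>y. y)) (at x)"
    by (rule has_derivative_transform_within_open[OF has_derivative_ident boxes(2) x]) (simp add: \<Phi>_a0)
  from has_derivative_unique[OF \<Phi>_right[OF boxes(3) x] this] show ?thesis by metis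
qed

text \<open>The fundamental vector field of the action generated by \<open>y\<close>.\<close>

definition kf :: "'e \<Rightarrow> real^'n \<Rightarrow> real^'n" where "kf y x = fd \<Phi> (a0, x) (y, 0)"

text \<open>The right-invariant field with value \<open>y\<close> at the unit.\<close>

definition rf :: "'e \<Rightarrow> 'e \<Rightarrow> 'e" where "rf y a = fd \<mu> (a0, a) (y, 0)"

lemma smooth_kf: "smooth_on \<Omega> (kf y)"
  unfolding kf_def
  by (rule smooth_on_fd[OF boxes(8)]) (use boxes(2,3) in \<open>auto intro!: smooth_on_Pair smooth_on_const smooth_on_ident\<close>)

lemma smooth_rf: "smooth_on dom (rf y)"
  unfolding rf_def
  by (rule smooth_on_fd[OF dom(5)]) (use dom in \<open>auto intro!: smooth_on_Pair smooth_on_const smooth_on_ident\<close>)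

lemma kf_x0: "kf y x0 = fd \<psi> a0 y"
  using fd_eqI[OF \<Phi>_left[OF boxes(3,4)]] by (simp add: kf_def \<Phi>_x0)

lemma linear_kf: "x \<in> \<Omega> \<Longrightarrow> linear (\<lambda>y. kf y x)"
  unfolding kf_def using boxes(3)
  by (intro linear_fst_slot linear_fd smooth_on_differentiable[OF boxes(8)]) auto

lemma rf_a0: "rf y a0 = y"
proof -
  have "((\<lambda>a. \<mu> (a, a0)) has_derivative (\<lambda>y. y)) (at a0)"
    by (rule has_derivative_transform_within_open[OF has_derivative_ident dom(1,2)]) (simp add: \<mu>_unit)
  from has_derivative_unique[OF fd_\<mu>_left[OF dom(2,2)] this] show ?thesis unfolding rf_def by metis
qed

text \<open>Both sides are the mixed second derivative of \<open>\<mu>\<close> at the unit.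
  Right-invariant fields therefore have the opposite bracket to left-invariant ones.\<close>

lemma fd_rf: "fd (rf y) a0 w = fd (lf w) a0 y"
proof -
  have "((\<lambda>a. fd \<mu> (a0, a) (y, 0)) has_derivative (\<lambda>w. fd (\<lambda>z. fd \<mu> z (y, 0)) (a0, a0) (0, w))) (at a0)"
    by (rule smooth_on_has_derivative_compose[OF smooth_on_fd_const[OF dom(5) open_dom2]
          has_derivative_Pair[OF has_derivative_const has_derivative_ident]]) (use dom(2) in auto)
  then have "fd (rf y) a0 w = fd (\<lambda>z. fd \<mu> z (y, 0)) (a0, a0) (0, w)"
    unfolding rf_def by (simp add: fd_eqI)
  also have "\<dots> = fd (lf w) a0 y"
    unfolding fd_lf by (rule fd_fd_commute[OF dom(5) open_dom2]) (use dom(2) in auto)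
  finally show ?thesis .
qed

text \<open>Associativity of the action, differentiated in the leftmost factor at the unit: the
  orbit map of \<open>x\<close> relates the right-invariant field to the fundamental field.\<close>

lemma kf_related:
  assumes a: "a \<in> A" and x: "x \<in> \<Omega>" and ax: "\<Phi> (a, x) \<in> \<Omega>"
  shows "kf y (\<Phi> (a, x)) = fd \<Phi> (a, x) (rf y a, 0)"
proof -
  have ad: "a \<in> dom" using a boxes(5) by blast
  have \<mu>a: "smooth_on A (\<lambda>s. \<mu> (s, a))"
    by (rule smooth_on_compose[OF dom(5)])
      (use boxes(1,5) ad in \<open>auto intro!: smooth_on_Pair smooth_on_const smooth_on_ident\<close>)
  let ?S = "{s \<in> A. \<mu> (s, a) \<in> A}"
  have S: "open ?S" by (rule open_preimage_smooth[OF \<mu>a boxes(1,1)])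
  have aS: "a0 \<in> ?S" using boxes(3) a \<mu>_unit(2)[OF ad] by simp
  have eq: "\<Phi> (s, \<Phi> (a, x)) = \<Phi> (\<mu> (s, a), x)" if "s \<in> ?S" for s
  proof -
    have "s \<in> dom" using that boxes(5) by blast
    then show ?thesis
      using gd_carrier ad gc_carrier[OF x] by (simp add: \<Phi>_def[of "(s, \<Phi> (a, x))"] \<Phi>_def[of "(\<mu> (s, a), x)"] gc_\<Phi>[OF a x] gd_\<mu> lcos_m_assoc)
  qed
  have 1: "((\<lambda>s. \<Phi> (\<mu> (s, a), x)) has_derivative (\<lambda>y. fd \<Phi> (\<mu> (a0, a), x) (fd \<mu> (a0, a) (y, 0), 0))) (at a0)"
    by (rule smooth_on_has_derivative_compose[OF boxes(8) has_derivative_Pair[OF fd_\<mu>_left[OF dom(2) ad] has_derivative_const]])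
      (use a x \<mu>_unit(2)[OF ad] in simp)
  have "((\<lambda>s. \<Phi> (s, \<Phi> (a, x))) has_derivative (\<lambda>y. fd \<Phi> (\<mu> (a0, a), x) (fd \<mu> (a0, a) (y, 0), 0))) (at a0)"
    by (rule has_derivative_transform_within_open[OF 1 S aS]) (simp add: eq)
  from has_derivative_unique[OF \<Phi>_left[OF boxes(3) ax] this]
  show ?thesis unfolding kf_def rf_def \<mu>_unit(2)[OF ad] by metis
qed

text \<open>The bracket is transported from the group by the orbit map of \<open>x\<close>. The
  reversed order on the left reflects the sign change between right- and left-invariant
  fields.\<close>

lemma kf_bracket:
  assumes x: "x \<in> \<Omega>" and u: "u \<in> lie_algebra G MG" and v: "v \<in> lie_algebra G MG"
  shows "fd (kf (u d)) x (kf (v d) x) - fd (kf (v d)) x (kf (u d) x) = kf (lie_bracket G MG u v d) x"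
proof -
  have f: "smooth_on A (\<lambda>a. \<Phi> (a, x))"
    by (rule smooth_on_compose[OF boxes(8)])
      (use boxes(1) x in \<open>auto intro!: smooth_on_Pair smooth_on_const smooth_on_ident\<close>)
  let ?S = "{a \<in> A. \<Phi> (a, x) \<in> \<Omega>}"
  have S: "open ?S" by (rule open_preimage_smooth[OF f boxes(1,2)])
  have aS: "a0 \<in> ?S" using boxes(3) x by (simp add: \<Phi>_a0)
  have fS: "smooth_on ?S (\<lambda>a. \<Phi> (a, x))" by (rule smooth_on_subset[OF f]) auto
  have dr: "rf y differentiable (at a0)" for y using smooth_on_differentiable[OF smooth_rf dom(2)] .
  have dk: "kf y differentiable (at (\<Phi> (a0, x)))" for y
    using smooth_on_differentiable[OF smooth_kf x] by (simp add: \<Phi>_a0[OF x])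
  have rel: "kf y (\<Phi> (a, x)) = fd (\<lambda>a. \<Phi> (a, x)) a (rf y a)" if "a \<in> ?S" for a y
    using that kf_related[OF _ x] fd_eqI[OF \<Phi>_left[OF _ x]] by auto
  have "fd (kf (u d)) (\<Phi> (a0, x)) (kf (v d) (\<Phi> (a0, x))) - fd (kf (v d)) (\<Phi> (a0, x)) (kf (u d) (\<Phi> (a0, x))) =
    fd (\<lambda>a. \<Phi> (a, x)) a0 (fd (rf (u d)) a0 (rf (v d) a0) - fd (rf (v d)) a0 (rf (u d) a0))"
    by (rule related_fields_bracket[OF fS S aS dr dr dk dk rel rel])
  then show ?thesis
    by (simp only: \<Phi>_a0[OF x] rf_a0 fd_rf lie_bracket_component[OF u v] fd_eqI[OF \<Phi>_left[OF boxes(3) x]] kf_def)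
qed

text \<open>The projection intertwines left multiplication by \<open>a\<close> with its action on
  cosets, so left translation carries the kernel of the derivative at the unit into the kernel at
  \<open>a\<close>.\<close>

lemma fd_\<psi>_lf:
  assumes a: "a \<in> A" and y: "fd \<psi> a0 y = 0"
  shows "fd \<psi> a (lf y a) = 0"
proof -
  have ad: "a \<in> dom" using a boxes(5) by blast
  have \<mu>a: "smooth_on A (\<lambda>b. \<mu> (a, b))"
    by (rule smooth_on_compose[OF dom(5)])
      (use boxes(1,5) ad in \<open>auto intro!: smooth_on_Pair smooth_on_const smooth_on_ident\<close>)
  let ?S = "{b \<in> A. \<mu> (a, b) \<in> A} \<inter> {b \<in> A. \<psi> b \<in> \<Omega>}"
  have S: "open ?S" by (intro open_Int open_preimage_smooth \<mu>a boxes(1,2,9))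
  have aS: "a0 \<in> ?S" using boxes(3,4) a \<mu>_unit(1)[OF ad] by (simp add: \<psi>_a0)
  have eq: "\<psi> (\<mu> (a, b)) = \<Phi> (a, \<psi> b)" if "b \<in> ?S" for b
  proof -
    have "b \<in> dom" "gc (\<psi> b) = gd b <# H" using that boxes(5) boxes(10) gc_snd by (auto simp: \<psi>_def)
    then show ?thesis
      using ad gd_carrier H_carrier by (simp add: \<psi>_def[of "\<mu> (a, b)"] \<Phi>_def gd_\<mu> lcos_m_assoc)
  qed
  have 1: "((\<lambda>b. \<psi> (\<mu> (a, b))) has_derivative (\<lambda>y. fd \<psi> (\<mu> (a, a0)) (lf y a))) (at a0)"
    unfolding lf_def
    by (rule smooth_on_has_derivative_compose[OF boxes(9) fd_\<mu>_right[OF ad dom(2)]]) (use a \<mu>_unit(1)[OF ad] in simp)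
  have 2: "((\<lambda>b. \<Phi> (a, \<psi> b)) has_derivative (\<lambda>y. fd \<Phi> (a, \<psi> a0) (0, fd \<psi> a0 y))) (at a0)"
    by (rule smooth_on_has_derivative_compose[OF boxes(8) has_derivative_Pair[OF has_derivative_const fd_has_derivative[OF \<psi>_differentiable]]])
      (use a boxes(4) in \<open>simp add: \<psi>_a0\<close>)
  have "((\<lambda>b. \<psi> (\<mu> (a, b))) has_derivative (\<lambda>y. fd \<Phi> (a, \<psi> a0) (0, fd \<psi> a0 y))) (at a0)"
    by (rule has_derivative_transform_within_open[OF 2 S aS]) (simp add: eq)
  from has_derivative_unique[OF 1 this] have "fd \<psi> (\<mu> (a, a0)) (lf y a) = fd \<Phi> (a, \<psi> a0) (0, fd \<psi> a0 y)" by metis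
  moreover have "fd \<Phi> (a, \<psi> a0) 0 = 0"
    by (rule fd_zero_at[OF smooth_on_differentiable[OF boxes(8)]]) (use a boxes(4) in \<open>simp add: \<psi>_a0\<close>)
  ultimately show ?thesis by (simp add: y \<mu>_unit(1)[OF ad] zero_prod_def)
qed

text \<open>A curve in \<open>H\<close> has constant projection, so its velocity lies in the kernel.
  Conversely, if \<open>u d\<close> lies in the kernel, the projection is constant along the
  integral curve of its left-invariant field, which therefore stays in \<open>H\<close> for small
  times; the homomorphism property extends this to all times.\<close>

lemma lie_subalgebra_of_eq_kernel:
  "lie_subalgebra_of G MG H = {u \<in> lie_algebra G MG. fd \<psi> a0 (u d) = 0}"
proof (intro equalityI subsetI)
  fix u assume "u \<in> lie_subalgebra_of G MG H"
  then obtain \<gamma> where u: "u \<in> lie_algebra G MG" and \<gamma>: "one_parameter_subgroup G MG \<gamma>" "velocity MG \<gamma> 0 = u" "\<And>t. \<gamma> t \<in> H"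
    unfolding lie_subalgebra_of_def by blast
  have car: "\<gamma> t \<in> carrier G" for t using \<gamma>(3) H_carrier by blast
  have "\<gamma> 0 \<otimes> \<gamma> 0 = \<gamma> 0" using \<gamma>(1) by (metis one_parameter_subgroup_def add.right_neutral)
  then have \<gamma>0: "\<gamma> 0 = \<one>" using car by (metis r_cancel_one')
  have "smooth_at real_line MG \<gamma> 0"
    using \<gamma>(1) by (intro smooth_map_smooth_at smooth_manifold_real_line MG)
      (auto simp: one_parameter_subgroup_def topspace_real_line)
  from smooth_atD[OF this, of "(UNIV, \<lambda>x. x)" d] obtain T where T: "open T" "0 \<in> T" "\<And>t. t \<in> T \<Longrightarrow> \<gamma> t \<in> fst d"
    "smooth_on T (\<lambda>t. snd d (\<gamma> t))"
    using d by (auto simp: charts_at_real_line \<gamma>0)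
  let ?x = "\<lambda>t. snd d (\<gamma> t)"
  have dx: "(?x has_derivative fd ?x 0) (at 0)" using smooth_on_has_derivative[OF T(4,2)] .
  have scale: "fd ?x 0 h = h *\<^sub>R fd ?x 0 1" for h
    using linear_scale[OF linear_fd[OF smooth_on_differentiable[OF T(4,2)]], of h 1] by simp
  have "(?x has_vector_derivative fd ?x 0 1) (at 0)"
    unfolding has_vector_derivative_def by (rule has_derivative_eq_rhs[OF dx], rule ext) (rule scale)
  then have ud: "u d = fd ?x 0 1"
    using \<gamma>(2) d \<gamma>0 by (auto simp: velocity_def vector_derivative_at o_def)
  have x0: "?x 0 = a0" by (simp add: \<gamma>0 a0_def)
  have 1: "((\<lambda>t. \<psi> (?x t)) has_derivative (\<lambda>h. fd \<psi> a0 (fd ?x 0 h))) (at 0)"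
    using has_derivative_compose[OF dx, of \<psi> "fd \<psi> a0"] fd_has_derivative[OF \<psi>_differentiable] x0 by simp
  have "((\<lambda>t. \<psi> (?x t)) has_derivative (\<lambda>h. 0)) (at 0)"
  proof (rule has_derivative_transform_within_open[OF has_derivative_const T(1,2)])
    show "x0 = \<psi> (?x t)" if "t \<in> T" for t
      using T(3)[OF that] \<gamma>(3) coset_join3[OF car[of t] H \<gamma>(3)] by (simp add: \<psi>_def gd_snd x0_def)
  qed
  from has_derivative_unique[OF 1 this] have "fd \<psi> a0 (u d) = 0" unfolding ud by metis
  then show "u \<in> {u \<in> lie_algebra G MG. fd \<psi> a0 (u d) = 0}" using u by simp
next
  fix u assume "u \<in> {u \<in> lie_algebra G MG. fd \<psi> a0 (u d) = 0}"
  then have u: "u \<in> lie_algebra G MG" "fd \<psi> a0 (u d) = 0" by auto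
  obtain \<gamma> e x where \<gamma>: "one_parameter_subgroup G MG \<gamma>" "velocity MG \<gamma> 0 = u" "e > 0" "x 0 = a0"
    "\<And>t. \<bar>t\<bar> < e \<Longrightarrow> x t \<in> dom" "\<And>t. \<bar>t\<bar> < e \<Longrightarrow> (x has_vector_derivative lf (u d) (x t)) (at t)"
    "\<And>t. \<bar>t\<bar> < e \<Longrightarrow> \<gamma> t = gd (x t)"
    using one_parameter_subgroup_exists[OF u(1)] by blast
  have x_smooth: "smooth_on {-e<..<e} x"
    by (rule smooth_on_integral_curve[OF smooth_lf[of "u d"]]) (use \<gamma> in auto)
  have "open {t \<in> {-e<..<e}. x t \<in> A}"
    by (rule open_preimage_smooth[OF x_smooth _ boxes(1)]) simp
  moreover have "0 \<in> {t \<in> {-e<..<e}. x t \<in> A}" using \<gamma>(3,4) boxes(3) by simp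
  ultimately obtain e' where e': "e' > 0" "ball 0 e' \<subseteq> {t \<in> {-e<..<e}. x t \<in> A}"
    using open_contains_ball by blast
  have b: "\<bar>t\<bar> < e" "x t \<in> A" if "t \<in> ball 0 e'" for t using e'(2) that by auto
  have "((\<lambda>t. \<psi> (x t)) has_derivative (\<lambda>h. 0)) (at t within ball 0 e')" if t: "t \<in> ball 0 e'" for t
  proof -
    have "(x has_derivative (\<lambda>h. h *\<^sub>R lf (u d) (x t))) (at t)"
      using \<gamma>(6)[OF b(1)[OF t]] by (simp add: has_vector_derivative_def)
    from smooth_on_has_derivative_compose[OF boxes(9) this b(2)[OF t]]
    have "((\<lambda>t. \<psi> (x t)) has_derivative (\<lambda>h. fd \<psi> (x t) (h *\<^sub>R lf (u d) (x t)))) (at t)" .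
    moreover have "fd \<psi> (x t) (h *\<^sub>R lf (u d) (x t)) = 0" for h
      using linear_scale[OF linear_fd[OF smooth_on_differentiable[OF boxes(9) b(2)[OF t]]]] fd_\<psi>_lf[OF b(2)[OF t] u(2)]
      by simp
    ultimately show ?thesis by (simp add: has_derivative_at_withinI)
  qed
  then have const: "\<psi> (x t) = x0" if "t \<in> ball 0 e'" for t
    using has_derivative_zero_unique[OF convex_ball, of 0 e' "\<lambda>t. \<psi> (x t)" t 0] that e'(1) \<gamma>(4) \<psi>_a0 by simp
  have "\<gamma> t \<in> H" if "\<bar>t\<bar> < e'" for t
  proof -
    have t: "t \<in> ball 0 e'" using that by simp
    have "snd c (gd (x t) <# H) = snd c H" using const[OF t] by (simp add: \<psi>_def x0_def)
    then have "gd (x t) <# H = H"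
      using boxes(10)[OF b(2)[OF t]] chart_origin(2) inj_onD[OF chart_inj[OF M chart_origin(1)]] by blast
    then have "gd (x t) \<in> H"
      using lcos_self[OF gd_carrier'[OF b(2)[OF t]] H] by simp
    then show ?thesis using \<gamma>(7)[OF b(1)[OF t]] by simp
  qed
  then have "\<gamma> t \<in> H" for t
    using real_hom_in_subgroup[of \<gamma> H e'] \<gamma>(1) H e'(1) by (simp add: one_parameter_subgroup_def)
  then show "u \<in> lie_subalgebra_of G MG H"
    using \<gamma>(1,2) u(1) by (auto simp: lie_subalgebra_of_def)
qed

end


section \<open>Invariant Finsler metrics\<close>

lemma inner_product_on_simps:
  assumes "subspace V" "inner_product_on V B" "x \<in> V" "y \<in> V" "z \<in> V"
  shows "B (x + y) z = B x z + B y z" "B (a *\<^sub>R x) z = a * B x z" "B x y = B y x"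
    "B z (x + y) = B z x + B z y" "B z (a *\<^sub>R x) = a * B z x" "B z (x - y) = B z x - B z y"
proof -
  have lin: "B (a *\<^sub>R x + b *\<^sub>R y) z = a * B x z + b * B y z" if "x \<in> V" "y \<in> V" "z \<in> V" for x y z a b
    using assms(2)[unfolded inner_product_on_def, THEN conjunct2, THEN conjunct1] that by blast
  have sym: "B x y = B y x" if "x \<in> V" "y \<in> V" for x y
    using assms(2)[unfolded inner_product_on_def, THEN conjunct1] that by blast
  have V: "x + y \<in> V" "a *\<^sub>R x \<in> V" "x - y \<in> V"
    by (intro subspace_add subspace_scale subspace_diff assms)+
  show 1: "B (x + y) z = B x z + B y z" using lin[OF assms(3-5), of 1 1] by simp
  show 2: "B (a *\<^sub>R x) z = a * B x z" using lin[OF assms(3,3,5), of a 0] by simp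
  show "B x y = B y x" by (rule sym[OF assms(3,4)])
  show "B z (x + y) = B z x + B z y" "B z (a *\<^sub>R x) = a * B z x"
    using 1 2 sym[OF assms(5) V(1)] sym[OF assms(5) V(2)] sym[OF assms(5,3)] sym[OF assms(5,4)] by simp_all
  show "B z (x - y) = B z x - B z y"
    using lin[OF assms(3-5), of 1 "-1"] sym[OF assms(5) V(3)] sym[OF assms(5,3)] sym[OF assms(5,4)] by simp
qed

text \<open>Gram-Schmidt by induction on a finite spanning set, for an arbitrary inner product that
  is controlled on \<open>V\<close> only.\<close>

lemma inner_product_on_projection:
  assumes V: "subspace V" and B: "inner_product_on V B" and "finite S" "S \<subseteq> V" "x \<in> V"
  shows "\<exists>p\<in>span S. \<forall>s\<in>span S. B s (x - p) = 0"
  using assms(3-5)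
proof (induction S arbitrary: x)
  case empty
  have "B 0 x = 0" using inner_product_on_simps(2)[OF V B empty(2) empty(2) empty(2), of 0] by simp
  then show ?case by simp
next
  case (insert b S)
  have spanV: "span S \<subseteq> V" using insert.prems(1) V by (intro span_minimal) auto
  have bV: "b \<in> V" using insert.prems by simp
  obtain q where q: "q \<in> span S" "\<And>s. s \<in> span S \<Longrightarrow> B s (b - q) = 0"
    using insert.IH[of b] insert.prems by blast
  obtain p where p: "p \<in> span S" "\<And>s. s \<in> span S \<Longrightarrow> B s (x - p) = 0"
    using insert.IH[of x] insert.prems by blast
  let ?e = "b - q"
  show ?case
  proof (cases "?e = 0")
    case True
    then have "span (insert b S) = span S" using q(1) by (simp add: span_redundant)
    then show ?thesis using p by auto
  next
    case False
    have eV: "?e \<in> V" "x - p \<in> V" using q p spanV bV insert.prems(2) V by (blast intro: subspace_diff)+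
    \<comment> \<open>\<open>b - q\<close> is the part of the new vector orthogonal to the span of
      \<open>S\<close>, and \<open>k\<close> is the Fourier coefficient of \<open>x - p\<close>
      along it.\<close>
    define k where "k = B ?e (x - p) / B ?e ?e"
    have pos: "B ?e ?e > 0" using B eV(1) False unfolding inner_product_on_def by blast
    have keV: "k *\<^sub>R ?e \<in> V" using eV V subspace_scale by blast
    note simps = inner_product_on_simps[OF V B]
    have eq: "x - (p + k *\<^sub>R ?e) = (x - p) - k *\<^sub>R ?e" by simp
    have s0: "B s (x - (p + k *\<^sub>R ?e)) = 0" if "s \<in> span S" for s
      unfolding eq using simps(6)[OF eV(2) keV, of s] simps(5)[OF eV(1,1), of s k] that spanV p(2)[OF that] q(2)[OF that] by auto
    have e0: "B ?e (x - (p + k *\<^sub>R ?e)) = 0"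
      unfolding eq using simps(6)[OF eV(2) keV eV(1)] simps(5)[OF eV(1,1,1), of k] pos by (simp add: k_def)
    have w: "x - (p + k *\<^sub>R ?e) \<in> V" unfolding eq using eV keV V subspace_diff by blast
    show ?thesis
    proof (rule bexI[of _ "p + k *\<^sub>R ?e"], rule ballI)
      have "b \<in> span (insert b S)" "q \<in> span (insert b S)" "p \<in> span (insert b S)"
        using q p span_mono[of S "insert b S"] by (auto intro: span_base)
      then show "p + k *\<^sub>R ?e \<in> span (insert b S)"
        by (intro span_add span_scale span_diff)
      fix s assume "s \<in> span (insert b S)"
      then obtain j where j: "s - j *\<^sub>R b \<in> span S" by (auto simp: span_insert)
      then have j': "s - j *\<^sub>R ?e \<in> span S"
        using span_add[OF j span_scale[OF q(1), of j]] by (simp add: algebra_simps)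
      have jV: "j *\<^sub>R ?e \<in> V" using eV V subspace_scale by blast
      have "B ((s - j *\<^sub>R ?e) + j *\<^sub>R ?e) (x - (p + k *\<^sub>R ?e)) = 0"
        using simps(1)[OF _ jV w, of "s - j *\<^sub>R ?e"] simps(2)[OF eV(1,1) w, of j] s0[OF j'] e0 j' spanV by auto
      then show "B s (x - (p + k *\<^sub>R ?e)) = 0" by simp
    qed
  qed
qed

lemma fund_tensor_eq_fd:
  fixes f :: "'a::euclidean_space \<times> 'b::euclidean_space \<Rightarrow> real"
  assumes f: "smooth_on S (\<lambda>z. (f z)\<^sup>2)" and "open S" "(x, y) \<in> S"
  shows "fund_tensor (\<lambda>y. f (x, y)) y v w = 1/2 * fd (\<lambda>z. fd (\<lambda>z. (f z)\<^sup>2) z (0, w)) (x, y) (0, v)"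
proof -
  let ?L = "\<lambda>z. (f z)\<^sup>2"
  have L1: "smooth_on S (\<lambda>z. fd ?L z (0, w))" using f \<open>open S\<close> by (rule smooth_on_fd_const)
  have inner: "deriv (\<lambda>t. (f (x, y + s *\<^sub>R v + t *\<^sub>R w))\<^sup>2) 0 = fd ?L (x, y + s *\<^sub>R v) (0, w)"
    if "(x, y + s *\<^sub>R v) \<in> S" for s
    using deriv_line[OF smooth_on_differentiable[OF f that], of "(0, w)"] by simp
  have "continuous_on UNIV (\<lambda>s. (x, y + s *\<^sub>R v))" by (intro continuous_intros)
  then have "open ((\<lambda>s. (x, y + s *\<^sub>R v)) -` S)"
    \<comment> \<open>The inner derivative is identified only for \<open>s\<close> near 0, which
      suffices for the outer one.\<close>
    using \<open>open S\<close> open_vimage by blast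
  then have "\<forall>\<^sub>F s in nhds 0. s \<in> (\<lambda>s. (x, y + s *\<^sub>R v)) -` S"
    by (rule eventually_nhds_in_open) (use assms(3) in simp)
  then have "\<forall>\<^sub>F s in nhds 0. (x, y + s *\<^sub>R v) \<in> S" by (simp only: vimage_eq)
  then have "\<forall>\<^sub>F s in nhds 0. deriv (\<lambda>t. (f (x, y + s *\<^sub>R v + t *\<^sub>R w))\<^sup>2) 0 = fd ?L (x, y + s *\<^sub>R v) (0, w)"
    by (rule eventually_mono) (rule inner)
  then have "deriv (\<lambda>s. deriv (\<lambda>t. (f (x, y + s *\<^sub>R v + t *\<^sub>R w))\<^sup>2) 0) 0 = deriv (\<lambda>s. fd ?L (x, y + s *\<^sub>R v) (0, w)) 0"
    by (rule deriv_cong_ev) simp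
  also have "\<dots> = fd (\<lambda>z. fd ?L z (0, w)) (x, y) (0, v)"
    using deriv_line[OF smooth_on_differentiable[OF L1 assms(3)], of "(0, v)"] by simp
  finally show ?thesis by (simp add: fund_tensor_def)
qed

locale finsler_chart = coset_chart G MG d H M c
  for G :: "'g monoid" (structure) and MG :: "('g, 'e::euclidean_space) manifold" and d :: "('g, 'e) chart"
    and H :: "'g set" and M :: "('g set, real^'n) manifold" and c :: "('g set, real^'n) chart" +
  fixes F :: "'g set \<Rightarrow> ('g set, real^'n) tvec \<Rightarrow> real"
  assumes finsler: "finsler_metric M F" and invariant: "invariant_metric G M F"
begin

definition L :: "(real^'n) \<times> (real^'n) \<Rightarrow> real" where "L z = (in_chart M F c z)\<^sup>2"

abbreviation "slit \<equiv> \<Omega> \<times> (UNIV - {0 :: real^'n})"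

lemma open_slit: "open slit"
  using boxes(2) by (intro open_Times) (auto intro: open_delete)

lemma smooth_on_L: "smooth_on slit L"
proof -
  have "smooth_on ((snd c ` fst c) \<times> (UNIV - {0})) (in_chart M F c)"
    using finsler chart_origin unfolding finsler_metric_def by blast
  then have "smooth_on slit (in_chart M F c)"
    by (rule smooth_on_subset) (use boxes(6) in auto)
  from smooth_on_mult[OF this this open_slit] show ?thesis by (simp add: L_def[abs_def] power2_eq_square)
qed

lemma minkowski: "x \<in> \<Omega> \<Longrightarrow> minkowski_norm (\<lambda>y. in_chart M F c (x, y))"
  using finsler chart_origin boxes(6) unfolding finsler_metric_def by blast

lemma fund_tensor_in_chart:
  assumes "(x, y) \<in> slit"
  shows "fund_tensor (\<lambda>y. in_chart M F c (x, y)) y v w = 1/2 * fd (\<lambda>z. fd L z (0, w)) (x, y) (0, v)"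
  using fund_tensor_eq_fd[of slit "in_chart M F c" x y v w] smooth_on_L open_slit assms by (simp add: L_def[abs_def])

sublocale spray \<Omega> L "spray_vec L"
proof (rule spray_spray_vec[OF boxes(2) smooth_on_L])
  fix z w assume z: "z \<in> slit" and w: "w \<noteq> (0 :: real^'n)"
  obtain x y where xy: "z = (x, y)" "x \<in> \<Omega>" "y \<noteq> 0" using z by auto
  have "fund_tensor (\<lambda>y. in_chart M F c (x, y)) y w w > 0"
    using minkowski[OF xy(2)] xy(3) w unfolding minkowski_norm_def by blast
  then show "fd (\<lambda>z. fd L z (0, w)) z (0, w) > 0"
    using fund_tensor_in_chart[of x y w w] z xy(1) by simp
next
  fix x y :: "real^'n" and a :: real assume "x \<in> \<Omega>" "a > 0"
  then have "in_chart M F c (x, a *\<^sub>R y) = a * in_chart M F c (x, y)"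
    using minkowski[of x] unfolding minkowski_norm_def by auto
  then show "L (x, a *\<^sub>R y) = a\<^sup>2 * L (x, y)" by (simp add: L_def power_mult_distrib)
qed

text \<open>In the chart, translation by \<open>gd a\<close> is \<open>\<Phi>\<close> with first
  argument \<open>a\<close>, so its differential is the partial derivative in the second
  slot.\<close>

lemma L_invariant:
  assumes a: "a \<in> A" and x: "x \<in> \<Omega>"
  shows "L (\<Phi> (a, x), fd \<Phi> (a, x) (0, y)) = L (x, y)"
proof -
  let ?g = "gd a" and ?p = "gc x"
  let ?f = "\<lambda>q. ?g <# q"
  have p: "c \<in> charts_at M ?p" and q: "c \<in> charts_at M (?g <# ?p)"
    using gc_fst[OF x] boxes(7)[OF a x] chart_origin by (auto simp: charts_at_iff)
  have top: "?p \<in> topspace (mtop M)" using p chart_openin[OF M] openin_subset unfolding charts_at_iff by blast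
  have \<Phi>f: "smooth_on \<Omega> (\<lambda>x. snd c (?g <# gc x))"
  proof (rule smooth_on_cong)
    show "smooth_on \<Omega> (\<lambda>x. \<Phi> (a, x))"
      by (rule smooth_on_compose[OF boxes(8)])
        (use boxes(2) a in \<open>auto intro!: smooth_on_Pair smooth_on_const smooth_on_ident\<close>)
  qed (auto simp: \<Phi>_def boxes(2))
  have sm: "smooth_at M M ?f ?p"
    by (rule smooth_atI[where f="?f" and T=\<Omega>, OF M M p q])
      (use boxes(2,6,7) a x \<Phi>f snd_gc in auto)
  have t: "tvec_of M ?p c y \<in> tangent_space M ?p" by (rule tvec_of_tangent_space[OF M p])
  have "(\<lambda>x. snd c (?g <# gc x)) = (\<lambda>x. \<Phi> (a, x))" by (simp add: \<Phi>_def)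
  then have "differential M M ?f ?p (tvec_of M ?p c y) c = fd \<Phi> (a, x) (0, y)"
    using differential_component[OF M M sm t p q] tvec_of_apply[OF M p] snd_gc[OF x] fd_eqI[OF \<Phi>_right[OF a x]]
    by simp
  then have "differential M M ?f ?p (tvec_of M ?p c y) = tvec_of M (?g <# ?p) c (fd \<Phi> (a, x) (0, y))"
    by (intro tangent_space_eqI[OF M differential_tangent_space[OF M M sm t top] tvec_of_tangent_space[OF M q] q])
      (simp add: tvec_of_apply[OF M q])
  moreover have "F (?g <# ?p) (differential M M ?f ?p (tvec_of M ?p c y)) = F ?p (tvec_of M ?p c y)"
    using invariant gd_carrier'[OF a] top t unfolding invariant_metric_def by blast
  ultimately show ?thesis
    by (simp add: L_def in_chart_def gc_\<Phi>[OF a x])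
qed

text \<open>\<open>L_invariant\<close> is differentiated in \<open>a\<close> at the unit. The fibre
  component of the resulting direction is a mixed derivative of \<open>\<Phi>\<close>, which by
  symmetry is the derivative of the fundamental field along \<open>w\<close>.\<close>

lemma killing_kf: "killing (kf y)"
  unfolding killing_def
proof (intro conjI ballI smooth_kf)
  fix z assume z: "z \<in> S"
  obtain x w where xw: "z = (x, w)" "x \<in> \<Omega>" "w \<noteq> 0" using z by auto
  have a: "(a0, x) \<in> A \<times> \<Omega>" using boxes(3) xw by simp
  have \<Phi>w: "smooth_on (A \<times> \<Omega>) (\<lambda>z. fd \<Phi> z (0, w))" by (rule smooth_on_fd_const[OF boxes(8) open_boxes])
  have 1: "((\<lambda>a. fd \<Phi> (a, x) (0, w)) has_derivative (\<lambda>h. fd (\<lambda>z. fd \<Phi> z (0, w)) (a0, x) (h, 0))) (at a0)"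
    by (rule smooth_on_has_derivative_compose[OF \<Phi>w has_derivative_Pair[OF has_derivative_ident has_derivative_const]]) (rule a)
  have 2: "((\<lambda>a. L (\<Phi> (a, x), fd \<Phi> (a, x) (0, w))) has_derivative
     (\<lambda>h. fd L (\<Phi> (a0, x), fd \<Phi> (a0, x) (0, w)) (fd \<Phi> (a0, x) (h, 0), fd (\<lambda>z. fd \<Phi> z (0, w)) (a0, x) (h, 0)))) (at a0)"
    by (rule smooth_on_has_derivative_compose[OF smooth_L has_derivative_Pair[OF \<Phi>_left[OF boxes(3) xw(2)] 1]])
      (use xw in \<open>simp add: \<Phi>_a0 fd_\<Phi>_right_a0\<close>)
  have "((\<lambda>a. L (\<Phi> (a, x), fd \<Phi> (a, x) (0, w))) has_derivative (\<lambda>h. 0)) (at a0)"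
    by (rule has_derivative_transform_within_open[OF has_derivative_const boxes(1,3)]) (simp add: L_invariant xw(2))
  from has_derivative_unique[OF 2 this]
  have "fd L (x, w) (kf y x, fd (\<lambda>z. fd \<Phi> z (0, w)) (a0, x) (y, 0)) = 0"
    unfolding \<Phi>_a0[OF xw(2)] fd_\<Phi>_right_a0[OF xw(2)] kf_def by metis
  moreover have "fd (\<lambda>z. fd \<Phi> z (0, w)) (a0, x) (y, 0) = fd (kf y) x w"
  proof -
    have "((\<lambda>x. fd \<Phi> (a0, x) (y, 0)) has_derivative (\<lambda>h. fd (\<lambda>z. fd \<Phi> z (y, 0)) (a0, x) (0, h))) (at x)"
      by (rule smooth_on_has_derivative_compose[OF smooth_on_fd_const[OF boxes(8) open_boxes]
          has_derivative_Pair[OF has_derivative_const has_derivative_ident]]) (rule a)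
    then have "fd (kf y) x w = fd (\<lambda>z. fd \<Phi> z (y, 0)) (a0, x) (0, w)"
      unfolding kf_def by (simp add: fd_eqI)
    then show ?thesis using fd_fd_commute[OF boxes(8) open_boxes a] by simp
  qed
  ultimately show "fd L z (complete_lift (kf y) z) = 0"
    by (simp add: xw complete_lift_Pair)
qed

lemma F_origin: "w \<in> tangent_space M H \<Longrightarrow> F H w = in_chart M F c (x0, w c)"
  using tvec_of_component[OF M _ c] by (simp add: in_chart_def gc_x0)

lemma fund_tensor_origin:
  assumes "y \<in> tangent_space M H" "v \<in> tangent_space M H" "w \<in> tangent_space M H" "y c \<noteq> 0"
  shows "fund_tensor (F H) y v w = 1/2 * vert (x0, y c) (v c) (w c)"
proof -
  have sub: "subspace (tangent_space M H)" by (rule subspace_tangent_space[OF M H_top])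
  have "F H (y + s *\<^sub>R v + t *\<^sub>R w) = in_chart M F c (x0, y c + s *\<^sub>R v c + t *\<^sub>R w c)" for s t
  proof -
    have "y + s *\<^sub>R v + t *\<^sub>R w \<in> tangent_space M H"
      using assms(1-3) sub by (intro subspace_add subspace_scale)
    then show ?thesis by (simp add: F_origin scaleR_fun_def)
  qed
  then have "fund_tensor (F H) y v w = fund_tensor (\<lambda>y. in_chart M F c (x0, y)) (y c) (v c) (w c)"
    by (simp add: fund_tensor_def)
  then show ?thesis
    using fund_tensor_in_chart[of x0 "y c"] boxes(4) assms(4) by simp
qed

end

section \<open>The complement as a model of the tangent space at the origin\<close>

context coset_chart
begin

text \<open>On the Lie algebra this is the component of \<open>to_origin\<close> in the chart
  \<open>c\<close>. As it reads only the component \<open>w d\<close>, it is linear on all families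
  of components, which spares membership conditions.\<close>

definition \<iota> :: "('g, 'e) tvec \<Rightarrow> real^'n" where "\<iota> w = fd \<psi> a0 (w d)"

lemma linear_\<iota>: "linear \<iota>"
proof (rule linearI)
  have lin: "linear (fd \<psi> a0)" by (rule linear_fd[OF \<psi>_differentiable])
  show "\<iota> (v + w) = \<iota> v + \<iota> w" for v w
    by (simp add: \<iota>_def linear_add[OF lin])
  show "\<iota> (a *\<^sub>R v) = a *\<^sub>R \<iota> v" for a v
    by (simp add: \<iota>_def scaleR_fun_def linear_scale[OF lin])
qed

lemma to_origin_\<iota>: "u \<in> lie_algebra G MG \<Longrightarrow> to_origin G MG H M u c = \<iota> u"
  by (simp add: to_origin_component \<iota>_def)

lemma subspace_lie_algebra: "subspace (lie_algebra G MG)"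
  by (rule subspace_tangent_space[OF MG one_carrier_top])

lemma linear_tvec_of_one: "linear (tvec_of MG \<one> d)"
proof -
  have lin: "linear (fd (snd e \<circ> gd) (snd d \<one>))" if "e \<in> charts_at MG \<one>" for e
    using linear_fd[OF transition_differentiable[OF MG d that]] by (simp add: o_def)
  show ?thesis
    by (rule linearI; rule ext) (simp_all add: tvec_of_def linear_add[OF lin] linear_scale[OF lin] scaleR_fun_def)
qed

lemma lie_subalgebra_of_iff: "u \<in> lie_subalgebra_of G MG H \<longleftrightarrow> u \<in> lie_algebra G MG \<and> \<iota> u = 0"
  by (simp add: lie_subalgebra_of_eq_kernel \<iota>_def)

text \<open>Finite dimensionality, needed for orthogonal projection: the kernel is spanned in
  coordinates and the spanning set is carried over by \<open>tvec_of\<close>.\<close>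

lemma lie_subalgebra_of_span:
  obtains S where "finite S" "span S = lie_subalgebra_of G MG H"
proof -
  have "subspace {y. fd \<psi> a0 y = 0}"
    by (rule linear_subspace_kernel[OF linear_fd[OF \<psi>_differentiable]])
  then obtain S0 where S0: "finite S0" "span S0 = {y. fd \<psi> a0 y = 0}"
    using basis_subspace_exists by metis
  let ?T = "tvec_of MG \<one> d"
  have "lie_subalgebra_of G MG H = ?T ` {y. fd \<psi> a0 y = 0}"
  proof (intro equalityI subsetI)
    fix u assume "u \<in> lie_subalgebra_of G MG H"
    then have u: "u \<in> lie_algebra G MG" "fd \<psi> a0 (u d) = 0" by (auto simp: lie_subalgebra_of_eq_kernel)
    then show "u \<in> ?T ` {y. fd \<psi> a0 y = 0}"
      using tvec_of_component[OF MG u(1) d] by (intro image_eqI[of _ _ "u d"]) auto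
  next
    fix u assume "u \<in> ?T ` {y. fd \<psi> a0 y = 0}"
    then show "u \<in> lie_subalgebra_of G MG H"
      using tvec_of_tangent_space[OF MG d] tvec_of_apply[OF MG d] by (auto simp: lie_subalgebra_of_eq_kernel)
  qed
  then have "span (?T ` S0) = lie_subalgebra_of G MG H"
    using linear_span_image[OF linear_tvec_of_one, of S0] S0(2) by simp
  then show ?thesis using that[of "?T ` S0"] S0(1) by simp
qed

context
  fixes \<mm> assumes dec: "invariant_decomposition G MG H \<mm>"
begin

lemma complement_subset: "w \<in> \<mm> \<Longrightarrow> w \<in> lie_algebra G MG"
  using dec unfolding invariant_decomposition_def by blast

text \<open>The difference of the two vectors lies in the subalgebra and is orthogonal to
  it.\<close>

lemma \<iota>_inj:
  assumes "w \<in> \<mm>" "w' \<in> \<mm>" "\<iota> w = \<iota> w'" shows "w = w'"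
proof -
  obtain B where B: "inner_product_on (lie_algebra G MG) B"
    "\<mm> = {w \<in> lie_algebra G MG. \<forall>x\<in>lie_subalgebra_of G MG H. B x w = 0}"
    using dec unfolding invariant_decomposition_def by blast
  have g: "w \<in> lie_algebra G MG" "w' \<in> lie_algebra G MG" using assms complement_subset by blast+
  have "w - w' \<in> lie_subalgebra_of G MG H"
    using g subspace_diff[OF subspace_lie_algebra] linear_diff[OF linear_\<iota>] assms(3)
    by (simp add: lie_subalgebra_of_iff)
  moreover from this have "w - w' \<in> lie_algebra G MG" by (simp add: lie_subalgebra_of_iff)
  ultimately have "B (w - w') (w - w') = 0"
    using inner_product_on_simps(6)[OF subspace_lie_algebra B(1) g, of "w - w'"] assms(1,2) B(2) by auto
  then have "\<not> (w - w' \<noteq> 0)"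
    using B(1)[unfolded inner_product_on_def, THEN conjunct2, THEN conjunct2] \<open>w - w' \<in> lie_algebra G MG\<close>
    by (metis less_irrefl)
  then show ?thesis by simp
qed

lemma decomposition_exists:
  assumes x: "x \<in> lie_algebra G MG"
  shows "\<exists>w. w \<in> \<mm> \<and> x - w \<in> lie_subalgebra_of G MG H"
proof -
  obtain B where B: "inner_product_on (lie_algebra G MG) B"
    "\<mm> = {w \<in> lie_algebra G MG. \<forall>x\<in>lie_subalgebra_of G MG H. B x w = 0}"
    using dec unfolding invariant_decomposition_def by blast
  obtain S where S: "finite S" "span S = lie_subalgebra_of G MG H" by (rule lie_subalgebra_of_span)
  have "S \<subseteq> lie_algebra G MG"
    using span_superset[of S] S(2) by (auto simp: lie_subalgebra_of_iff)
  from inner_product_on_projection[OF subspace_lie_algebra B(1) S(1) this x]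
  obtain p where p: "p \<in> lie_subalgebra_of G MG H" "\<And>s. s \<in> lie_subalgebra_of G MG H \<Longrightarrow> B s (x - p) = 0"
    unfolding S(2) by blast
  then have "x - p \<in> lie_algebra G MG"
    using subspace_diff[OF subspace_lie_algebra x] by (simp add: lie_subalgebra_of_iff)
  then have "x - p \<in> \<mm>" using p(2) B(2) by blast
  then show ?thesis using p(1) by (intro exI[of _ "x - p"]) simp
qed

lemma \<iota>_eq: "x \<in> lie_algebra G MG \<Longrightarrow> x - w \<in> lie_subalgebra_of G MG H \<Longrightarrow> \<iota> w = \<iota> x"
  using linear_diff[OF linear_\<iota>, of x w] by (simp add: lie_subalgebra_of_iff)

lemma \<iota>_surj: "\<exists>w\<in>\<mm>. \<iota> w = y"
proof -
  obtain e where e: "y = fd \<psi> a0 e" using surj_\<psi> by (metis surjD)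
  let ?u = "tvec_of MG \<one> d e"
  have u: "?u \<in> lie_algebra G MG" "\<iota> ?u = y"
    using tvec_of_tangent_space[OF MG d] tvec_of_apply[OF MG d] e by (auto simp: \<iota>_def)
  then show ?thesis using decomposition_exists[OF u(1)] \<iota>_eq[OF u(1)] by auto
qed

text \<open>Orthogonal projection gives existence and \<open>\<iota>_inj\<close> uniqueness, so the
  definite description in \<open>proj_along\<close> denotes a vector.\<close>

lemma bracket_m:
  assumes "u \<in> \<mm>" "v \<in> \<mm>"
  shows "bracket_m G MG H \<mm> u v \<in> \<mm>" "\<iota> (bracket_m G MG H \<mm> u v) = \<iota> (lie_bracket G MG u v)"
proof -
  let ?x = "lie_bracket G MG u v"
  have x: "?x \<in> lie_algebra G MG"
    by (intro lie_bracket_lie_algebra complement_subset assms)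
  obtain w where w: "w \<in> \<mm>" "?x - w \<in> lie_subalgebra_of G MG H" using decomposition_exists[OF x] by blast
  have "proj_along (lie_subalgebra_of G MG H) \<mm> ?x = w"
    unfolding proj_along_def
  proof (rule the_equality)
    show "w \<in> \<mm> \<and> ?x - w \<in> lie_subalgebra_of G MG H" using w by simp
    show "w' = w" if "w' \<in> \<mm> \<and> ?x - w' \<in> lie_subalgebra_of G MG H" for w'
      using that w \<iota>_eq[OF x] by (intro \<iota>_inj) auto
  qed
  then show "bracket_m G MG H \<mm> u v \<in> \<mm>" "\<iota> (bracket_m G MG H \<mm> u v) = \<iota> ?x"
    using w \<iota>_eq[OF x] by (simp_all add: bracket_m_def)
qed

lemma kf_bracket_m:
  assumes "u \<in> \<mm>" "v \<in> \<mm>"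
  shows "fd (kf (u d)) x0 (\<iota> v) - fd (kf (v d)) x0 (\<iota> u) = \<iota> (bracket_m G MG H \<mm> u v)"
  using kf_bracket[OF boxes(4) complement_subset[OF assms(1)] complement_subset[OF assms(2)]] bracket_m(2)[OF assms]
  by (simp add: kf_x0 \<iota>_def)

end

end

section \<open>The geodesic equation and the covariant derivative in terms of the Lie
  algebra\<close>

context finsler_chart
begin

abbreviation "N \<equiv> norm_m G MG H M F"

lemma fund_tensor_N:
  assumes "u \<in> lie_algebra G MG" "a \<in> lie_algebra G MG" "b \<in> lie_algebra G MG" "\<iota> u \<noteq> 0"
  shows "fund_tensor N u a b = 1/2 * vert (x0, \<iota> u) (\<iota> a) (\<iota> b)"
proof -
  have "N (u + s *\<^sub>R a + t *\<^sub>R b) = in_chart M F c (x0, \<iota> u + s *\<^sub>R \<iota> a + t *\<^sub>R \<iota> b)" for s t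
  proof -
    have "u + s *\<^sub>R a + t *\<^sub>R b \<in> lie_algebra G MG"
      using assms by (intro subspace_add subspace_scale subspace_lie_algebra)
    then show ?thesis
      by (simp add: norm_m_def F_origin to_origin_tangent_space to_origin_\<iota> linear_add[OF linear_\<iota>] linear_scale[OF linear_\<iota>])
  qed
  then have "fund_tensor N u a b = fund_tensor (\<lambda>y. in_chart M F c (x0, y)) (\<iota> u) (\<iota> a) (\<iota> b)"
    by (simp add: fund_tensor_def)
  then show ?thesis
    using fund_tensor_in_chart[of x0 "\<iota> u"] boxes(4) assms(4) by simp
qed

lemma fund_tensor_to_origin:
  assumes "u \<in> lie_algebra G MG" "a \<in> lie_algebra G MG" "b \<in> lie_algebra G MG" "\<iota> u \<noteq> 0"
  shows "fund_tensor (F H) (to_origin G MG H M u) (to_origin G MG H M a) (to_origin G MG H M b) = fund_tensor N u a b"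
  using assms by (simp add: fund_tensor_N fund_tensor_origin to_origin_tangent_space to_origin_\<iota>)

context
  fixes \<mm> u
  assumes dec: "invariant_decomposition G MG H \<mm>" and u: "u \<in> \<mm>" "u \<noteq> 0"
    and geo: "\<And>w. w \<in> \<mm> \<Longrightarrow> fund_tensor N u (bracket_m G MG H \<mm> u w) u = 0"
begin

text \<open>This places the reference vector off the zero section, where \<open>L\<close> is
  smooth.\<close>

lemma \<iota>_u: "\<iota> u \<noteq> 0"
proof
  assume "\<iota> u = 0"
  moreover have "0 \<in> \<mm>"
  proof -
    obtain B where B: "inner_product_on (lie_algebra G MG) B"
      "\<mm> = {w \<in> lie_algebra G MG. \<forall>x\<in>lie_subalgebra_of G MG H. B x w = 0}"
      using dec unfolding invariant_decomposition_def by blast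
    have "B x 0 = 0" if "x \<in> lie_algebra G MG" for x
      using inner_product_on_simps(5)[OF subspace_lie_algebra B(1) that that that, of 0] by simp
    then show ?thesis using B(2) subspace_0[OF subspace_lie_algebra] by (auto simp: lie_subalgebra_of_iff)
  qed
  ultimately show False using \<iota>_inj[OF dec u(1), of 0] u(2) linear_0[OF linear_\<iota>] by simp
qed

lemma base_point: "(x0, \<iota> u) \<in> S"
  using \<iota>_u boxes(4) by simp

lemma fund_tensor_m:
  "a \<in> \<mm> \<Longrightarrow> b \<in> \<mm> \<Longrightarrow> fund_tensor N u a b = 1/2 * vert (x0, \<iota> u) (\<iota> a) (\<iota> b)"
  using fund_tensor_N complement_subset[OF dec] u(1) \<iota>_u by blast

lemma fund_tensor_m_eqI:
  assumes "a \<in> \<mm>" "b \<in> \<mm>" "\<And>w. w \<in> \<mm> \<Longrightarrow> fund_tensor N u a w = fund_tensor N u b w"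
  shows "a = b"
proof (rule \<iota>_inj[OF dec assms(1,2)], rule vert_eqI[OF base_point])
  fix w obtain w' where "w' \<in> \<mm>" "\<iota> w' = w" using \<iota>_surj[OF dec] by blast
  then show "vert (x0, \<iota> u) (\<iota> a) w = vert (x0, \<iota> u) (\<iota> b) w"
    using assms(3)[of w'] assms(1,2) by (simp add: fund_tensor_m)
qed

lemma kf_\<iota>: "kf (w d) x0 = \<iota> w"
  by (simp add: kf_x0 \<iota>_def)

text \<open>By Euler's identity, pairing with the reference vector is the vertical derivative of
  \<open>L\<close>. The hypothesis on \<open>u\<close> thus says that this derivative vanishes along
  the projected brackets, which are the brackets of the fundamental fields at the origin up to
  sign.\<close>

lemma geodesic_m: "2 *\<^sub>R spray_vec L (x0, \<iota> u) = - fd (kf (u d)) x0 (\<iota> u)"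
proof (rule geodesic_killing[OF base_point killing_kf kf_\<iota>])
  fix w
  obtain w' where w: "w' \<in> \<mm>" "\<iota> w' = w" using \<iota>_surj[OF dec] by blast
  let ?b = "bracket_m G MG H \<mm> u w'"
  have b: "?b \<in> \<mm>" "fd (kf (w' d)) x0 (\<iota> u) - fd (kf (u d)) x0 w = - \<iota> ?b"
    using bracket_m(1)[OF dec u(1) w(1)] kf_bracket_m[OF dec u(1) w(1)] w(2) by (simp_all add: algebra_simps)
  have "vert (x0, \<iota> u) (\<iota> u) (\<iota> ?b) = 0"
    using geo[OF w(1)] fund_tensor_m[OF b(1) u(1)] vert_commute[OF base_point] by simp
  then have "fd L (x0, \<iota> u) (0, \<iota> ?b) = 0"
    using euler[OF base_point, of "\<iota> ?b"] by simp
  then have "fd L (x0, \<iota> u) (0, fd (kf (w' d)) x0 (\<iota> u) - fd (kf (u d)) x0 w) = 0"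
    unfolding b(2) using linear_neg[OF linear_L[OF base_point], of "(0, \<iota> ?b)"] by simp
  then show "\<exists>W. killing W \<and> W x0 = w \<and> fd L (x0, \<iota> u) (0, fd W x0 (\<iota> u) - fd (kf (u d)) x0 w) = 0"
    using killing_kf kf_\<iota> w(2) by metis
qed

abbreviation "conn_u \<equiv> conn (kf (u d)) (x0, \<iota> u)"

lemma koszul_m:
  assumes w: "w1 \<in> \<mm>" "w2 \<in> \<mm>" and a: "a \<in> \<mm>" "\<iota> a = conn_u (\<iota> w1)"
  shows "2 * fund_tensor N u a w2 = fund_tensor N u (bracket_m G MG H \<mm> u w1) w2
    + fund_tensor N u (bracket_m G MG H \<mm> w2 u) w1 + fund_tensor N u (bracket_m G MG H \<mm> w2 w1) u"
  using killing_koszul[OF base_point killing_kf kf_\<iota> geodesic_m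
      killing_kf[of "w1 d"] kf_\<iota>[of w1] killing_kf[of "w2 d"] kf_\<iota>[of w2]]
    w a u(1) bracket_m(1)[OF dec]
  by (simp add: fund_tensor_m kf_bracket_m[OF dec])

text \<open>Exchanging \<open>w1\<close> and \<open>w2\<close> in the Koszul formula swaps its first
  two terms up to sign and changes the sign of the third.\<close>

lemma koszul_m_skew:
  assumes w: "w1 \<in> \<mm>" "w2 \<in> \<mm>" and a: "a1 \<in> \<mm>" "\<iota> a1 = conn_u (\<iota> w1)" "a2 \<in> \<mm>" "\<iota> a2 = conn_u (\<iota> w2)"
  shows "fund_tensor N u a1 w2 = - fund_tensor N u w1 a2"
proof -
  let ?b = "bracket_m G MG H \<mm>"
  have anti: "fund_tensor N u (?b x y) z = - fund_tensor N u (?b y x) z" if "x \<in> \<mm>" "y \<in> \<mm>" "z \<in> \<mm>" for x y z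
  proof -
    \<comment> \<open>Antisymmetry is read off from \<open>kf_bracket_m\<close>, where exchanging
      the arguments visibly changes the sign.\<close>
    have "\<iota> (?b x y) = - \<iota> (?b y x)"
      unfolding kf_bracket_m[OF dec that(1,2), symmetric] kf_bracket_m[OF dec that(2,1), symmetric] by simp
    then show ?thesis
      using bracket_m(1)[OF dec] that by (simp add: fund_tensor_m vert_minus[OF base_point])
  qed
  have "fund_tensor N u w1 a2 = fund_tensor N u a2 w1"
    using vert_commute[OF base_point, of "\<iota> w1" "\<iota> a2"] w(1) a(3) by (simp add: fund_tensor_m)
  then show ?thesis
    using koszul_m[OF w a(1,2)] koszul_m[OF w(2,1) a(3,4)]
      anti[OF u(1) w(1,2)] anti[OF u(1) w(2,1)] anti[OF w u(1)] by simp
qed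

lemma riemann_curvature_chart:
  assumes v: "v \<in> \<mm>" and comm: "lie_bracket G MG u v = 0"
    and a: "a1 \<in> \<mm>" "\<iota> a1 = conn_u (\<iota> v)" "a2 \<in> \<mm>" "\<iota> a2 = conn_u (\<iota> a1)"
  shows "riemann_curvature M F H (to_origin G MG H M u) (to_origin G MG H M v) c = - \<iota> a2"
proof -
  have g: "u \<in> lie_algebra G MG" "v \<in> lie_algebra G MG" using u v complement_subset[OF dec] by auto
  have "fd (kf (v d)) x (kf (u d) x) = fd (kf (u d)) x (kf (v d) x)" if "x \<in> \<Omega>" for x
    using kf_bracket[OF that g] linear_0[OF linear_kf[OF that]] comm by simp
  from curv_killing[OF base_point killing_kf[of "u d"] kf_\<iota>[of u] killing_kf[of "v d"] kf_\<iota>[of v] geodesic_m this]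
  have "curv (x0, \<iota> u) (\<iota> v) = - \<iota> a2" using a by simp
  moreover have "(\<Sum>k\<in>UNIV. riemann_coeff L i k (x0, \<iota> u) * \<iota> v $ k) = curv (x0, \<iota> u) (\<iota> v) $ i" for i
    by (rule riemann_coeff_eq_curv[OF spray_axioms base_point])
  moreover have "(\<lambda>z. (in_chart M F c z)\<^sup>2) = L" by (simp add: L_def[abs_def])
  ultimately have "(\<Sum>k\<in>UNIV. riemann_coeff (\<lambda>z. (in_chart M F c z)\<^sup>2) i k (x0, \<iota> u) * \<iota> v $ k) = (- \<iota> a2) $ i" for i
    by simp
  then have "(\<chi> i. \<Sum>k\<in>UNIV. riemann_coeff (\<lambda>z. (in_chart M F c z)\<^sup>2) i k (x0, \<iota> u) * \<iota> v $ k) = - \<iota> a2"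
    by (subst vec_eq_iff) simp
  then show ?thesis
    using c by (simp add: riemann_curvature_def x0_def[symmetric] to_origin_\<iota>[OF g(1)] to_origin_\<iota>[OF g(2)])
qed

end

end

theorem theorem4p1:
  fixes G :: "'g monoid"
    and MG :: "('g, 'e::euclidean_space) manifold"
    and H :: "'g set"
    and M :: "('g set, real^'n) manifold"
    and F :: "'g set \<Rightarrow> ('g set, real^'n) tvec \<Rightarrow> real"
    and \<mm> :: "('g, 'e) tvec set"
    and u v :: "('g, 'e) tvec"
  defines "N \<equiv> norm_m G MG H M F"
  defines "U \<equiv> U_map G MG H \<mm> N u"
  assumes "lie_group G MG" and "connected_space (mtop MG)"
    and "subgroup H G" and "compactin (mtop MG) H"
    and "coset_manifold G MG H M"
    and "finsler_metric M F" and "invariant_metric G M F"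
    and "invariant_decomposition G MG H \<mm>"
    and "u \<in> \<mm>" and "v \<in> \<mm>"
    and "u \<noteq> v" and "independent {u, v}"
    and "lie_bracket G MG u v = 0"
    and "\<forall>w\<in>\<mm>. fund_tensor N u (bracket_m G MG H \<mm> u w) u = 0"
  shows "flag_curvature M F H (to_origin G MG H M u) (to_origin G MG H M v) =
           fund_tensor N u (U u v) (U u v) /
           (fund_tensor N u u u * fund_tensor N u v v - fund_tensor N u u v * fund_tensor N u u v)"
proof -
  note lie = assms(3) and H = assms(5) and coset = assms(7) and finsler = assms(8) and invariant = assms(9)
    and dec = assms(10) and u = assms(11) and v = assms(12) and comm = assms(15) and geo = assms(16)
  have u0: "u \<noteq> 0" using \<open>independent {u, v}\<close> dependent_zero[of "{u, v}"] by auto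
  have geo': "fund_tensor (norm_m G MG H M F) u (bracket_m G MG H \<mm> u w) u = 0" if "w \<in> \<mm>" for w
    using geo that by (simp add: N_def)
  have group: "group G" and MG: "smooth_manifold MG" and topMG: "topspace (mtop MG) = carrier G"
    using lie by (auto simp: lie_group_def)
  have M: "smooth_manifold M" and topM: "topspace (mtop M) = lcosets\<^bsub>G\<^esub> H"
    using coset by (auto simp: coset_manifold_def)
  have "\<exists>d. d \<in> charts_at MG \<one>\<^bsub>G\<^esub>"
    by (intro charts_at_nonempty[OF MG]) (simp add: topMG monoid.one_closed group.is_monoid[OF group])
  then obtain d where d: "d \<in> charts_at MG \<one>\<^bsub>G\<^esub>" by blast
  have "H \<in> lcosets\<^bsub>G\<^esub> H"
    using group.lcos_mult_one[OF group subgroup.subset[OF H]] group.is_monoid[OF group]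
    unfolding LCOSETS_def by (metis (mono_tags, lifting) UN_iff monoid.one_closed singletonI)
  then have "\<exists>c. c \<in> charts_at M H" by (intro charts_at_nonempty[OF M]) (simp add: topM)
  then obtain c0 where c0: "c0 \<in> charts_at M H" by blast
  have chart: "finsler_chart G MG d H M c F" if "c \<in> charts_at M H" for c
    using lie d H coset that finsler invariant
    by (intro finsler_chart.intro coset_chart.intro lie_chart.intro coset_chart_axioms.intro finsler_chart_axioms.intro)
  interpret f: finsler_chart G MG d H M c0 F by (rule chart[OF c0])
  have Nf: "f.N = N" by (simp add: N_def)
  note fix_u = dec u u0 geo'
  have lift: "\<exists>a\<in>\<mm>. f.\<iota> a = y" for y by (rule f.\<iota>_surj[OF dec])
  \<comment> \<open>\<open>a1\<close> and \<open>a2\<close> represent in the complement the first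
    and second covariant derivatives of the field of \<open>v\<close>.\<close>
  obtain a1 where a1: "a1 \<in> \<mm>" "f.\<iota> a1 = f.conn (f.kf (u d)) (f.x0, f.\<iota> u) (f.\<iota> v)" using lift by blast
  obtain a2 where a2: "a2 \<in> \<mm>" "f.\<iota> a2 = f.conn (f.kf (u d)) (f.x0, f.\<iota> u) (f.\<iota> a1)" using lift by blast
  note alg = f.complement_subset[OF dec]
  have \<iota>u: "f.\<iota> u \<noteq> 0" by (rule f.\<iota>_u[OF fix_u])
  \<comment> \<open>As \<open>[u, v] = 0\<close>, the first Koszul term vanishes and the rest is the
    condition that defines \<open>U u v\<close>.\<close>
  have bracket_0: "fund_tensor N u (bracket_m G MG H \<mm> u v) w = 0" if "w \<in> \<mm>" for w
  proof -
    have "f.\<iota> (bracket_m G MG H \<mm> u v) = 0"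
      using f.bracket_m(2)[OF dec u v] comm linear_0[OF f.linear_\<iota>] by simp
    then show ?thesis
      using f.fund_tensor_m[OF fix_u f.bracket_m(1)[OF dec u v] that] linear_0[OF f.vert_linear[OF f.base_point[OF fix_u]]]
      by (simp add: N_def)
  qed
  have Uuv: "U u v = a1"
    unfolding U_def U_map_def
  proof (rule the_equality)
    have 1: "fund_tensor N u a1 w = 1 / 2 * (fund_tensor N u (bracket_m G MG H \<mm> w u) v + fund_tensor N u (bracket_m G MG H \<mm> w v) u)"
      if "w \<in> \<mm>" for w
      using f.koszul_m[OF fix_u v that a1] bracket_0[OF that] by (simp add: N_def)
    then show "a1 \<in> \<mm> \<and> (\<forall>w\<in>\<mm>. fund_tensor N u a1 w = 1 / 2 * (fund_tensor N u (bracket_m G MG H \<mm> w u) v + fund_tensor N u (bracket_m G MG H \<mm> w v) u))"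
      using a1(1) by blast
    fix z assume z: "z \<in> \<mm> \<and> (\<forall>w\<in>\<mm>. fund_tensor N u z w = 1 / 2 * (fund_tensor N u (bracket_m G MG H \<mm> w u) v + fund_tensor N u (bracket_m G MG H \<mm> w v) u))"
    then have "fund_tensor N u z w = fund_tensor N u a1 w" if "w \<in> \<mm>" for w
      using 1[OF that] that by metis
    then show "z = a1"
      using f.fund_tensor_m_eqI[OF fix_u _ a1(1), folded N_def] z by blast
  qed
  have R: "riemann_curvature M F H (to_origin G MG H M u) (to_origin G MG H M v) = - to_origin G MG H M a2"
  proof
    fix c
    show "riemann_curvature M F H (to_origin G MG H M u) (to_origin G MG H M v) c = (- to_origin G MG H M a2) c"
    proof (cases "c \<in> charts_at M H")
      case True
      interpret h: finsler_chart G MG d H M c F by (rule chart[OF True])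
      \<comment> \<open>Both lifts satisfy the same Koszul formula, and a vector of the complement
        is determined by its pairings.\<close>
      have same: "a = b" if a: "a \<in> \<mm>" "f.\<iota> a = f.conn (f.kf (u d)) (f.x0, f.\<iota> u) (f.\<iota> w)"
        and b: "b \<in> \<mm>" "h.\<iota> b = h.conn (h.kf (u d)) (h.x0, h.\<iota> u) (h.\<iota> w)" and w: "w \<in> \<mm>" for a b w
      proof (rule f.fund_tensor_m_eqI[OF fix_u a(1) b(1)])
        fix w' assume w': "w' \<in> \<mm>"
        show "fund_tensor f.N u a w' = fund_tensor f.N u b w'"
          using f.koszul_m[OF fix_u w w' a] h.koszul_m[OF fix_u w w' b] by simp
      qed
      obtain b1 where b1: "b1 \<in> \<mm>" "h.\<iota> b1 = h.conn (h.kf (u d)) (h.x0, h.\<iota> u) (h.\<iota> v)" using h.\<iota>_surj[OF dec] by blast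
      obtain b2 where b2: "b2 \<in> \<mm>" "h.\<iota> b2 = h.conn (h.kf (u d)) (h.x0, h.\<iota> u) (h.\<iota> b1)" using h.\<iota>_surj[OF dec] by blast
      have "a1 = b1" by (rule same[OF a1 b1 v])
      moreover from this have "a2 = b2" using same[OF a2, of b2] b2 a1(1) by simp
      ultimately show ?thesis
        using h.riemann_curvature_chart[OF fix_u v comm b1 b2] h.to_origin_\<iota>[OF alg[OF a2(1)]] by simp
    next
      case False
      then show ?thesis
        using f.to_origin_tangent_space[OF alg[OF a2(1)]] tangent_spaceD(2)[OF M] by (simp add: riemann_curvature_def)
    qed
  qed
  have sub: "subspace (tangent_space M H)" by (rule subspace_tangent_space[OF M f.H_top])
  have t: "to_origin G MG H M w \<in> tangent_space M H" if "w \<in> \<mm>" for w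
    by (rule f.to_origin_tangent_space[OF alg[OF that]])
  have "fund_tensor (F H) (to_origin G MG H M u) (- to_origin G MG H M a2) (to_origin G MG H M v) = - fund_tensor N u a2 v"
    using f.fund_tensor_origin[OF t[OF u] subspace_neg[OF sub t[OF a2(1)]] t[OF v]] \<iota>u
      f.vert_minus[OF f.base_point[OF fix_u]] f.fund_tensor_m[OF fix_u a2(1) v]
    by (simp add: f.to_origin_\<iota> alg u v a2(1) N_def)
  \<comment> \<open>Skewness moves one \<open>A\<close> across the pairing: \<open>a2 = A a1\<close>
    paired with \<open>v\<close> is minus \<open>a1\<close> paired with
    \<open>A v = a1\<close>.\<close>
  also have "\<dots> = fund_tensor N u a1 a1"
    using f.koszul_m_skew[OF fix_u a1(1) v a2 a1] by (simp add: N_def)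
  finally have num: "fund_tensor (F H) (to_origin G MG H M u) (- to_origin G MG H M a2) (to_origin G MG H M v) = fund_tensor N u a1 a1" .
  have den: "fund_tensor (F H) (to_origin G MG H M u) (to_origin G MG H M a) (to_origin G MG H M b) = fund_tensor N u a b"
    if "a \<in> \<mm>" "b \<in> \<mm>" for a b
    using f.fund_tensor_to_origin[OF alg[OF u] alg[OF that(1)] alg[OF that(2)] \<iota>u] by (simp add: N_def)
  show ?thesis
    unfolding flag_curvature_def R num Uuv by (simp add: den u v power2_eq_square)
qed

end
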